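(* Let $0<\theta<1$ and $c(\theta)=(\theta^{\theta}(1-\theta)^{1-\theta})^{-1}$. Let $A$ be a $C^*$-algebra. Then for any complete contraction $u\colon A\to R[\theta]=(C,R)_\theta$, there are states $f,g$ on $A$ such that $$\forall a\in A\qquad \|ua\|\le c(\theta)\, f(a^*a)^{\frac{1-\theta}{2}}\, g(aa^* )^{\frac{\theta}{2}}.$$
   Context: An operator space is a Banach space given with an isometric embedding in $B(\mathcal H)$ for some Hilbert space $\mathcal H$. A map $u$ between operator spaces is completely bounded if $\|u\|_{cb}=\sup_n\|\mathrm{id}_{M_n}\otimes u\|<\infty$, and is a complete contraction if $\|u\|_{cb}\le 1$. The row and column spaces are $R=\overline{\mathrm{span}}\{e_{1j}\mid j\ge1\}$ and $C=\overline{\mathrm{span}}\{e_{i1}\mid i\ge1\}$ in $B(\ell_2)$, with the operator space structures induced by $B(\ell_2)$; both are isometric to $\ell_2$. View $(C,R)$ as a compatible couple by means of the transposition map $e_{i1}\leftrightarrow e_{1i}$. Then $R[\theta]=(C,R)_\theta$ is the complex interpolation space with the operator space structure determined by $M_n(R[\theta])=(M_n(C),M_n(R))_\theta$ isometrically for all $n\ge1$. It is isometric to $\ell_2$ as a Banach space. Explicitly, if $(e_i(\theta))$ is an orthonormal basis of $R[\theta]$, then for any finite sequence $(a_i)$ in $B(\ell_2)$, $$\Big\|\sum a_i\otimes e_i(\theta)\Big\|_{\min}=\sup\Big\{\Big(\sum\|s^\theta a_i t^{1-\theta}\|_2^2\Big)^{1/2}\ \Big|\ s,t\ge0,\ \|s\|_2\le1,\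 \|t\|_2\le1\Big\},$$ where $\|\cdot\|_2$ is the Hilbert–Schmidt norm. The norm $\|ua\|$ is the Hilbert space norm of $R[\theta]\simeq\ell_2$. *)

theory Defs
  imports "HOL-Analysis.Analysis" "HOL-Library.Function_Algebras"
begin

section \<open>Complex vector spaces, Hilbert spaces, C*-algebras\<close>

class scaleC =
  fixes scaleC :: "complex \<Rightarrow> 'a \<Rightarrow> 'a"  (infixr "*\<^sub>C" 75)

class complex_vector = ab_group_add + scaleC +
  assumes scaleC_add_right: "c *\<^sub>C (x + y) = c *\<^sub>C x + c *\<^sub>C y"
    and scaleC_add_left: "(c + d) *\<^sub>C x = c *\<^sub>C x + d *\<^sub>C x"
    and scaleC_scaleC: "c *\<^sub>C d *\<^sub>C x = (c * d) *\<^sub>C x"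
    and scaleC_one: "1 *\<^sub>C x = x"

class complex_normed_vector = real_normed_vector + complex_vector +
  assumes scaleR_scaleC: "scaleR r x = complex_of_real r *\<^sub>C x"
    and norm_scaleC: "norm (c *\<^sub>C x) = cmod c * norm x"

class complex_banach = complex_normed_vector + banach

text \<open>The inner product is linear in the second argument.\<close>

class complex_hilbert = complex_banach +
  fixes cinner :: "'a \<Rightarrow> 'a \<Rightarrow> complex"
  assumes cinner_commute: "cinner x y = cnj (cinner y x)"
    and cinner_add_right: "cinner x (y + z) = cinner x y + cinner x z"
    and cinner_scaleC_right: "cinner x (c *\<^sub>C y) = c * cinner x y"
    and cinner_self: "cinner x x = complex_of_real ((norm x)\<^sup>2)"

text \<open>C*-algebras are not assumed to be unital, nor to be nonzero.\<close>

class cstar_algebra = complex_banach + real_normed_algebra +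
  fixes star :: "'a \<Rightarrow> 'a"
  assumes mult_scaleC_left: "(c *\<^sub>C x) * y = c *\<^sub>C (x * y)"
    and mult_scaleC_right: "x * (c *\<^sub>C y) = c *\<^sub>C (x * y)"
    and star_star: "star (star x) = x"
    and star_add: "star (x + y) = star x + star y"
    and star_scaleC: "star (c *\<^sub>C x) = cnj c *\<^sub>C star x"
    and star_mult: "star (x * y) = star y * star x"
    and cstar_identity: "norm (star x * x) = (norm x)\<^sup>2"

global_interpretation complex_vector:
  vector_space "scaleC :: complex \<Rightarrow> 'a \<Rightarrow> 'a::complex_vector"
  defines cspan = complex_vector.span
  by unfold_locales
    (simp_all add: scaleC_add_right scaleC_add_left scaleC_scaleC scaleC_one)

abbreviation clinear :: "('a::complex_vector \<Rightarrow> 'b::complex_vector) \<Rightarrow> bool" where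
  "clinear \<equiv> Vector_Spaces.linear scaleC scaleC"

lemma clinearI:
  fixes f :: "'a::complex_vector \<Rightarrow> 'b::complex_vector"
  assumes "\<And>x y. f (x + y) = f x + f y" and "\<And>c x. f (c *\<^sub>C x) = c *\<^sub>C f x"
  shows "clinear f"
  using assms by unfold_locales auto

instantiation complex :: complex_hilbert
begin
definition scaleC_complex :: "complex \<Rightarrow> complex \<Rightarrow> complex" where
  "scaleC_complex c z = c * z"
definition cinner_complex :: "complex \<Rightarrow> complex \<Rightarrow> complex" where
  "cinner_complex w z = cnj w * z"
instance
proof
  fix x :: complex
  show "cinner x x = complex_of_real ((norm x)\<^sup>2)"
    unfolding cinner_complex_def using complex_norm_square [of x]
    by (simp add: mult.commute)
qed (simp_all add: scaleC_complex_def cinner_complex_def algebra_simps norm_mult scaleR_conv_of_real)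
end

instantiation complex :: cstar_algebra
begin
definition star_complex :: "complex \<Rightarrow> complex" where "star_complex = cnj"
instance
  by standard (simp_all add: scaleC_complex_def star_complex_def norm_mult power2_eq_square)
end

instantiation "fun" :: (type, complex_vector) complex_vector
begin
definition scaleC_fun :: "complex \<Rightarrow> ('a \<Rightarrow> 'b) \<Rightarrow> 'a \<Rightarrow> 'b" where
  "scaleC_fun c f = (\<lambda>x. c *\<^sub>C f x)"
instance
  by standard
    (simp_all add: scaleC_fun_def fun_eq_iff scaleC_add_right scaleC_add_left scaleC_scaleC scaleC_one)
end

lemma bounded_linear_scaleC_right:
  "bounded_linear (\<lambda>x::'a::complex_normed_vector. c *\<^sub>C x)"
  by (rule bounded_linear_intro [where K = "cmod c"])
    (simp_all add: scaleC_add_right scaleR_scaleC scaleC_scaleC mult.commute norm_scaleC)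

instantiation blinfun :: (real_normed_vector, complex_normed_vector) complex_normed_vector
begin
lift_definition scaleC_blinfun :: "complex \<Rightarrow> ('a \<Rightarrow>\<^sub>L 'b) \<Rightarrow> ('a \<Rightarrow>\<^sub>L 'b)"
  is "\<lambda>c f x. c *\<^sub>C f x"
  by (rule bounded_linear_compose [OF bounded_linear_scaleC_right])
instance
proof
  fix c d :: complex and r :: real and f g :: "'a \<Rightarrow>\<^sub>L 'b"
  show "c *\<^sub>C (f + g) = c *\<^sub>C f + c *\<^sub>C g" by transfer (simp add: scaleC_add_right)
  show "(c + d) *\<^sub>C f = c *\<^sub>C f + d *\<^sub>C f" by transfer (simp add: scaleC_add_left)
  show "c *\<^sub>C d *\<^sub>C f = (c * d) *\<^sub>C f" by transfer (simp add: scaleC_scaleC)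
  show "1 *\<^sub>C f = f" by transfer (simp add: scaleC_one)
  show "scaleR r f = complex_of_real r *\<^sub>C f" by transfer (simp add: scaleR_scaleC)
  show "norm (c *\<^sub>C f) = cmod c * norm f"
  proof transfer
    fix c :: complex and f :: "'a \<Rightarrow> 'b"
    assume f: "bounded_linear f"
    have "onorm (\<lambda>x. cmod c *\<^sub>R f x) = \<bar>cmod c\<bar> * onorm f" by (rule onorm_scaleR [OF f])
    then show "onorm (\<lambda>x. c *\<^sub>C f x) = cmod c * onorm f"
      by (simp add: onorm_def norm_scaleC)
  qed
qed
end

instance blinfun :: (real_normed_vector, complex_banach) complex_banach ..

section \<open>The Hilbert space of square summable sequences\<close>

typedef ell2 = "{x :: nat \<Rightarrow> complex. summable (\<lambda>i. (cmod (x i))\<^sup>2)}"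
  morphisms coord Abs_ell2
  by (rule exI [of _ "\<lambda>_. 0"]) simp

setup_lifting type_definition_ell2

lemma summable_coord: "summable (\<lambda>i. (cmod (coord x i))\<^sup>2)"
  using coord [of x] by simp

lemma square_summable_iff:
  fixes a :: "nat \<Rightarrow> complex"
  shows "summable (\<lambda>i. (cmod (a i))\<^sup>2) \<longleftrightarrow> (\<exists>B. \<forall>m. L2_set (\<lambda>i. cmod (a i)) {..<m} \<le> B)"
proof
  assume s: "summable (\<lambda>i. (cmod (a i))\<^sup>2)"
  show "\<exists>B. \<forall>m. L2_set (\<lambda>i. cmod (a i)) {..<m} \<le> B"
    unfolding L2_set_def
    by (intro exI [of _ "sqrt (\<Sum>i. (cmod (a i))\<^sup>2)"] allI real_sqrt_le_mono sum_le_suminf s) auto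
next
  assume "\<exists>B. \<forall>m. L2_set (\<lambda>i. cmod (a i)) {..<m} \<le> B"
  then obtain B where B: "\<And>m. L2_set (\<lambda>i. cmod (a i)) {..<m} \<le> B" by blast
  show "summable (\<lambda>i. (cmod (a i))\<^sup>2)"
  proof (rule summableI_nonneg_bounded [where x = "B\<^sup>2"])
    fix m
    have "(L2_set (\<lambda>i. cmod (a i)) {..<m})\<^sup>2 \<le> B\<^sup>2"
      by (rule power_mono [OF B]) (rule L2_set_nonneg)
    then show "(\<Sum>i<m. (cmod (a i))\<^sup>2) \<le> B\<^sup>2"
      by (simp add: L2_set_def sum_nonneg)
  qed simp
qed

lemma square_summable_add:
  fixes a b :: "nat \<Rightarrow> complex"
  assumes a: "summable (\<lambda>i. (cmod (a i))\<^sup>2)" and b: "summable (\<lambda>i. (cmod (b i))\<^sup>2)"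
  shows "summable (\<lambda>i. (cmod (a i + b i))\<^sup>2)"
proof -
  obtain A B where A: "\<And>m. L2_set (\<lambda>i. cmod (a i)) {..<m} \<le> A"
    and B: "\<And>m. L2_set (\<lambda>i. cmod (b i)) {..<m} \<le> B"
    using a b unfolding square_summable_iff by blast
  have "L2_set (\<lambda>i. cmod (a i + b i)) {..<m} \<le> A + B" for m
  proof -
    have "L2_set (\<lambda>i. cmod (a i + b i)) {..<m} \<le> L2_set (\<lambda>i. cmod (a i) + cmod (b i)) {..<m}"
      by (rule L2_set_mono) (auto intro: norm_triangle_ineq)
    also have "\<dots> \<le> L2_set (\<lambda>i. cmod (a i)) {..<m} + L2_set (\<lambda>i. cmod (b i)) {..<m}"
      by (rule L2_set_triangle_ineq)
    finally show ?thesis using A [of m] B [of m] by linarith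
  qed
  then show ?thesis unfolding square_summable_iff by blast
qed

lemma square_summable_scale:
  fixes a :: "nat \<Rightarrow> complex"
  assumes "summable (\<lambda>i. (cmod (a i))\<^sup>2)"
  shows "summable (\<lambda>i. (cmod (c * a i))\<^sup>2)"
  using summable_mult [OF assms, of "(cmod c)\<^sup>2"] by (simp add: norm_mult power_mult_distrib)

lemma summable_mult_square_summable:
  fixes a b :: "nat \<Rightarrow> complex"
  assumes "summable (\<lambda>i. (cmod (a i))\<^sup>2)" and "summable (\<lambda>i. (cmod (b i))\<^sup>2)"
  shows "summable (\<lambda>i. a i * b i)"
proof (rule summable_comparison_test' [OF summable_add [OF assms], where N = 0])
  fix n
  have "0 \<le> (cmod (a n) - cmod (b n))\<^sup>2" "0 \<le> cmod (a n) * cmod (b n)" by auto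
  then show "norm (a n * b n) \<le> (cmod (a n))\<^sup>2 + (cmod (b n))\<^sup>2"
    unfolding norm_mult power2_diff by linarith
qed

instantiation ell2 :: complex_vector
begin
lift_definition zero_ell2 :: ell2 is "\<lambda>_. 0" by simp
lift_definition plus_ell2 :: "ell2 \<Rightarrow> ell2 \<Rightarrow> ell2" is "\<lambda>x y i. x i + y i"
  by (rule square_summable_add)
lift_definition uminus_ell2 :: "ell2 \<Rightarrow> ell2" is "\<lambda>x i. - x i" by simp
lift_definition minus_ell2 :: "ell2 \<Rightarrow> ell2 \<Rightarrow> ell2" is "\<lambda>x y i. x i - y i"
  subgoal for x y using square_summable_add [of x "\<lambda>i. - y i"] by simp
  done
lift_definition scaleC_ell2 :: "complex \<Rightarrow> ell2 \<Rightarrow> ell2" is "\<lambda>c x i. c * x i"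
  by (rule square_summable_scale)
instance
  by standard (transfer; simp add: algebra_simps)+
end

lemma coord_simps [simp]:
  "coord 0 i = 0" "coord (x + y) i = coord x i + coord y i" "coord (- x) i = - coord x i"
  "coord (x - y) i = coord x i - coord y i" "coord (c *\<^sub>C x) i = c * coord x i"
  by (transfer; simp)+

lemma ell2_eqI: "(\<And>i. coord x i = coord y i) \<Longrightarrow> x = y"
  by transfer auto

instantiation ell2 :: real_normed_vector
begin
definition scaleR_ell2 :: "real \<Rightarrow> ell2 \<Rightarrow> ell2" where
  "scaleR_ell2 r x = complex_of_real r *\<^sub>C x"
definition norm_ell2 :: "ell2 \<Rightarrow> real" where
  "norm_ell2 x = sqrt (\<Sum>i. (cmod (coord x i))\<^sup>2)"
definition dist_ell2 :: "ell2 \<Rightarrow> ell2 \<Rightarrow> real" where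
  "dist_ell2 x y = norm (x - y)"
definition sgn_ell2 :: "ell2 \<Rightarrow> ell2" where
  "sgn_ell2 x = inverse (norm x) *\<^sub>R x"
definition uniformity_ell2 :: "(ell2 \<times> ell2) filter" where
  "uniformity_ell2 = (INF e\<in>{0<..}. principal {(x, y). dist x y < e})"
definition open_ell2 :: "ell2 set \<Rightarrow> bool" where
  "open_ell2 S = (\<forall>x\<in>S. \<forall>\<^sub>F (x', y) in uniformity. x' = x \<longrightarrow> y \<in> S)"

lemma L2_set_coord_le_norm: "L2_set (\<lambda>i. cmod (coord x i)) {..<m} \<le> norm x"
  unfolding norm_ell2_def L2_set_def
  by (intro real_sqrt_le_mono sum_le_suminf summable_coord) auto

lemma norm_ell2_leI:
  assumes "\<And>m. L2_set (\<lambda>i. cmod (coord x i)) {..<m} \<le> B"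
  shows "norm x \<le> B"
proof (rule LIMSEQ_le_const2)
  show "(\<lambda>m. L2_set (\<lambda>i. cmod (coord x i)) {..<m}) \<longlonglongrightarrow> norm x"
    unfolding norm_ell2_def L2_set_def
    by (intro tendsto_real_sqrt summable_LIMSEQ summable_coord)
qed (use assms in auto)

instance
proof
  fix x y :: ell2 and a b :: real
  show "(norm x = 0) = (x = 0)"
  proof
    assume "norm x = 0"
    then have "(\<Sum>i. (cmod (coord x i))\<^sup>2) = 0" by (simp add: norm_ell2_def)
    then have "\<forall>i. (cmod (coord x i))\<^sup>2 = 0"
      using suminf_eq_zero_iff [OF summable_coord] by simp
    then show "x = 0" by (intro ell2_eqI) simp
  qed (simp add: norm_ell2_def)
  show "norm (x + y) \<le> norm x + norm y"
  proof (rule norm_ell2_leI)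
    fix m
    have "L2_set (\<lambda>i. cmod (coord (x + y) i)) {..<m}
        \<le> L2_set (\<lambda>i. cmod (coord x i) + cmod (coord y i)) {..<m}"
      by (rule L2_set_mono) (auto intro: norm_triangle_ineq)
    also have "\<dots> \<le> L2_set (\<lambda>i. cmod (coord x i)) {..<m} + L2_set (\<lambda>i. cmod (coord y i)) {..<m}"
      by (rule L2_set_triangle_ineq)
    also have "\<dots> \<le> norm x + norm y" by (intro add_mono L2_set_coord_le_norm)
    finally show "L2_set (\<lambda>i. cmod (coord (x + y) i)) {..<m} \<le> norm x + norm y" .
  qed
  show "norm (a *\<^sub>R x) = \<bar>a\<bar> * norm x"
    by (simp add: norm_ell2_def scaleR_ell2_def norm_mult power_mult_distrib
        suminf_mult [OF summable_coord] real_sqrt_mult)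
qed (simp_all add: dist_ell2_def sgn_ell2_def uniformity_ell2_def open_ell2_def scaleR_ell2_def
      complex_vector.scale_right_distrib complex_vector.scale_left_distrib)
end

lemma cmod_coord_le_norm: "cmod (coord x i) \<le> norm x"
proof -
  have "cmod (coord x i) \<le> L2_set (\<lambda>i. cmod (coord x i)) {..<Suc i}"
    by (rule member_le_L2_set) auto
  also have "\<dots> \<le> norm x" by (rule L2_set_coord_le_norm)
  finally show ?thesis .
qed

instantiation ell2 :: complex_hilbert
begin
definition cinner_ell2 :: "ell2 \<Rightarrow> ell2 \<Rightarrow> complex" where
  "cinner_ell2 x y = (\<Sum>i. cnj (coord x i) * coord y i)"

lemma summable_cinner_ell2: "summable (\<lambda>i. cnj (coord x i) * coord y i)"
  by (rule summable_mult_square_summable) (simp_all add: summable_coord)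

instance
proof
  fix x y z :: ell2 and c :: complex and r :: real
  show "scaleR r x = complex_of_real r *\<^sub>C x" by (simp add: scaleR_ell2_def)
  show "norm (c *\<^sub>C x) = cmod c * norm x"
    by (simp add: norm_ell2_def norm_mult power_mult_distrib
        suminf_mult [OF summable_coord] real_sqrt_mult)
  show "cinner x y = cnj (cinner y x)"
  proof -
    have "(\<lambda>i. cnj (coord y i) * coord x i) sums cinner y x"
      unfolding cinner_ell2_def by (rule summable_sums [OF summable_cinner_ell2])
    then have "(\<lambda>i. cnj (cnj (coord y i) * coord x i)) sums cnj (cinner y x)"
      by (simp only: sums_cnj)
    then have "(\<lambda>i. cnj (coord x i) * coord y i) sums cnj (cinner y x)"
      by (simp add: mult.commute)
    then show ?thesis unfolding cinner_ell2_def [of x y] by (rule sums_unique [symmetric])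
  qed
  show "cinner x (y + z) = cinner x y + cinner x z"
    using suminf_add [OF summable_cinner_ell2 [of x y] summable_cinner_ell2 [of x z]]
    by (simp add: cinner_ell2_def algebra_simps)
  show "cinner x (c *\<^sub>C y) = c * cinner x y"
    using suminf_mult [OF summable_cinner_ell2 [of x y], of c]
    by (simp add: cinner_ell2_def algebra_simps)
  show "cinner x x = complex_of_real ((norm x)\<^sup>2)"
  proof -
    have "(norm x)\<^sup>2 = (\<Sum>i. (cmod (coord x i))\<^sup>2)"
      unfolding norm_ell2_def by (simp add: suminf_nonneg [OF summable_coord])
    moreover have "cnj (coord x i) * coord x i = complex_of_real ((cmod (coord x i))\<^sup>2)" for i
      using complex_norm_square [of "coord x i"] by (simp add: mult.commute)
    ultimately show ?thesis
      using suminf_of_real [OF summable_coord [of x], where 'a = complex]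
      by (simp add: cinner_ell2_def)
  qed
next
  fix X :: "nat \<Rightarrow> ell2"
  assume X: "Cauchy X"
  have "Cauchy (\<lambda>n. coord (X n) i)" for i
  proof (rule metric_CauchyI)
    fix e :: real assume "0 < e"
    then obtain M where "\<forall>m\<ge>M. \<forall>n\<ge>M. dist (X m) (X n) < e"
      using metric_CauchyD [OF X] by blast
    moreover have "dist (coord (X m) i) (coord (X n) i) \<le> dist (X m) (X n)" for m n
      using cmod_coord_le_norm [of "X m - X n" i] by (simp add: dist_norm)
    ultimately show "\<exists>M. \<forall>m\<ge>M. \<forall>n\<ge>M. dist (coord (X m) i) (coord (X n) i) < e"
      by (meson le_less_trans)
  qed
  then have "\<exists>l. (\<lambda>n. coord (X n) i) \<longlonglongrightarrow> l" for i
    by (simp add: Cauchy_convergent_iff convergent_def)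
  then obtain l where l: "\<And>i. (\<lambda>n. coord (X n) i) \<longlonglongrightarrow> l i" by metis
  have bound: "L2_set (\<lambda>i. cmod (coord (X n) i - l i)) {..<k} \<le> e"
    if M: "\<And>m n. m \<ge> M \<Longrightarrow> n \<ge> M \<Longrightarrow> norm (X n - X m) < e" and n: "n \<ge> M" for M n k e
  proof (rule LIMSEQ_le_const2)
    show "(\<lambda>m. L2_set (\<lambda>i. cmod (coord (X n - X m) i)) {..<k})
        \<longlonglongrightarrow> L2_set (\<lambda>i. cmod (coord (X n) i - l i)) {..<k}"
      unfolding L2_set_def coord_simps by (intro tendsto_intros l)
    show "\<exists>N. \<forall>m\<ge>N. L2_set (\<lambda>i. cmod (coord (X n - X m) i)) {..<k} \<le> e"
    proof (intro exI [of _ M] allI impI)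
      fix m assume "M \<le> m"
      from M [OF this n] L2_set_coord_le_norm [of "X n - X m" k]
      show "L2_set (\<lambda>i. cmod (coord (X n - X m) i)) {..<k} \<le> e" by linarith
    qed
  qed
  have M: "\<exists>M. \<forall>m\<ge>M. \<forall>n\<ge>M. norm (X n - X m) < e" if "0 < e" for e
    using metric_CauchyD [OF X that] by (simp add: dist_norm) blast
  have summ: "summable (\<lambda>i. (cmod (l i))\<^sup>2)"
  proof -
    obtain M where "\<And>m n. m \<ge> M \<Longrightarrow> n \<ge> M \<Longrightarrow> norm (X n - X m) < 1"
      using M [of 1] by auto
    then have "summable (\<lambda>i. (cmod (coord (X M) i - l i))\<^sup>2)"
      unfolding square_summable_iff using bound by blast
    then have "summable (\<lambda>i. (cmod (- coord (X M) i + (coord (X M) i - l i)))\<^sup>2)"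
      by (intro square_summable_add) (simp_all add: summable_coord)
    then show ?thesis by simp
  qed
  define L where "L = Abs_ell2 l"
  have L: "coord L i = l i" for i
    unfolding L_def using summ by (simp add: Abs_ell2_inverse)
  have "X \<longlonglongrightarrow> L"
  proof (rule metric_LIMSEQ_I)
    fix e :: real assume e: "0 < e"
    then obtain M where M': "\<And>m n. m \<ge> M \<Longrightarrow> n \<ge> M \<Longrightarrow> norm (X n - X m) < e / 2"
      using M [of "e / 2"] by auto
    have "norm (X n - L) \<le> e / 2" if "n \<ge> M" for n
      by (rule norm_ell2_leI) (use bound [OF M' that] in \<open>simp add: L\<close>)
    then show "\<exists>M. \<forall>n\<ge>M. dist (X n) L < e"
      using e by (intro exI [of _ M]) (fastforce simp: dist_norm)
  qed
  then show "convergent X" by (auto simp: convergent_def)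
qed
end

lift_definition unit_vec :: "nat \<Rightarrow> ell2" is "\<lambda>k i. if i = k then 1 else 0"
  subgoal for k using summable_finite [of "{k}" "\<lambda>i. (cmod (if i = k then 1 else 0))\<^sup>2"] by simp
  done

lemma coord_unit_vec [simp]: "coord (unit_vec k) i = (if i = k then 1 else 0)"
  by transfer simp

lifting_forget ell2.lifting

section \<open>Rows and columns\<close>

lift_definition matrix_unit :: "nat \<Rightarrow> nat \<Rightarrow> ell2 \<Rightarrow>\<^sub>L ell2"
  is "\<lambda>i j \<xi>. coord \<xi> j *\<^sub>C unit_vec i"
  subgoal for i j
    by (rule bounded_linear_intro [where K = "norm (unit_vec i)"])
      (simp_all add: scaleC_add_left scaleR_scaleC scaleC_scaleC norm_scaleC
        mult_right_mono cmod_coord_le_norm)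
  done

definition column_space :: "(ell2 \<Rightarrow>\<^sub>L ell2) set" where
  "column_space = closure (cspan (range (\<lambda>i. matrix_unit i 0)))"

definition row_space :: "(ell2 \<Rightarrow>\<^sub>L ell2) set" where
  "row_space = closure (cspan (range (\<lambda>j. matrix_unit 0 j)))"

text \<open>
  The norm convergent series below identify the space of square summable sequences isometrically
  with the column space and with the row space. The transposition map sends \<^term>\<open>col_op x\<close> to
  \<^term>\<open>row_op x\<close>, so in these coordinates it is the identity.
\<close>

definition col_op :: "ell2 \<Rightarrow> ell2 \<Rightarrow>\<^sub>L ell2" where
  "col_op x = (\<Sum>i. coord x i *\<^sub>C matrix_unit i 0)"

definition row_op :: "ell2 \<Rightarrow> ell2 \<Rightarrow>\<^sub>L ell2" where
  "row_op x = (\<Sum>j. coord x j *\<^sub>C matrix_unit 0 j)"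

lemma coord_sum: "coord (sum f A) i = (\<Sum>a\<in>A. coord (f a) i)"
  by (induction A rule: infinite_finite_induct) simp_all

lemma ell2_expansion: "(\<lambda>i. coord x i *\<^sub>C unit_vec i) sums x"
proof -
  have co: "coord (x - (\<Sum>i<n. coord x i *\<^sub>C unit_vec i)) k = (if k < n then 0 else coord x k)" for n k
    by (simp add: coord_sum if_distrib [of "\<lambda>z. _ * z"] sum.delta cong: if_cong)
  define s where "s = (\<lambda>n. \<Sum>i<n. (cmod (coord x i))\<^sup>2)"
  define t where "t = (\<Sum>i. (cmod (coord x i))\<^sup>2)"
  have "norm (x - (\<Sum>i<n. coord x i *\<^sub>C unit_vec i)) \<le> sqrt (t - s n)" for n
  proof (rule norm_ell2_leI)
    fix m
    have "(\<Sum>k<m. (cmod (if k < n then 0 else coord x k))\<^sup>2)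
        \<le> (\<Sum>k<max m n. (cmod (if k < n then 0 else coord x k))\<^sup>2)"
      by (rule sum_mono2) auto
    also have "\<dots> = (\<Sum>k\<in>{..<max m n} - {..<n}. (cmod (coord x k))\<^sup>2)"
      by (rule sum.mono_neutral_cong_right) auto
    also have "\<dots> = s (max m n) - s n"
      unfolding s_def by (rule sum_diff) auto
    also have "s (max m n) \<le> t"
      unfolding s_def t_def by (intro sum_le_suminf summable_coord) auto
    finally show "L2_set (\<lambda>k. cmod (coord (x - (\<Sum>i<n. coord x i *\<^sub>C unit_vec i)) k)) {..<m}
        \<le> sqrt (t - s n)"
      unfolding L2_set_def co by simp
  qed
  then have "\<forall>\<^sub>F n in sequentially. norm ((\<Sum>i<n. coord x i *\<^sub>C unit_vec i) - x) \<le> sqrt (t - s n)"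
    by (simp add: norm_minus_commute)
  moreover have "(\<lambda>n. sqrt (t - s n)) \<longlonglongrightarrow> sqrt (t - t)"
    unfolding s_def t_def
    by (intro tendsto_intros summable_LIMSEQ summable_coord)
  then have "(\<lambda>n. sqrt (t - s n)) \<longlonglongrightarrow> 0" by simp
  ultimately have "(\<lambda>n. (\<Sum>i<n. coord x i *\<^sub>C unit_vec i) - x) \<longlonglongrightarrow> 0"
    by (rule Lim_null_comparison)
  then show ?thesis
    unfolding sums_def by (rule LIM_zero_cancel)
qed

lemma norm_unit_vec [simp]: "norm (unit_vec k) = 1"
proof -
  have "(\<lambda>i. (cmod (coord (unit_vec k) i))\<^sup>2) sums (\<Sum>i\<in>{k}. (cmod (coord (unit_vec k) i))\<^sup>2)"
    by (rule sums_finite) auto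
  then show ?thesis unfolding norm_ell2_def by (simp add: sums_iff)
qed

lemma cmod_bilinear_le:
  "cmod (\<Sum>i. coord x i * coord y i) \<le> norm x * norm y"
proof (rule LIMSEQ_le_const2)
  have "summable (\<lambda>i. coord x i * coord y i)"
    by (intro summable_mult_square_summable summable_coord)
  then show "(\<lambda>n. cmod (\<Sum>i<n. coord x i * coord y i)) \<longlonglongrightarrow> cmod (\<Sum>i. coord x i * coord y i)"
    by (intro tendsto_norm summable_LIMSEQ)
  have "cmod (\<Sum>i<n. coord x i * coord y i) \<le> norm x * norm y" for n
  proof -
    have "cmod (\<Sum>i<n. coord x i * coord y i) \<le> (\<Sum>i<n. cmod (coord x i) * cmod (coord y i))"
      using norm_sum [of "\<lambda>i. coord x i * coord y i"] by (simp add: norm_mult)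
    also have "\<dots> \<le> L2_set (\<lambda>i. cmod (coord x i)) {..<n} * L2_set (\<lambda>i. cmod (coord y i)) {..<n}"
      using L2_set_mult_ineq [of "\<lambda>i. cmod (coord x i)" "\<lambda>i. cmod (coord y i)" "{..<n}"] by simp
    also have "\<dots> \<le> norm x * norm y"
      by (intro mult_mono L2_set_coord_le_norm) (auto simp: L2_set_nonneg)
    finally show ?thesis .
  qed
  then show "\<exists>N. \<forall>n\<ge>N. cmod (\<Sum>i<n. coord x i * coord y i) \<le> norm x * norm y" by blast
qed

lemma summable_bilinear: "summable (\<lambda>i. coord x i * coord y i)"
  by (intro summable_mult_square_summable summable_coord)

text \<open>The operators given by the series, in closed form.\<close>

lift_definition col_aux :: "ell2 \<Rightarrow> ell2 \<Rightarrow>\<^sub>L ell2" is "\<lambda>x \<xi>. coord \<xi> 0 *\<^sub>C x"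
  subgoal for x
    by (rule bounded_linear_intro [where K = "norm x"])
      (simp_all add: scaleC_add_left scaleR_scaleC scaleC_scaleC norm_scaleC
        mult_right_mono cmod_coord_le_norm)
  done

lift_definition row_aux :: "ell2 \<Rightarrow> ell2 \<Rightarrow>\<^sub>L ell2"
  is "\<lambda>x \<xi>. (\<Sum>j. coord x j * coord \<xi> j) *\<^sub>C unit_vec 0"
  subgoal for x
  proof (rule bounded_linear_intro [where K = "norm x"])
    fix y z :: ell2 and r :: real
    show "(\<Sum>j. coord x j * coord (y + z) j) *\<^sub>C unit_vec 0
        = (\<Sum>j. coord x j * coord y j) *\<^sub>C unit_vec 0 + (\<Sum>j. coord x j * coord z j) *\<^sub>C unit_vec 0"
      using suminf_add [OF summable_bilinear [of x y] summable_bilinear [of x z]]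
      by (simp add: algebra_simps flip: scaleC_add_left)
    show "(\<Sum>j. coord x j * coord (r *\<^sub>R y) j) *\<^sub>C unit_vec 0
        = r *\<^sub>R (\<Sum>j. coord x j * coord y j) *\<^sub>C unit_vec 0"
      using suminf_mult [OF summable_bilinear [of x y], of "complex_of_real r"]
      by (simp add: scaleR_scaleC scaleC_scaleC algebra_simps)
    show "norm ((\<Sum>j. coord x j * coord y j) *\<^sub>C unit_vec 0) \<le> norm y * norm x"
      using cmod_bilinear_le [of x y] by (simp add: norm_scaleC mult.commute)
  qed
  done

lemma bounded_linear_col_aux: "bounded_linear col_aux"
proof (rule bounded_linear_intro [where K = 1])
  fix x y :: ell2 and r :: real
  show "col_aux (x + y) = col_aux x + col_aux y"
    by transfer (simp add: scaleC_add_right)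
  show "col_aux (r *\<^sub>R x) = r *\<^sub>R col_aux x"
    by transfer (simp add: scaleR_scaleC scaleC_scaleC mult.commute)
  show "norm (col_aux x) \<le> norm x * 1"
    by (rule norm_blinfun_bound)
      (simp_all add: col_aux.rep_eq norm_scaleC cmod_coord_le_norm mult_right_mono mult.commute [of "norm x"])
qed

lemma bounded_linear_row_aux: "bounded_linear row_aux"
proof (rule bounded_linear_intro [where K = 1])
  fix x y :: ell2 and r :: real
  show "row_aux (x + y) = row_aux x + row_aux y"
  proof (rule blinfun_eqI)
    fix z
    show "row_aux (x + y) z = (row_aux x + row_aux y) z"
      using suminf_add [OF summable_bilinear [of x z] summable_bilinear [of y z]]
      by (simp add: row_aux.rep_eq blinfun.add_left algebra_simps flip: scaleC_add_left)
  qed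
  show "row_aux (r *\<^sub>R x) = r *\<^sub>R row_aux x"
  proof (rule blinfun_eqI)
    fix z
    show "row_aux (r *\<^sub>R x) z = (r *\<^sub>R row_aux x) z"
      using suminf_mult [OF summable_bilinear [of x z], of "complex_of_real r"]
      by (simp add: row_aux.rep_eq scaleC_blinfun.rep_eq scaleR_scaleC scaleC_scaleC algebra_simps)
  qed
  show "norm (row_aux x) \<le> norm x * 1"
    by (rule norm_blinfun_bound) (simp_all add: row_aux.rep_eq norm_scaleC cmod_bilinear_le)
qed

lemma suminf_bilinear_unit_vec: "(\<Sum>j. (c * coord (unit_vec i) j) * coord y j) = c * coord y i"
proof -
  have "(\<lambda>j. (c * coord (unit_vec i) j) * coord y j)
      sums (\<Sum>j\<in>{i}. (c * coord (unit_vec i) j) * coord y j)"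
    by (rule sums_finite) auto
  then show ?thesis by (simp add: sums_iff)
qed

lemma col_sums: "(\<lambda>i. coord x i *\<^sub>C matrix_unit i 0) sums col_aux x"
proof -
  have "col_aux (c *\<^sub>C unit_vec i) = c *\<^sub>C matrix_unit i 0" for c i
    by transfer (simp add: scaleC_scaleC mult.commute)
  then show ?thesis
    using bounded_linear.sums [OF bounded_linear_col_aux ell2_expansion [of x]] by simp
qed

lemma row_sums: "(\<lambda>j. coord x j *\<^sub>C matrix_unit 0 j) sums row_aux x"
proof -
  have "row_aux (c *\<^sub>C unit_vec i) = c *\<^sub>C matrix_unit 0 i" for c i
    by (rule blinfun_eqI)
      (simp add: row_aux.rep_eq scaleC_blinfun.rep_eq matrix_unit.rep_eq scaleC_scaleC
        suminf_bilinear_unit_vec del: coord_unit_vec)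
  then show ?thesis
    using bounded_linear.sums [OF bounded_linear_row_aux ell2_expansion [of x]] by simp
qed

lemma col_op_apply: "col_op x \<xi> = coord \<xi> 0 *\<^sub>C x"
  unfolding col_op_def sums_unique [OF col_sums [of x], symmetric] by (simp add: col_aux.rep_eq)

lemma row_op_apply: "row_op x \<xi> = (\<Sum>j. coord x j * coord \<xi> j) *\<^sub>C unit_vec 0"
  unfolding row_op_def sums_unique [OF row_sums [of x], symmetric] by (simp add: row_aux.rep_eq)

lemma col_op_eq: "col_op = col_aux"
  by (rule ext, rule blinfun_eqI) (simp add: col_op_apply col_aux.rep_eq)

lemma row_op_eq: "row_op = row_aux"
  by (rule ext, rule blinfun_eqI) (simp add: row_op_apply row_aux.rep_eq)

lemma col_op_unit_vec: "col_op (unit_vec i) = matrix_unit i 0"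
  by (rule blinfun_eqI) (simp add: col_op_apply matrix_unit.rep_eq)

lemma row_op_unit_vec: "row_op (unit_vec j) = matrix_unit 0 j"
proof (rule blinfun_eqI)
  fix \<xi>
  have "(\<Sum>i. coord (unit_vec j) i * coord \<xi> i) = coord \<xi> j"
    using suminf_bilinear_unit_vec [of 1 j \<xi>] by (simp only: mult_1_left)
  then show "row_op (unit_vec j) \<xi> = matrix_unit 0 j \<xi>"
    unfolding row_op_apply matrix_unit.rep_eq by (rule arg_cong)
qed

lemma norm_col_op: "norm (col_op x) = norm x"
proof (rule antisym)
  show "norm (col_op x) \<le> norm x"
  proof (rule norm_blinfun_bound)
    fix \<xi>
    show "norm (col_op x \<xi>) \<le> norm x * norm \<xi>"
      unfolding col_op_apply norm_scaleC
      by (subst mult.commute) (intro mult_left_mono cmod_coord_le_norm norm_ge_zero)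
  qed simp
  show "norm x \<le> norm (col_op x)"
    using norm_blinfun [of "col_op x" "unit_vec 0"] by (simp add: col_op_apply scaleC_one)
qed

lemma norm_row_op: "norm (row_op x) = norm x"
proof (rule antisym)
  show "norm (row_op x) \<le> norm x"
    by (rule norm_blinfun_bound) (simp_all add: row_op_apply norm_scaleC cmod_bilinear_le)
  show "norm x \<le> norm (row_op x)"
  proof (cases "norm x = 0")
    case False
    have "summable (\<lambda>i. (cmod (cnj (coord x i)))\<^sup>2)" by (simp add: summable_coord)
    then have "coord (Abs_ell2 (\<lambda>i. cnj (coord x i))) = (\<lambda>i. cnj (coord x i))"
      by (intro Abs_ell2_inverse) simp
    then obtain y where y: "\<And>i. coord y i = cnj (coord x i)" by metis
    have "norm y = norm x" by (simp add: norm_ell2_def y)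
    moreover have "row_op x y = complex_of_real ((norm x)\<^sup>2) *\<^sub>C unit_vec 0"
      using cinner_self [of x] by (simp add: row_op_apply y cinner_ell2_def mult.commute)
    then have "norm (row_op x y) = norm x * norm x"
      by (simp only: norm_scaleC norm_of_real norm_unit_vec) (simp add: power2_eq_square)
    ultimately show ?thesis
      using norm_blinfun [of "row_op x" y] False by simp
  qed simp
qed

lemma range_eq_closure_cspan:
  fixes T :: "ell2 \<Rightarrow> ell2 \<Rightarrow>\<^sub>L ell2"
  assumes T: "bounded_linear T" "\<And>x. norm (T x) = norm x"
    and lin: "\<And>c x. T (c *\<^sub>C x) = c *\<^sub>C T x"
    and expansion: "\<And>x. (\<lambda>i. coord x i *\<^sub>C T (unit_vec i)) sums T x"
  shows "range T = closure (cspan (range (\<lambda>i. T (unit_vec i))))"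
proof
  interpret bounded_linear T by (rule T)
  show "range T \<subseteq> closure (cspan (range (\<lambda>i. T (unit_vec i))))"
  proof clarify
    fix x
    have "(\<Sum>i<n. coord x i *\<^sub>C T (unit_vec i)) \<in> cspan (range (\<lambda>i. T (unit_vec i)))" for n
      by (intro complex_vector.span_sum complex_vector.span_scale complex_vector.span_base) blast
    then show "T x \<in> closure (cspan (range (\<lambda>i. T (unit_vec i))))"
      using expansion [of x] unfolding sums_def closure_sequential
      by (intro exI [of _ "\<lambda>n. \<Sum>i<n. coord x i *\<^sub>C T (unit_vec i)"]) blast
  qed
  have "complete (range T)"
    by (rule complete_isometric_image [where e = 1])
      (auto simp: T bounded_linear_axioms complete_UNIV)
  moreover have "cspan (range (\<lambda>i. T (unit_vec i))) \<subseteq> range T"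
  proof (rule complex_vector.span_minimal)
    show "complex_vector.subspace (range T)"
    proof (rule complex_vector.subspaceI)
      show "0 \<in> range T" using zero by (metis rangeI)
      show "a + b \<in> range T" if "a \<in> range T" "b \<in> range T" for a b
        using that by (auto simp flip: add)
      show "c *\<^sub>C a \<in> range T" if "a \<in> range T" for c a
        using that by (auto simp flip: lin)
    qed
  qed auto
  ultimately show "closure (cspan (range (\<lambda>i. T (unit_vec i)))) \<subseteq> range T"
    by (intro closure_minimal complete_imp_closed)
qed

lemma range_col_op: "range col_op = column_space"
proof -
  have "range col_op = closure (cspan (range (\<lambda>i. col_op (unit_vec i))))"
  proof (rule range_eq_closure_cspan)
    show "bounded_linear col_op" unfolding col_op_eq by (rule bounded_linear_col_aux)
    show "norm (col_op x) = norm x" for x by (rule norm_col_op)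
    show "col_op (c *\<^sub>C x) = c *\<^sub>C col_op x" for c x
      by (rule blinfun_eqI) (simp add: col_op_apply scaleC_blinfun.rep_eq scaleC_scaleC mult.commute)
    show "(\<lambda>i. coord x i *\<^sub>C col_op (unit_vec i)) sums col_op x" for x
      unfolding col_op_unit_vec unfolding col_op_eq by (rule col_sums)
  qed
  then show ?thesis unfolding column_space_def col_op_unit_vec .
qed

lemma range_row_op: "range row_op = row_space"
proof -
  have "range row_op = closure (cspan (range (\<lambda>i. row_op (unit_vec i))))"
  proof (rule range_eq_closure_cspan)
    show "bounded_linear row_op" unfolding row_op_eq by (rule bounded_linear_row_aux)
    show "norm (row_op x) = norm x" for x by (rule norm_row_op)
    show "row_op (c *\<^sub>C x) = c *\<^sub>C row_op x" for c x
      using suminf_mult [OF summable_bilinear [of x], of c]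
      by (intro blinfun_eqI) (simp add: row_op_apply scaleC_blinfun.rep_eq scaleC_scaleC mult.assoc)
    show "(\<lambda>i. coord x i *\<^sub>C row_op (unit_vec i)) sums row_op x" for x
      unfolding row_op_unit_vec unfolding row_op_eq by (rule row_sums)
  qed
  then show ?thesis unfolding row_space_def row_op_unit_vec .
qed

section \<open>Operator spaces and completely contractive maps\<close>

text \<open>The \<open>n \<times> n\<close> matrices, as functions supported in the square \<open>{..<n} \<times> {..<n}\<close>.\<close>

definition mats :: "nat \<Rightarrow> (nat \<Rightarrow> nat \<Rightarrow> 'e::zero) set" where
  "mats n = {x. \<forall>i j. \<not> (i < n \<and> j < n) \<longrightarrow> x i j = 0}"

text \<open>The operator norm of an operator matrix acting on the Hilbert space direct sum of \<open>n\<close> copies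
  of the underlying Hilbert space.\<close>

definition op_mat_norm ::
    "nat \<Rightarrow> (nat \<Rightarrow> nat \<Rightarrow> 'h \<Rightarrow>\<^sub>L 'h::real_normed_vector) \<Rightarrow> real" where
  "op_mat_norm n T =
     (SUP \<xi>\<in>{\<xi>. L2_set (\<lambda>k. norm (\<xi> k)) {..<n} \<le> 1}.
        L2_set (\<lambda>i. norm (\<Sum>k<n. blinfun_apply (T i k) (\<xi> k))) {..<n})"

text \<open>An operator space enters through its matrix norms, a function of the size \<open>n\<close> and of
  an \<open>n \<times> n\<close> matrix. The following are those induced by an embedding \<open>\<iota>\<close> into the bounded
  operators on a Hilbert space.\<close>

definition opspace_norm ::
    "('e \<Rightarrow> 'h \<Rightarrow>\<^sub>L 'h::real_normed_vector) \<Rightarrow> nat \<Rightarrow> (nat \<Rightarrow> nat \<Rightarrow> 'e) \<Rightarrow> real" where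
  "opspace_norm \<iota> n x = op_mat_norm n (\<lambda>i j. \<iota> (x i j))"

definition cb_norm ::
    "(nat \<Rightarrow> (nat \<Rightarrow> nat \<Rightarrow> 'e) \<Rightarrow> real) \<Rightarrow> (nat \<Rightarrow> (nat \<Rightarrow> nat \<Rightarrow> 'f) \<Rightarrow> real)
      \<Rightarrow> ('e::complex_vector \<Rightarrow> 'f::complex_vector) \<Rightarrow> ereal" where
  "cb_norm NE NF u =
     (SUP n\<in>{1..}. SUP x\<in>{x \<in> mats n. NE n x \<le> 1}. ereal (NF n (\<lambda>i j. u (x i j))))"

definition completely_contractive ::
    "(nat \<Rightarrow> (nat \<Rightarrow> nat \<Rightarrow> 'e) \<Rightarrow> real) \<Rightarrow> (nat \<Rightarrow> (nat \<Rightarrow> nat \<Rightarrow> 'f) \<Rightarrow> real)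
      \<Rightarrow> ('e::complex_vector \<Rightarrow> 'f::complex_vector) \<Rightarrow> bool" where
  "completely_contractive NE NF u \<longleftrightarrow> clinear u \<and> cb_norm NE NF u \<le> 1"

section \<open>Complex interpolation\<close>

text \<open>
  A compatible couple consists of two subspaces \<open>X0\<close>, \<open>X1\<close> of one vector space, with norms
  \<open>N0\<close>, \<open>N1\<close>. Continuity and holomorphy of functions on the strip refer to the norm of
  the sum space.
\<close>

definition sum_space :: "'v::complex_vector set \<Rightarrow> 'v set \<Rightarrow> 'v set" where
  "sum_space X0 X1 = {a + b |a b. a \<in> X0 \<and> b \<in> X1}"

definition sum_norm ::
    "'v::complex_vector set \<Rightarrow> ('v \<Rightarrow> real) \<Rightarrow> 'v set \<Rightarrow> ('v \<Rightarrow> real) \<Rightarrow> 'v \<Rightarrow> real" where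
  "sum_norm X0 N0 X1 N1 x = Inf {N0 a + N1 b |a b. a \<in> X0 \<and> b \<in> X1 \<and> x = a + b}"

definition norm_continuous_on ::
    "'z::topological_space set \<Rightarrow> ('v::complex_vector \<Rightarrow> real) \<Rightarrow> ('z \<Rightarrow> 'v) \<Rightarrow> bool" where
  "norm_continuous_on S N F \<longleftrightarrow>
     (\<forall>z\<in>S. ((\<lambda>w. N (F w - F z)) \<longlongrightarrow> 0) (at z within S))"

definition norm_holomorphic_on ::
    "complex set \<Rightarrow> 'v::complex_vector set \<Rightarrow> ('v \<Rightarrow> real) \<Rightarrow> (complex \<Rightarrow> 'v) \<Rightarrow> bool" where
  "norm_holomorphic_on S V N F \<longleftrightarrow>
     (\<forall>z\<in>S. \<exists>D\<in>V. ((\<lambda>w. N (inverse (w - z) *\<^sub>C (F w - F z) - D)) \<longlongrightarrow> 0) (at z within S))"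

definition interp_functions ::
    "'v::complex_vector set \<Rightarrow> ('v \<Rightarrow> real) \<Rightarrow> 'v set \<Rightarrow> ('v \<Rightarrow> real) \<Rightarrow> (complex \<Rightarrow> 'v) set" where
  "interp_functions X0 N0 X1 N1 =
     {F. F ` {z. 0 \<le> Re z \<and> Re z \<le> 1} \<subseteq> sum_space X0 X1
       \<and> bdd_above ((\<lambda>z. sum_norm X0 N0 X1 N1 (F z)) ` {z. 0 \<le> Re z \<and> Re z \<le> 1})
       \<and> norm_continuous_on {z. 0 \<le> Re z \<and> Re z \<le> 1} (sum_norm X0 N0 X1 N1) F
       \<and> norm_holomorphic_on {z. 0 < Re z \<and> Re z < 1} (sum_space X0 X1) (sum_norm X0 N0 X1 N1) F
       \<and> range (\<lambda>t. F (Complex 0 t)) \<subseteq> X0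
       \<and> bdd_above (range (\<lambda>t. N0 (F (Complex 0 t))))
       \<and> norm_continuous_on UNIV N0 (\<lambda>t. F (Complex 0 t))
       \<and> range (\<lambda>t. F (Complex 1 t)) \<subseteq> X1
       \<and> bdd_above (range (\<lambda>t. N1 (F (Complex 1 t))))
       \<and> norm_continuous_on UNIV N1 (\<lambda>t. F (Complex 1 t))}"

definition interp_norm ::
    "'v::complex_vector set \<Rightarrow> ('v \<Rightarrow> real) \<Rightarrow> 'v set \<Rightarrow> ('v \<Rightarrow> real) \<Rightarrow> real \<Rightarrow> 'v \<Rightarrow> real" where
  "interp_norm X0 N0 X1 N1 \<theta> x =
     Inf {max (SUP t. N0 (F (Complex 0 t))) (SUP t. N1 (F (Complex 1 t))) |F.
            F \<in> interp_functions X0 N0 X1 N1 \<and> F (complex_of_real \<theta>) = x}"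

text \<open>The matrix norms of \<open>R[\<theta>]\<close>, whose underlying space is \<^typ>\<open>ell2\<close> through the
  coordinates \<^const>\<open>col_op\<close> and \<^const>\<open>row_op\<close>.\<close>

definition R_interp_norm :: "real \<Rightarrow> nat \<Rightarrow> (nat \<Rightarrow> nat \<Rightarrow> ell2) \<Rightarrow> real" where
  "R_interp_norm \<theta> n =
     interp_norm (mats n) (opspace_norm col_op n) (mats n) (opspace_norm row_op n) \<theta>"

section \<open>Representations and states\<close>

text \<open>
  Every C*-algebra has a faithful representation, and its matrix norms \<^const>\<open>opspace_norm\<close> do not
  depend on the choice: on \<open>n \<times> n\<close> matrices they are the unique C*-norm. The type
  \<^typ>\<open>'h \<Rightarrow>\<^sub>L 'h\<close> contains all bounded real linear maps, hence the second condition.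
\<close>

definition faithful_representation ::
    "('a::cstar_algebra \<Rightarrow> 'h \<Rightarrow>\<^sub>L 'h::complex_hilbert) \<Rightarrow> bool" where
  "faithful_representation \<pi> \<longleftrightarrow>
     clinear \<pi>
     \<and> (\<forall>a. clinear (blinfun_apply (\<pi> a)))
     \<and> (\<forall>a b. \<pi> (a * b) = \<pi> a o\<^sub>L \<pi> b)
     \<and> (\<forall>a \<xi> \<eta>. cinner (\<pi> (star a) \<xi>) \<eta> = cinner \<xi> (\<pi> a \<eta>))
     \<and> (\<forall>a. norm (\<pi> a) = norm a)"

definition state :: "('a::cstar_algebra \<Rightarrow> complex) \<Rightarrow> bool" where
  "state f \<longleftrightarrow>
     clinear f \<and> bounded_linear f \<and> (\<forall>a. f (star a * a) \<in> \<real>\<^sub>\<ge>\<^sub>0) \<and> onorm f = 1"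

definition c_const :: "real \<Rightarrow> real" where
  "c_const \<theta> = inverse (\<theta> powr \<theta> * (1 - \<theta>) powr (1 - \<theta>))"

end

theory Submission
  imports Defs "HOL-Complex_Analysis.Complex_Analysis"
begin

text \<open>
  Let \<open>D\<close> be a diagonal density matrix of size \<open>N\<close>. By the three lines theorem, the norm of
  \<open>M\<^sub>N(R[\<theta>])\<close> dominates the Hilbert norm \<open>(\<Sum> D\<^sub>p\<^sup>\<theta> D\<^sub>q\<^sup>1\<^sup>-\<^sup>\<theta> \<parallel>x\<^sub>p\<^sub>q\<parallel>\<^sup>2)\<^sup>1\<^sup>/\<^sup>2\<close>, so \<open>u\<close> induces a
  contraction from the C*-algebra \<open>M\<^sub>N(A)\<close> into a Hilbert space. Haagerup's little Grothendieck
  inequality, with constant 1, bounds it by two functionals on \<open>M\<^sub>N(A)\<close>; at the matrix with the only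
  entry \<open>a\<close> in the place \<open>(p, q)\<close> this reads
  \<open>D\<^sub>p\<^sup>\<theta> D\<^sub>q\<^sup>1\<^sup>-\<^sup>\<theta> \<parallel>u a\<parallel>\<^sup>2 \<le> F\<^sub>q(a*a) + G\<^sub>p(aa*)\<close>, where \<open>f = \<Sum> F\<^sub>q\<close> and \<open>g = \<Sum> G\<^sub>p\<close> have norm at
  most 1. As in the proofs of Regev and Vidick by embezzlement, \<open>D\<close> is spread evenly over many levels
  of geometrically growing multiplicity, and adding up over the pairs of levels with a given ratio \<open>r\<close>
  gives \<open>r\<^sup>\<theta> \<parallel>u a\<parallel>\<^sup>2 \<le> f(a*a) + r g(aa*)\<close> up to a small error. A cluster point of such pairs \<open>(f, g)\<close>
  works for all \<open>r > 0\<close> at once, and the best choice of \<open>r\<close> gives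
  \<open>\<parallel>u a\<parallel>\<^sup>2 \<le> c(\<theta>) f(a*a)\<^sup>1\<^sup>-\<^sup>\<theta> g(aa*)\<^sup>\<theta>\<close>, which is enough since \<open>c(\<theta>) \<ge> 1\<close>.
\<close>

section \<open>Semi-inner products\<close>

text \<open>Pairs of vectors carry the dilation space of \<open>contraction_curve\<close>.\<close>

instantiation prod :: (complex_vector, complex_vector) complex_vector
begin
definition scaleC_prod :: "complex \<Rightarrow> 'a \<times> 'b \<Rightarrow> 'a \<times> 'b" where
  "scaleC_prod c x = (c *\<^sub>C fst x, c *\<^sub>C snd x)"
instance
  by standard
    (simp_all add: scaleC_prod_def prod_eq_iff scaleC_add_right scaleC_add_left scaleC_scaleC scaleC_one)
end

lemma scaleC_Pair [simp]: "c *\<^sub>C (x, y) = (c *\<^sub>C x, c *\<^sub>C y)"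
  by (simp add: scaleC_prod_def)

text \<open>Definiteness is left out because the forms met below have null vectors: a form pulled
  back along \<open>u\<close> vanishes on its kernel, and the dilation form of
  \<open>contraction_curve\<close> degenerates where the contraction is isometric.\<close>

locale semi_inner =
  fixes S :: "'b::complex_vector \<Rightarrow> 'b \<Rightarrow> complex"
  assumes commute: "S x y = cnj (S y x)"
    and add_right: "S x (y + z) = S x y + S x z"
    and scaleC_right: "S x (c *\<^sub>C y) = c * S x y"
    and nonneg: "0 \<le> Re (S x x)"
begin

definition sq :: "'b \<Rightarrow> real" where "sq x = Re (S x x)"

lemma sq_nonneg [simp]: "0 \<le> sq x"
  by (simp add: sq_def nonneg)

lemma add_left: "S (x + y) z = S x z + S y z"
  by (metis commute add_right complex_cnj_add)

lemma scaleC_left: "S (c *\<^sub>C x) y = cnj c * S x y"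
  by (metis commute scaleC_right complex_cnj_mult)

lemma diff_right: "S x (y - z) = S x y - S x z"
  using add_right [of x "y - z" z] by simp

lemma diff_left: "S (x - y) z = S x z - S y z"
  using add_left [of "x - y" y z] by simp

lemma zero_right [simp]: "S x 0 = 0"
  using diff_right [of x 0 0] by simp

lemma zero_left [simp]: "S 0 x = 0"
  using diff_left [of 0 0 x] by simp

lemma sum_right: "S x (sum f I) = (\<Sum>i\<in>I. S x (f i))"
  by (induction I rule: infinite_finite_induct) (simp_all add: add_right)

lemmas sesquilinear = add_left add_right diff_left diff_right scaleC_left scaleC_right

lemma Re_commute: "Re (S x y) = Re (S y x)"
  by (subst commute) simp

lemma sq_add: "sq (x + y) = sq x + sq y + 2 * Re (S x y)"
  using Re_commute [of x y] by (simp add: sq_def sesquilinear)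

lemma sq_diff: "sq (x - y) = sq x + sq y - 2 * Re (S x y)"
  using Re_commute [of x y] by (simp add: sq_def sesquilinear)

lemma sq_scaleC: "sq (c *\<^sub>C x) = (cmod c)\<^sup>2 * sq x"
proof -
  have "S (c *\<^sub>C x) (c *\<^sub>C x) = complex_of_real ((cmod c)\<^sup>2) * S x x"
    by (simp add: sesquilinear complex_norm_square mult_ac del: of_real_power)
  then show ?thesis by (simp add: sq_def)
qed

lemma parallelogram: "sq (x + y) + sq (x - y) = 2 * sq x + 2 * sq y"
  by (simp add: sq_add sq_diff)

lemma sq_add_le: "sq (x + y) \<le> 2 * sq x + 2 * sq y"
  using parallelogram [of x y] sq_nonneg [of "x - y"] by linarith

lemma Re_le: "2 * Re (S x y) \<le> sq x + sq y"
  using sq_diff [of x y] sq_nonneg [of "x - y"] by linarith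

text \<open>A unimodular multiple of \<open>y\<close> turns the pairing into its modulus, and then
  \<open>Re_le\<close> applies. The bound by the mean of squares suffices for vectors of the unit
  ball and never divides by a length that may vanish.\<close>

lemma cmod_le: "2 * cmod (S x y) \<le> sq x + sq y"
proof (cases "S x y = 0")
  case False
  define c where "c = cnj (sgn (S x y))"
  have c: "cmod c = 1" using False by (simp add: c_def norm_sgn)
  have "cnj (S x y) * S x y = complex_of_real (cmod (S x y)) * complex_of_real (cmod (S x y))"
    using complex_norm_square [of "S x y"] by (simp add: power2_eq_square mult.commute)
  then have "S x (c *\<^sub>C y) = complex_of_real (cmod (S x y))"
    using False by (simp add: scaleC_right c_def sgn_eq)
  then show ?thesis using Re_le [of x "c *\<^sub>C y"] c by (simp add: sq_scaleC)
qed simp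

text \<open>The squared length of \<open>X' \<eta>\<close> is the pairing of
  \<open>X (X' \<eta>)\<close> with \<open>\<eta>\<close>. By \<open>Re_le\<close> and the
  contractivity of \<open>X\<close>, half of it is absorbed on the left. No completeness
  enters.\<close>

lemma adjoint_contraction:
  assumes adj: "\<And>\<xi> \<eta>. S (X \<xi>) \<eta> = S \<xi> (X' \<eta>)" and X: "\<And>\<xi>. sq (X \<xi>) \<le> sq \<xi>"
  shows "sq (X' \<eta>) \<le> sq \<eta>"
proof -
  have "sq (X' \<eta>) = Re (S (X (X' \<eta>)) \<eta>)" by (simp add: adj sq_def)
  then show ?thesis using Re_le [of "X (X' \<eta>)" \<eta>] X [of "X' \<eta>"] by simp
qed

text \<open>The second order Taylor polynomial of \<open>exp (\<i> t K)\<close> is isometric up to order four.\<close>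

lemma symmetric_curve:
  assumes K: "\<And>x y. S (K x) y = S x (K y)"
  shows "sq (w + (\<i> * complex_of_real t) *\<^sub>C K w - complex_of_real (t\<^sup>2 / 2) *\<^sub>C K (K w))
    = sq w + t ^ 4 / 4 * sq (K (K w))"
proof -
  \<comment> \<open>Symmetry makes these diagonal values real, which removes the terms of order 1
    and 3 in \<open>t\<close>. By \<open>e\<close> the two terms of order 2 cancel as well.\<close>
  have re: "Im (S x (K x)) = 0" for x
  proof -
    have "S x (K x) = cnj (S x (K x))" using commute [of x "K x"] K by metis
    then show ?thesis by (simp add: complex_eq_iff)
  qed
  have e: "Re (S w (K (K w))) = sq (K w)" by (simp add: sq_def flip: K)
  have "sq (w + (\<i> * complex_of_real t) *\<^sub>C K w - complex_of_real (t\<^sup>2 / 2) *\<^sub>C K (K w))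
    = sq w + t\<^sup>2 * sq (K w) + (t\<^sup>2 / 2)\<^sup>2 * sq (K (K w)) - t\<^sup>2 * Re (S w (K (K w)))
      - 2 * t * Im (S w (K w)) - t ^ 3 * Im (S (K w) (K (K w)))"
    by (simp add: sq_add sq_diff sq_scaleC sesquilinear norm_mult power2_eq_square power3_eq_cube algebra_simps
         del: of_real_power)
  also have "\<dots> = sq w + t ^ 4 / 4 * sq (K (K w))"
    by (simp add: re e power2_eq_square power4_eq_xxxx)
  finally show ?thesis .
qed

text \<open>Adding the bounds at \<open>t\<close> and \<open>- t\<close> by the parallelogram law
  eliminates the first order term and leaves the squared length of \<open>D\<close>. The term
  \<open>E\<close> survives only through its pairing with \<open>v\<close>, since its squared length
  has a favourable sign.\<close>

lemma second_order:
  assumes "\<And>s. s = t \<or> s = - t \<Longrightarrow>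
    sq (v + (\<i> * complex_of_real s) *\<^sub>C D - complex_of_real (s\<^sup>2 / 2) *\<^sub>C E) \<le> B"
  shows "sq v + t\<^sup>2 * sq D \<le> B + t\<^sup>2 * Re (S v E)"
proof -
  define w where "w = v - complex_of_real (t\<^sup>2 / 2) *\<^sub>C E"
  have "sq (w + (\<i> * complex_of_real t) *\<^sub>C D) \<le> B" "sq (w - (\<i> * complex_of_real t) *\<^sub>C D) \<le> B"
    using assms [of t] assms [of "- t"] by (simp_all add: w_def algebra_simps)
  moreover have "sq w \<ge> sq v - t\<^sup>2 * Re (S v E)"
    by (simp add: w_def sq_diff scaleC_right del: of_real_divide of_real_power)
  moreover have "sq ((\<i> * complex_of_real t) *\<^sub>C D) = t\<^sup>2 * sq D"
    by (simp add: sq_scaleC norm_mult)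
  ultimately show ?thesis
    using parallelogram [of w "(\<i> * complex_of_real t) *\<^sub>C D"] by linarith
qed

text \<open>
  Here \<open>V\<close> is a contraction without any unitarity. Writing \<open>d = (1 - V*V)\<^sup>1\<^sup>/\<^sup>2\<close>, the pair \<open>(\<eta>, \<zeta>)\<close>
  stands for the vector \<open>(\<eta>, d \<zeta>)\<close>, so that \<open>(V \<xi>, \<xi>)\<close> is the image of \<open>\<xi>\<close> under a unitary
  dilation of \<open>V\<close>; only \<open>d\<^sup>2\<close> enters the computation.
\<close>

lemma contraction_curve:
  fixes V V' X X' :: "'b \<Rightarrow> 'b"
  assumes add: "\<And>x y. V (x + y) = V x + V y" "\<And>x y. V' (x + y) = V' x + V' y"
      "\<And>x y. X (x + y) = X x + X y" "\<And>x y. X' (x + y) = X' x + X' y"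
    and scale: "\<And>c x. V (c *\<^sub>C x) = c *\<^sub>C V x" "\<And>c x. V' (c *\<^sub>C x) = c *\<^sub>C V' x"
      "\<And>c x. X (c *\<^sub>C x) = c *\<^sub>C X x" "\<And>c x. X' (c *\<^sub>C x) = c *\<^sub>C X' x"
    and adj: "\<And>\<xi> \<eta>. S (V \<xi>) \<eta> = S \<xi> (V' \<eta>)" "\<And>\<xi> \<eta>. S (X \<xi>) \<eta> = S \<xi> (X' \<eta>)"
    and contr: "\<And>\<xi>. sq (V \<xi>) \<le> sq \<xi>" "\<And>\<xi>. sq (X \<xi>) \<le> sq \<xi>"
  shows "sq (V \<xi> + (\<i> * complex_of_real t) *\<^sub>C ((1 / 2) *\<^sub>C (X \<xi> + V (X' (V \<xi>))))
      - complex_of_real (t\<^sup>2 / 2) *\<^sub>C ((1 / 4) *\<^sub>C (X (V' (X \<xi>)) + V (X' (V (X' (V \<xi>))))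
          + (X (X' (V \<xi>)) + V (X' (X \<xi>)))))) \<le> (1 + t ^ 4 / 2) * sq \<xi>"
proof -
  define \<Lambda> :: "'b \<times> 'b \<Rightarrow> 'b \<times> 'b \<Rightarrow> complex" where
    "\<Lambda> = (\<lambda>x y. S (fst x) (fst y) + (S (snd x) (snd y) - S (V (snd x)) (V (snd y))))"
  \<comment> \<open>Put \<open>W \<xi> = (V \<xi>, d \<xi>)\<close>, an isometry, and
    \<open>Y \<xi> = (X \<xi>, 0)\<close>. With primes for adjoints, this is
    \<open>K = (Y W' + W Y') / 2\<close>, which is visibly symmetric; \<open>W'\<close> sends
    \<open>(\<eta>, d \<zeta>)\<close> to
    \<open>V' \<eta> + \<zeta> - V' (V \<zeta>)\<close>.\<close>
  define K :: "'b \<times> 'b \<Rightarrow> 'b \<times> 'b" where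
    "K = (\<lambda>x. ((1 / 2) *\<^sub>C (X (V' (fst x)) + V (X' (fst x)) + (X (snd x) - X (V' (V (snd x))))),
              (1 / 2) *\<^sub>C X' (fst x)))"
  have adj': "S \<eta> (V \<xi>) = S (V' \<eta>) \<xi>" "S \<eta> (X \<xi>) = S (X' \<eta>) \<xi>" for \<xi> \<eta>
    by (metis adj commute)+
  interpret L: semi_inner \<Lambda>
  proof
    fix x y z :: "'b \<times> 'b" and c :: complex
    show "\<Lambda> x y = cnj (\<Lambda> y x)"
      unfolding \<Lambda>_def complex_cnj_add complex_cnj_diff by (simp flip: commute)
    show "\<Lambda> x (y + z) = \<Lambda> x y + \<Lambda> x z"
      by (simp add: \<Lambda>_def add sesquilinear)
    show "\<Lambda> x (c *\<^sub>C y) = c * \<Lambda> x y"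
      by (simp add: \<Lambda>_def scaleC_prod_def scale sesquilinear algebra_simps)
    show "0 \<le> Re (\<Lambda> x x)"
      using contr(1) [of "snd x"] nonneg [of "fst x"] by (simp add: \<Lambda>_def sq_def)
  qed
  have X': "sq (X' \<eta>) \<le> sq \<eta>" and V': "sq (V' \<eta>) \<le> sq \<eta>" for \<eta>
    using adjoint_contraction [OF adj(2) contr(2)] adjoint_contraction [OF adj(1) contr(1)] by auto
  have "\<Lambda> (K x) y = \<Lambda> x (K y)" for x y
    by (simp add: \<Lambda>_def K_def sesquilinear scale adj' adj [symmetric] algebra_simps)
  note curve = L.symmetric_curve [of K "(V \<xi>, \<xi>)" t, OF this]
  define \<eta>1 where "\<eta>1 = X \<xi> + V (X' (V \<xi>))"
  define \<eta>2 where "\<eta>2 = X (V' (X \<xi>)) + V (X' (V (X' (V \<xi>)))) + (X (X' (V \<xi>)) + V (X' (X \<xi>)))"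
  define \<zeta>2 where "\<zeta>2 = X' (X \<xi>) + X' (V (X' (V \<xi>)))"
  have K1: "K (V \<xi>, \<xi>) = ((1 / 2) *\<^sub>C \<eta>1, (1 / 2) *\<^sub>C X' (V \<xi>))"
    by (simp add: K_def \<eta>1_def)
  have K2: "K (K (V \<xi>, \<xi>)) = ((1 / 4) *\<^sub>C \<eta>2, (1 / 4) *\<^sub>C \<zeta>2)"
    unfolding K1
    by (simp add: K_def \<eta>1_def \<eta>2_def \<zeta>2_def scale add scaleC_scaleC algebra_simps
          complex_vector.scale_right_diff_distrib complex_vector.scale_right_distrib)
  have Lsq: "L.sq x = sq (fst x) + (sq (snd x) - sq (V (snd x)))" for x
    unfolding L.sq_def by (simp add: \<Lambda>_def sq_def)
  \<comment> \<open>Forgetting the second component can only shrink a length, so the estimate for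
    the dilated curve descends to the curve through \<open>V \<xi>\<close>.\<close>
  have le: "sq (fst x) \<le> L.sq x" "L.sq x \<le> sq (fst x) + sq (snd x)" for x
    using contr(1) [of "snd x"] by (simp_all add: Lsq)
  have w: "L.sq (V \<xi>, \<xi>) = sq \<xi>"
    by (simp add: Lsq)
  note c = order_trans [OF contr(1)] order_trans [OF contr(2)] order_trans [OF X'] order_trans [OF V']
  have b1: "sq (X (V' (X \<xi>))) \<le> sq \<xi>" "sq (V (X' (V (X' (V \<xi>))))) \<le> sq \<xi>"
     "sq (X (X' (V \<xi>))) \<le> sq \<xi>" "sq (V (X' (X \<xi>))) \<le> sq \<xi>"
     "sq (X' (X \<xi>)) \<le> sq \<xi>" "sq (X' (V (X' (V \<xi>)))) \<le> sq \<xi>"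
    by (auto intro!: c)
  \<comment> \<open>Sums of four and of two images of \<open>\<xi>\<close> under contractions:
    \<open>sq_add_le\<close> costs a factor 2 per addition, hence 16 and 4. After division by 16
    this leaves \<open>1 + 1/4\<close>, rounded up to 2.\<close>
  have "sq \<eta>2 \<le> 16 * sq \<xi>"
    unfolding \<eta>2_def
    using sq_add_le [of "X (V' (X \<xi>)) + V (X' (V (X' (V \<xi>))))" "X (X' (V \<xi>)) + V (X' (X \<xi>))"]
      sq_add_le [of "X (V' (X \<xi>))" "V (X' (V (X' (V \<xi>))))"] sq_add_le [of "X (X' (V \<xi>))" "V (X' (X \<xi>))"] b1
    by linarith
  moreover have "sq \<zeta>2 \<le> 4 * sq \<xi>"
    unfolding \<zeta>2_def using sq_add_le [of "X' (X \<xi>)" "X' (V (X' (V \<xi>)))"] b1 by linarith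
  moreover have "L.sq (K (K (V \<xi>, \<xi>))) \<le> sq \<eta>2 / 16 + sq \<zeta>2 / 16"
    using le(2) [of "K (K (V \<xi>, \<xi>))"] unfolding K2
    by (simp add: sq_scaleC norm_divide power2_eq_square)
  ultimately have "L.sq (K (K (V \<xi>, \<xi>))) \<le> 2 * sq \<xi>"
    using sq_nonneg [of \<xi>] by linarith
  then have "t ^ 4 / 4 * L.sq (K (K (V \<xi>, \<xi>))) \<le> t ^ 4 / 4 * (2 * sq \<xi>)"
    by (intro mult_left_mono) auto
  then have "L.sq (V \<xi>, \<xi>) + t ^ 4 / 4 * L.sq (K (K (V \<xi>, \<xi>))) \<le> (1 + t ^ 4 / 2) * sq \<xi>"
    unfolding w by (simp add: algebra_simps)
  then have "sq (fst ((V \<xi>, \<xi>) + (\<i> * complex_of_real t) *\<^sub>C K (V \<xi>, \<xi>)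
      - complex_of_real (t\<^sup>2 / 2) *\<^sub>C K (K (V \<xi>, \<xi>)))) \<le> (1 + t ^ 4 / 2) * sq \<xi>"
    unfolding curve [symmetric] by (rule order_trans [OF le(1)])
  then show ?thesis unfolding K2 unfolding K1 unfolding \<eta>1_def \<eta>2_def by simp
qed

end

section \<open>Matrices over a represented C*-algebra\<close>

lemma cinner_sum_right: "cinner z (sum f I) = (\<Sum>i\<in>I. cinner z (f i))"
  for z :: "'k::complex_hilbert"
proof (induction I rule: infinite_finite_induct)
  case empty
  show ?case using cinner_scaleC_right [of z 0 0] by simp
next
  case (infinite A)
  then show ?case using cinner_scaleC_right [of z 0 0] by simp
qed (simp add: cinner_add_right)

lemma cinner_sum_left: "cinner (sum f I) z = (\<Sum>i\<in>I. cinner (f i) z)"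
  for z :: "'k::complex_hilbert"
proof -
  have "cinner (sum f I) z = cnj (\<Sum>i\<in>I. cinner z (f i))"
    by (subst cinner_commute) (simp add: cinner_sum_right)
  also have "\<dots> = (\<Sum>i\<in>I. cinner (f i) z)"
    by (simp flip: cinner_commute)
  finally show ?thesis .
qed

text \<open>A vector of the direct sum of \<open>N\<close> copies is a function of which only the
  first \<open>N\<close> entries count, as in \<open>op_mat_norm\<close>.\<close>

definition tup :: "nat \<Rightarrow> (nat \<Rightarrow> 'h::complex_hilbert) \<Rightarrow> (nat \<Rightarrow> 'h) \<Rightarrow> complex" where
  "tup N \<xi> \<eta> = (\<Sum>i<N. cinner (\<xi> i) (\<eta> i))"

interpretation tup: semi_inner "tup N" for N
proof
  fix x y z :: "nat \<Rightarrow> 'a::complex_hilbert" and c :: complex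
  show "tup N x y = cnj (tup N y x)"
    by (simp add: tup_def flip: cinner_commute)
  show "tup N x (y + z) = tup N x y + tup N x z"
    by (simp add: tup_def cinner_add_right sum.distrib)
  show "tup N x (c *\<^sub>C y) = c * tup N x y"
    by (simp add: tup_def scaleC_fun_def cinner_scaleC_right sum_distrib_left)
  show "0 \<le> Re (tup N x x)"
    by (simp add: tup_def cinner_self sum_nonneg)
qed

lemma tup_sq: "tup.sq N \<xi> = (\<Sum>i<N. (norm (\<xi> i))\<^sup>2)"
  by (simp add: tup.sq_def tup_def cinner_self)

definition mmul :: "nat \<Rightarrow> (nat \<Rightarrow> nat \<Rightarrow> 'a::cstar_algebra) \<Rightarrow> (nat \<Rightarrow> nat \<Rightarrow> 'a) \<Rightarrow> nat \<Rightarrow> nat \<Rightarrow> 'a" where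
  "mmul N x y = (\<lambda>i j. \<Sum>k<N. x i k * y k j)"

definition madj :: "(nat \<Rightarrow> nat \<Rightarrow> 'a::cstar_algebra) \<Rightarrow> nat \<Rightarrow> nat \<Rightarrow> 'a" where
  "madj x = (\<lambda>i j. star (x j i))"

lemma star_zero [simp]: "star (0::'a::cstar_algebra) = 0"
  using star_add [of "0::'a" 0] by simp

lemma mats_zero: "0 \<in> mats N"
  by (simp add: mats_def)

lemma mats_add: "x \<in> mats N \<Longrightarrow> y \<in> mats N \<Longrightarrow> x + y \<in> mats N"
  for x y :: "nat \<Rightarrow> nat \<Rightarrow> 'a::complex_vector"
  unfolding mats_def mem_Collect_eq plus_fun_def by (metis add_0)

lemma mats_scale: "x \<in> mats N \<Longrightarrow> c *\<^sub>C x \<in> mats N"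
  for x :: "nat \<Rightarrow> nat \<Rightarrow> 'a::complex_vector"
  unfolding mats_def mem_Collect_eq scaleC_fun_def by (metis complex_vector.scale_zero_right)

lemma mats_diff: "x \<in> mats N \<Longrightarrow> y \<in> mats N \<Longrightarrow> x - y \<in> mats N"
  for x y :: "nat \<Rightarrow> nat \<Rightarrow> 'a::complex_vector"
  unfolding mats_def mem_Collect_eq fun_diff_def by (metis diff_0_right)

lemma mats_mmul: "x \<in> mats N \<Longrightarrow> y \<in> mats N \<Longrightarrow> mmul N x y \<in> mats N"
  unfolding mats_def mmul_def mem_Collect_eq by (intro allI impI sum.neutral ballI) (metis mult_zero_left mult_zero_right)

lemma mats_madj: "x \<in> mats N \<Longrightarrow> madj x \<in> mats N"
  unfolding mats_def madj_def mem_Collect_eq by (metis star_zero)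

lemmas mats_intros = mats_zero mats_add mats_scale mats_diff mats_mmul mats_madj

lemma mmul_scale_left: "mmul N (c *\<^sub>C x) y = c *\<^sub>C mmul N x y"
  by (simp add: mmul_def scaleC_fun_def mult_scaleC_left complex_vector.scale_sum_right)

lemma mmul_scale_right: "mmul N x (c *\<^sub>C y) = c *\<^sub>C mmul N x y"
  by (simp add: mmul_def scaleC_fun_def mult_scaleC_right complex_vector.scale_sum_right)

lemma madj_scale: "madj (c *\<^sub>C x) = cnj c *\<^sub>C madj x"
  by (simp add: madj_def scaleC_fun_def star_scaleC)

section \<open>The action of matrices over \<open>A\<close> on tuples of vectors\<close>

locale representation =
  fixes \<pi> :: "'a::cstar_algebra \<Rightarrow> 'h::complex_hilbert \<Rightarrow>\<^sub>L 'h"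
  assumes faithful: "faithful_representation \<pi>"
begin

lemma pi_add: "\<pi> (a + b) = \<pi> a + \<pi> b"
  and pi_scale: "\<pi> (c *\<^sub>C a) = c *\<^sub>C \<pi> a"
  and pi_app_scale: "\<pi> a (c *\<^sub>C \<xi>) = c *\<^sub>C \<pi> a \<xi>"
  and pi_mult: "\<pi> (a * b) \<xi> = \<pi> a (\<pi> b \<xi>)"
  and pi_star: "cinner (\<pi> a \<xi>) \<eta> = cinner \<xi> (\<pi> (star a) \<eta>)"
  and pi_norm: "norm (\<pi> a) = norm a"
proof -
  interpret p: Vector_Spaces.linear scaleC scaleC \<pi>
    using faithful by (simp add: faithful_representation_def)
  interpret q: Vector_Spaces.linear scaleC scaleC "blinfun_apply (\<pi> a)"
    using faithful by (simp add: faithful_representation_def)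
  show "\<pi> (a + b) = \<pi> a + \<pi> b" "\<pi> (c *\<^sub>C a) = c *\<^sub>C \<pi> a" by (rule p.add p.scale)+
  show "\<pi> a (c *\<^sub>C \<xi>) = c *\<^sub>C \<pi> a \<xi>" by (rule q.scale)
  show "\<pi> (a * b) \<xi> = \<pi> a (\<pi> b \<xi>)" "norm (\<pi> a) = norm a"
    using faithful by (simp_all add: faithful_representation_def)
  show "cinner (\<pi> a \<xi>) \<eta> = cinner \<xi> (\<pi> (star a) \<eta>)"
    using faithful unfolding faithful_representation_def by (metis star_star)
qed

lemma pi_zero: "\<pi> 0 = 0"
  using pi_scale [of 0 0] by simp

lemma pi_sum: "\<pi> (sum f I) = (\<Sum>i\<in>I. \<pi> (f i))"
  by (induction I rule: infinite_finite_induct) (simp_all add: pi_add pi_zero)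

definition act :: "nat \<Rightarrow> (nat \<Rightarrow> nat \<Rightarrow> 'a) \<Rightarrow> (nat \<Rightarrow> 'h) \<Rightarrow> nat \<Rightarrow> 'h" where
  "act N x \<xi> = (\<lambda>i. \<Sum>k<N. \<pi> (x i k) (\<xi> k))"

lemma act_add: "act N x (\<xi> + \<eta>) = act N x \<xi> + act N x \<eta>"
  by (simp add: act_def fun_eq_iff blinfun.add_right sum.distrib)

lemma act_scale: "act N x (c *\<^sub>C \<xi>) = c *\<^sub>C act N x \<xi>"
  by (simp add: act_def fun_eq_iff scaleC_fun_def pi_app_scale complex_vector.scale_sum_right)

lemma act_diff: "act N x (\<xi> - \<eta>) = act N x \<xi> - act N x \<eta>"
  by (simp add: act_def fun_eq_iff blinfun.diff_right sum_subtractf)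

lemma act_matrix_add: "act N (x + y) \<xi> = act N x \<xi> + act N y \<xi>"
  by (simp add: act_def fun_eq_iff pi_add blinfun.add_left sum.distrib)

lemma act_matrix_scale: "act N (c *\<^sub>C x) \<xi> = c *\<^sub>C act N x \<xi>"
  by (simp add: act_def fun_eq_iff scaleC_fun_def pi_scale scaleC_blinfun.rep_eq complex_vector.scale_sum_right)

lemma act_matrix_diff: "act N (x - y) \<xi> = act N x \<xi> - act N y \<xi>"
  using act_matrix_add [of N "x - y" y \<xi>] by simp

lemma act_mmul: "act N (mmul N x y) \<xi> = act N x (act N y \<xi>)"
proof
  fix i
  have "act N (mmul N x y) \<xi> i = (\<Sum>k<N. \<Sum>j<N. \<pi> (x i j) (\<pi> (y j k) (\<xi> k)))"
    by (simp add: act_def mmul_def pi_sum blinfun.sum_left pi_mult)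
  also have "\<dots> = act N x (act N y \<xi>) i"
    by (subst sum.swap) (simp add: act_def blinfun.sum_right)
  finally show "act N (mmul N x y) \<xi> i = act N x (act N y \<xi>) i" .
qed

lemma act_madj: "tup N (act N x \<xi>) \<eta> = tup N \<xi> (act N (madj x) \<eta>)"
proof -
  have "tup N (act N x \<xi>) \<eta> = (\<Sum>i<N. \<Sum>k<N. cinner (\<xi> k) (\<pi> (star (x i k)) (\<eta> i)))"
    by (simp add: tup_def act_def cinner_sum_left pi_star)
  also have "\<dots> = tup N \<xi> (act N (madj x) \<eta>)"
    by (subst sum.swap) (simp add: tup_def act_def cinner_sum_right madj_def)
  finally show ?thesis .
qed

text \<open>The closed unit ball of the C*-algebra of matrices over \<open>A\<close>, described by
  the action on tuples, so that no norm on matrices has to be built.\<close>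

definition contr :: "nat \<Rightarrow> (nat \<Rightarrow> nat \<Rightarrow> 'a) set" where
  "contr N = {x \<in> mats N. \<forall>\<xi>. tup.sq N (act N x \<xi>) \<le> tup.sq N \<xi>}"

lemma contrD: "x \<in> contr N \<Longrightarrow> tup.sq N (act N x \<xi>) \<le> tup.sq N \<xi>"
  and contr_mats: "x \<in> contr N \<Longrightarrow> x \<in> mats N"
  and contrI: "x \<in> mats N \<Longrightarrow> (\<And>\<xi>. tup.sq N (act N x \<xi>) \<le> tup.sq N \<xi>) \<Longrightarrow> x \<in> contr N"
  by (auto simp: contr_def)

lemma contr_madj: "x \<in> contr N \<Longrightarrow> tup.sq N (act N (madj x) \<xi>) \<le> tup.sq N \<xi>"
  by (rule tup.adjoint_contraction [OF act_madj]) (rule contrD)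

lemma zero_contr: "0 \<in> contr N"
  by (rule contrI) (simp_all add: mats_zero act_def pi_zero tup_sq sum_nonneg)

lemma contr_scale: "x \<in> contr N \<Longrightarrow> cmod c \<le> 1 \<Longrightarrow> c *\<^sub>C x \<in> contr N"
proof (rule contrI)
  fix \<xi> assume x: "x \<in> contr N" and c: "cmod c \<le> 1"
  have "(cmod c)\<^sup>2 * tup.sq N (act N x \<xi>) \<le> 1 * tup.sq N \<xi>"
    by (rule mult_mono) (use c contrD [OF x] in \<open>auto simp: power_le_one\<close>)
  then show "tup.sq N (act N (c *\<^sub>C x) \<xi>) \<le> tup.sq N \<xi>"
    by (simp add: act_matrix_scale tup.sq_scaleC)
qed (auto intro: mats_intros contr_mats)

text \<open>The first and second order coefficients of a curve through the contraction \<open>v\<close>, in the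
  direction \<open>x\<close>, that stays in the unit ball up to fourth order.\<close>

definition curve1 :: "nat \<Rightarrow> (nat \<Rightarrow> nat \<Rightarrow> 'a) \<Rightarrow> (nat \<Rightarrow> nat \<Rightarrow> 'a) \<Rightarrow> nat \<Rightarrow> nat \<Rightarrow> 'a" where
  "curve1 N v x = (1 / 2) *\<^sub>C (x + mmul N v (mmul N (madj x) v))"

definition curve2 :: "nat \<Rightarrow> (nat \<Rightarrow> nat \<Rightarrow> 'a) \<Rightarrow> (nat \<Rightarrow> nat \<Rightarrow> 'a) \<Rightarrow> nat \<Rightarrow> nat \<Rightarrow> 'a" where
  "curve2 N v x = (1 / 4) *\<^sub>C
     (mmul N x (mmul N (madj v) x) + mmul N v (mmul N (madj x) (mmul N v (mmul N (madj x) v)))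
       + (mmul N x (mmul N (madj x) v) + mmul N v (mmul N (madj x) x)))"

text \<open>This is \<open>contraction_curve\<close> for the action on tuples; the scalar factor
  compensates the growth \<open>1 + t ^ 4 / 2\<close> of squared lengths.\<close>

lemma curve_contr:
  assumes v: "v \<in> contr N" and x: "x \<in> contr N"
  shows "complex_of_real (1 / sqrt (1 + t ^ 4 / 2)) *\<^sub>C
      (v + (\<i> * complex_of_real t) *\<^sub>C curve1 N v x - complex_of_real (t\<^sup>2 / 2) *\<^sub>C curve2 N v x) \<in> contr N"
    (is "_ *\<^sub>C ?y \<in> _")
proof (rule contrI)
  show "complex_of_real (1 / sqrt (1 + t ^ 4 / 2)) *\<^sub>C ?y \<in> mats N"
    unfolding curve1_def curve2_def using contr_mats [OF v] contr_mats [OF x]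
    by (intro mats_intros)
  fix \<xi>
  have pos: "0 < 1 + t ^ 4 / 2" by (smt (verit) zero_le_even_power' divide_nonneg_pos even_numeral zero_le_power_eq)
  have "tup.sq N (act N ?y \<xi>) \<le> (1 + t ^ 4 / 2) * tup.sq N \<xi>"
    using tup.contraction_curve [of "act N v" "act N (madj v)" "act N x" "act N (madj x)" N \<xi> t,
        OF act_add act_add act_add act_add act_scale act_scale act_scale act_scale
          act_madj act_madj contrD [OF v] contrD [OF x]]
    by (simp only: act_matrix_add act_matrix_diff act_matrix_scale act_mmul curve1_def curve2_def)
  then show "tup.sq N (act N (complex_of_real (1 / sqrt (1 + t ^ 4 / 2)) *\<^sub>C ?y) \<xi>) \<le> tup.sq N \<xi>"
    unfolding act_matrix_scale [of N _ ?y] tup.sq_scaleC norm_of_real using pos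
    by (simp add: power_divide divide_le_eq mult.commute)
qed

text \<open>Haagerup's argument for the little noncommutative Grothendieck inequality: an almost norm
  attaining \<open>v\<close> is perturbed to second order within the unit ball.\<close>

lemma little_Grothendieck:
  assumes T: "semi_inner T" and le1: "\<And>x. x \<in> contr N \<Longrightarrow> semi_inner.sq T x \<le> 1" and \<delta>: "0 < \<delta>"
  obtains v where "v \<in> contr N"
    and "\<And>x. x \<in> contr N \<Longrightarrow> semi_inner.sq T x
      \<le> Re (T v (mmul N x (mmul N (madj x) v))) + Re (T v (mmul N v (mmul N (madj x) x))) + \<delta>"
    and "\<And>x. x \<in> contr N \<Longrightarrow> - \<delta> \<le> Re (T v (mmul N v (mmul N (madj x) x)))"
    and "\<And>x. x \<in> contr N \<Longrightarrow> - \<delta> \<le> Re (T v (mmul N x (mmul N (madj x) v)))"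
proof -
  interpret T: semi_inner T by (rule T)
  define \<sigma> where "\<sigma> = (SUP x\<in>contr N. T.sq x)"
  have bdd: "bdd_above (T.sq ` contr N)" by (rule bdd_aboveI2) (rule le1)
  have \<sigma>: "T.sq x \<le> \<sigma>" if "x \<in> contr N" for x
    unfolding \<sigma>_def using that by (intro cSUP_upper bdd)
  have \<sigma>1: "\<sigma> \<le> 1" unfolding \<sigma>_def using le1 zero_contr by (intro cSUP_least) auto
  \<comment> \<open>The supremum need not be attained, so \<open>v\<close> is only almost maximal.
    With \<open>t\<^sup>2 = \<delta> / 4\<close> chosen below, the choice
    \<open>\<delta>\<^sup>2 / 32\<close> makes the total error \<open>\<epsilon> + t ^ 4 / 2\<close>
    at most \<open>t\<^sup>2 * (\<delta> / 4)\<close>.\<close>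
  define \<epsilon> where "\<epsilon> = min \<delta> (\<delta>\<^sup>2 / 32)"
  have \<epsilon>: "0 < \<epsilon>" "\<epsilon> \<le> \<delta>" "\<epsilon> \<le> \<delta>\<^sup>2 / 32" using \<delta> by (auto simp: \<epsilon>_def)
  obtain v where v: "v \<in> contr N" and "\<sigma> - \<epsilon> < T.sq v"
    using less_cSUP_iff [OF _ bdd, of "\<sigma> - \<epsilon>"] zero_contr \<epsilon>(1) unfolding \<sigma>_def by fastforce
  then have max: "\<sigma> \<le> T.sq v + \<epsilon>" by simp
  \<comment> \<open>Moving from \<open>v\<close> to \<open>v - w\<close> inside the unit ball cannot
    increase the squared length by more than \<open>\<epsilon>\<close>, so \<open>w\<close> cannot
    point far away from \<open>v\<close>.\<close>
  have pos: "- \<delta> \<le> Re (T v w)" if "v - w \<in> contr N" for w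
  proof -
    have "T.sq v - 2 * Re (T v w) \<le> \<sigma>"
      using \<sigma> [OF that] T.sq_nonneg [of w] unfolding T.sq_diff by linarith
    then show ?thesis using max \<epsilon> by linarith
  qed
  \<comment> \<open>With a prime for the adjoint, \<open>1 - x'x\<close> and \<open>1 - xx'\<close>
    are contractions. They are written as operators on tuples because \<open>A\<close> may lack a
    unit. Composed with \<open>v\<close> they show that \<open>v - vx'x\<close> and
    \<open>v - xx'v\<close> stay in the ball, as \<open>pos\<close> requires.\<close>
  have defect: "tup.sq N (\<xi> - act N (madj x) (act N x \<xi>)) \<le> tup.sq N \<xi>"
    "tup.sq N (\<xi> - act N x (act N (madj x) \<xi>)) \<le> tup.sq N \<xi>" if x: "x \<in> contr N" for x \<xi>
  proof -
    have "Re (tup N \<xi> (act N (madj x) (act N x \<xi>))) = tup.sq N (act N x \<xi>)"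
      by (simp add: tup.sq_def flip: act_madj)
    then show "tup.sq N (\<xi> - act N (madj x) (act N x \<xi>)) \<le> tup.sq N \<xi>"
      using contr_madj [OF x, of "act N x \<xi>"] tup.sq_nonneg [of N "act N x \<xi>"] unfolding tup.sq_diff by linarith
    have "Re (tup N \<xi> (act N x (act N (madj x) \<xi>))) = tup.sq N (act N (madj x) \<xi>)"
      by (subst tup.Re_commute) (simp add: tup.sq_def act_madj)
    then show "tup.sq N (\<xi> - act N x (act N (madj x) \<xi>)) \<le> tup.sq N \<xi>"
      using contrD [OF x, of "act N (madj x) \<xi>"] tup.sq_nonneg [of N "act N (madj x) \<xi>"] unfolding tup.sq_diff by linarith
  qed
  define t where "t = sqrt \<delta> / 2"
  have t2: "t\<^sup>2 = \<delta> / 4" and t4: "t ^ 4 = \<delta>\<^sup>2 / 16" using \<delta>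
    by (simp_all add: t_def power_divide) (simp add: power4_eq_xxxx power2_eq_square)
  \<comment> \<open>The rescaled curve stays in the ball for both signs of the parameter, and
    \<open>\<sigma> \<le> 1\<close> bounds the excess from rescaling by \<open>t ^ 4 / 2\<close>.
    Dividing the conclusion of \<open>second_order\<close> by \<open>t\<^sup>2\<close> gives the
    claim.\<close>
  have perturb: "T.sq (curve1 N v x) \<le> Re (T v (curve2 N v x)) + \<delta> / 4" if x: "x \<in> contr N" for x
  proof -
    have "T.sq (v + (\<i> * complex_of_real s) *\<^sub>C curve1 N v x - complex_of_real (s\<^sup>2 / 2) *\<^sub>C curve2 N v x)
        \<le> \<sigma> + t ^ 4 / 2" if s: "s = t \<or> s = - t" for s
    proof -
      let ?y = "v + (\<i> * complex_of_real s) *\<^sub>C curve1 N v x - complex_of_real (s\<^sup>2 / 2) *\<^sub>C curve2 N v x"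
      have "0 \<le> s ^ 4" by simp
      have "T.sq (complex_of_real (1 / sqrt (1 + s ^ 4 / 2)) *\<^sub>C ?y) \<le> \<sigma>"
        by (rule \<sigma> [OF curve_contr [OF v x]])
      then have "T.sq ?y \<le> \<sigma> * (1 + s ^ 4 / 2)"
        using \<open>0 \<le> s ^ 4\<close> unfolding T.sq_scaleC norm_of_real by (simp add: power_divide divide_le_eq)
      also have "\<dots> \<le> \<sigma> + s ^ 4 / 2"
        using mult_right_mono [OF \<sigma>1, of "s ^ 4 / 2"] by (simp add: algebra_simps)
      also have "s ^ 4 = t ^ 4" using s by auto
      finally show ?thesis .
    qed
    from T.second_order [where t = t, OF this]
    have "t\<^sup>2 * T.sq (curve1 N v x) \<le> \<epsilon> + t ^ 4 / 2 + t\<^sup>2 * Re (T v (curve2 N v x))"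
      using max by linarith
    also have "\<epsilon> + t ^ 4 / 2 \<le> t\<^sup>2 * (\<delta> / 4)"
      using \<epsilon> \<delta> unfolding t2 t4 by (simp add: power2_eq_square)
    finally have "\<delta> / 4 * T.sq (curve1 N v x) \<le> \<delta> / 4 * (\<delta> / 4 + Re (T v (curve2 N v x)))"
      unfolding t2 by (simp only: distrib_left)
    then show ?thesis
      using \<delta> by (simp add: mult_le_cancel_left)
  qed
  show thesis
  proof (rule that [OF v])
    fix x assume x: "x \<in> contr N"
    \<comment> \<open>The first order coefficient contains the adjoint of \<open>x\<close> and is
      thus only real linear in \<open>x\<close>. Running the curve also in the direction
      \<open>- \<i> x\<close> and adding \<open>\<i>\<close> times the result recovers
      \<open>x\<close> itself.\<close>
    define x' where "x' = (- \<i>) *\<^sub>C x"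
    have x': "x' \<in> contr N" unfolding x'_def by (rule contr_scale [OF x]) simp
    define w where "w = mmul N v (mmul N (madj x) v)"
    have "mmul N v (mmul N (madj x') v) = \<i> *\<^sub>C w"
      by (simp only: x'_def w_def madj_scale mmul_scale_left mmul_scale_right) simp
    then have "curve1 N v x + \<i> *\<^sub>C curve1 N v x'
        = ((1 / 2) *\<^sub>C x + (1 / 2) *\<^sub>C x) + ((1 / 2) *\<^sub>C w + (- 1 / 2) *\<^sub>C w)"
      by (simp add: curve1_def x'_def scaleC_scaleC complex_vector.scale_right_distrib w_def [symmetric]
          del: complex_vector.scale_minus_left complex_vector.scale_minus_right)
    also have "\<dots> = x"
      unfolding scaleC_add_left [symmetric] by (simp add: scaleC_one)
    finally have "x = curve1 N v x + \<i> *\<^sub>C curve1 N v x'" by simp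
    then have "T.sq x \<le> 2 * T.sq (curve1 N v x) + 2 * T.sq (curve1 N v x')"
      using T.sq_add_le [of "curve1 N v x" "\<i> *\<^sub>C curve1 N v x'"] by (simp add: T.sq_scaleC)
    also have "\<dots> \<le> 2 * (Re (T v (curve2 N v x)) + \<delta> / 4) + 2 * (Re (T v (curve2 N v x')) + \<delta> / 4)"
      by (intro add_mono mult_left_mono perturb x x') simp_all
    \<comment> \<open>In \<open>curve2\<close> the summands with \<open>x\<close> twice or its
      adjoint twice change sign when \<open>x\<close> is replaced by \<open>x'\<close> and cancel;
      the summands containing one of each are unchanged and double.\<close>
    also have "\<dots> = Re (T v (mmul N x (mmul N (madj x) v))) + Re (T v (mmul N v (mmul N (madj x) x))) + \<delta>"
      by (simp only: curve2_def x'_def madj_scale mmul_scale_left mmul_scale_right T.add_right T.scaleC_right)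
        (simp add: field_simps)
    finally show "T.sq x \<le> Re (T v (mmul N x (mmul N (madj x) v))) + Re (T v (mmul N v (mmul N (madj x) x))) + \<delta>" .
    have m: "v \<in> mats N" "x \<in> mats N" using v x by (auto intro: contr_mats)
    show "- \<delta> \<le> Re (T v (mmul N v (mmul N (madj x) x)))"
    proof (intro pos contrI mats_intros m)
      fix \<xi>
      have "act N (v - mmul N v (mmul N (madj x) x)) \<xi> = act N v (\<xi> - act N (madj x) (act N x \<xi>))"
        by (simp add: act_matrix_diff act_mmul act_diff)
      then show "tup.sq N (act N (v - mmul N v (mmul N (madj x) x)) \<xi>) \<le> tup.sq N \<xi>"
        using order_trans [OF contrD [OF v] defect(1) [OF x]] by simp
    qed
    show "- \<delta> \<le> Re (T v (mmul N x (mmul N (madj x) v)))"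
    proof (intro pos contrI mats_intros m)
      fix \<xi>
      have "act N (v - mmul N x (mmul N (madj x) v)) \<xi> = act N v \<xi> - act N x (act N (madj x) (act N v \<xi>))"
        by (simp add: act_matrix_diff act_mmul)
      then show "tup.sq N (act N (v - mmul N x (mmul N (madj x) v)) \<xi>) \<le> tup.sq N \<xi>"
        using order_trans [OF defect(2) [OF x] contrD [OF v]] by simp
    qed
  qed
qed

end

section \<open>The interpolation norm dominates weighted Hilbert norms\<close>

lemma cmod_cinner_le: "cmod (cinner x y) \<le> norm x * norm y"
  for x y :: "'k::complex_hilbert"
proof -
  interpret semi_inner "cinner :: 'k \<Rightarrow> 'k \<Rightarrow> complex"
    by standard (simp_all add: cinner_add_right cinner_scaleC_right cinner_self flip: cinner_commute)
  have sq: "sq z = (norm z)\<^sup>2" for z by (simp add: sq_def cinner_self)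
  show ?thesis
  proof (cases "norm x = 0 \<or> norm y = 0")
    case True
    then show ?thesis using zero_left zero_right by auto
  next
    case False
    define a where "a = complex_of_real (inverse (norm x))"
    define b where "b = complex_of_real (inverse (norm y))"
    have n: "norm (a *\<^sub>C x) = 1" "norm (b *\<^sub>C y) = 1"
      using False by (simp_all add: a_def b_def norm_scaleC norm_inverse)
    have "cmod (cinner (a *\<^sub>C x) (b *\<^sub>C y)) \<le> 1"
      using cmod_le [of "a *\<^sub>C x" "b *\<^sub>C y"] unfolding sq n by simp
    then show ?thesis
      using False by (simp add: scaleC_left scaleC_right norm_mult norm_divide a_def b_def norm_inverse divide_simps mult.commute)
  qed
qed

lemma cinner_mean_le: "2 * cmod (cinner x y) \<le> (norm x)\<^sup>2 + (norm y)\<^sup>2"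
  for x y :: "'k::complex_hilbert"
  using cmod_cinner_le [of x y] sum_squares_bound [of "norm x" "norm y"] by simp

text \<open>The bound is the same on both boundary lines, so this is a maximum principle. The factor
  \<open>exp (\<epsilon> * z\<^sup>2)\<close> decays as the imaginary part grows, which reduces the
  strip to a rectangle and costs at most \<open>exp \<epsilon>\<close>; then
  \<open>\<epsilon>\<close> tends to 0.\<close>

lemma three_lines:
  assumes hol: "G holomorphic_on {z. 0 < Re z \<and> Re z < 1}"
    and cont: "continuous_on {z. 0 \<le> Re z \<and> Re z \<le> 1} G"
    and bounded: "\<And>z. 0 \<le> Re z \<Longrightarrow> Re z \<le> 1 \<Longrightarrow> cmod (G z) \<le> K"
    and le: "\<And>t. cmod (G (Complex 0 t)) \<le> B" "\<And>t. cmod (G (Complex 1 t)) \<le> B"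
    and B: "0 < B" and \<theta>: "0 < \<theta>" "\<theta> < 1"
  shows "cmod (G (complex_of_real \<theta>)) \<le> B"
proof -
  have K: "0 \<le> K" using order_trans [OF norm_ge_zero bounded [of 0]] by simp
  have "cmod (G (complex_of_real \<theta>)) \<le> B * exp \<epsilon>" if \<epsilon>: "0 < \<epsilon>" for \<epsilon>
  proof -
    \<comment> \<open>A height at which the decay beats the crude bound \<open>K\<close>. Using
      \<open>K + B\<close> in place of \<open>K\<close> allows \<open>K = 0\<close>, and the summand
      1 keeps the rectangle nondegenerate.\<close>
    define Y where "Y = sqrt (\<bar>ln (B / (K + B))\<bar> / \<epsilon>) + 1"
    have Y0: "0 < Y" using \<epsilon> by (simp add: Y_def add_nonneg_pos)
    have "\<bar>ln (B / (K + B))\<bar> / \<epsilon> \<le> Y\<^sup>2"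
      using \<epsilon> by (simp add: Y_def power2_sum)
    then have "- \<epsilon> * Y\<^sup>2 \<le> ln (B / (K + B))"
      using \<epsilon> by (simp add: field_simps abs_le_iff)
    then have "exp (- \<epsilon> * Y\<^sup>2) \<le> B / (K + B)"
      using B K by (simp add: ln_ge_iff)
    then have "exp (- \<epsilon> * Y\<^sup>2) * (K + B) \<le> B"
      using B K by (simp add: pos_le_divide_eq)
    moreover have "0 \<le> exp (- \<epsilon> * Y\<^sup>2) * B" using B by simp
    ultimately have Y: "K * exp (- \<epsilon> * Y\<^sup>2) \<le> B"
      by (simp only: distrib_left mult.commute [of K])
    define h where "h = (\<lambda>z. G z * exp (complex_of_real \<epsilon> * z\<^sup>2))"
    define R where "R = cbox (Complex 0 (- Y)) (Complex 1 Y)"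
    have R: "z \<in> R \<longleftrightarrow> 0 \<le> Re z \<and> Re z \<le> 1 \<and> - Y \<le> Im z \<and> Im z \<le> Y" for z
      by (auto simp: R_def in_cbox_complex_iff)
    have int: "interior R = box (Complex 0 (- Y)) (Complex 1 Y)"
      unfolding R_def by (rule interior_cbox)
    have nexp: "cmod (exp (complex_of_real \<epsilon> * z\<^sup>2)) = exp (\<epsilon> * ((Re z)\<^sup>2 - (Im z)\<^sup>2))" for z
      by (simp add: power2_eq_square)
    have bnd: "cmod (h z) \<le> B * exp \<epsilon>" if z: "z \<in> frontier R" for z
    proof -
      have zR: "z \<in> R" using z frontier_subset_closed [of R] by (auto simp: R_def)
      have "z \<notin> interior R" using z by (simp add: frontier_def)
      then have "Re z = 0 \<or> Re z = 1 \<or> \<bar>Im z\<bar> = Y"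
        using zR R [of z] unfolding int by (auto simp: in_box_complex_iff)
      then consider "Re z = 0 \<or> Re z = 1" | "\<bar>Im z\<bar> = Y" by blast
      then show ?thesis
      proof cases
        case 1
        then have "cmod (G z) \<le> B" using le [of "Im z"] by (metis complex.collapse)
        moreover have "exp (\<epsilon> * ((Re z)\<^sup>2 - (Im z)\<^sup>2)) \<le> exp \<epsilon>"
          using 1 \<epsilon> by (auto intro: order_trans [of _ 0])
        ultimately show ?thesis
          unfolding h_def norm_mult nexp using B by (intro mult_mono) auto
      next
        case 2
        then have "(Im z)\<^sup>2 = Y\<^sup>2" by (metis power2_abs)
        moreover have "(Re z)\<^sup>2 \<le> 1" using zR R by (simp add: power_le_one)
        ultimately have "\<epsilon> * ((Re z)\<^sup>2 - (Im z)\<^sup>2) \<le> \<epsilon> + - \<epsilon> * Y\<^sup>2"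
          using \<epsilon> mult_left_mono [of "(Re z)\<^sup>2" 1 \<epsilon>] by (simp add: algebra_simps)
        then have e: "exp (\<epsilon> * ((Re z)\<^sup>2 - (Im z)\<^sup>2)) \<le> exp (- \<epsilon> * Y\<^sup>2) * exp \<epsilon>"
          by (simp flip: exp_add)
        have "cmod (h z) \<le> K * (exp (- \<epsilon> * Y\<^sup>2) * exp \<epsilon>)"
          unfolding h_def norm_mult nexp using bounded [of z] e K zR R by (intro mult_mono) auto
        also have "\<dots> \<le> B * exp \<epsilon>"
          using mult_right_mono [OF Y, of "exp \<epsilon>"] by (simp add: mult.assoc)
        finally show ?thesis .
      qed
    qed
    have sub: "interior R \<subseteq> {z. 0 < Re z \<and> Re z < 1}"
      unfolding int by (auto simp: in_box_complex_iff)
    have "cmod (h (complex_of_real \<theta>)) \<le> B * exp \<epsilon>"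
    proof (rule maximum_modulus_frontier [of h R])
      show "h holomorphic_on interior R"
        unfolding h_def by (intro holomorphic_intros holomorphic_on_subset [OF hol sub])
      have "closure R \<subseteq> {z. 0 \<le> Re z \<and> Re z \<le> 1}"
        using R by (auto simp: R_def)
      then show "continuous_on (closure R) h"
        unfolding h_def by (intro continuous_intros continuous_on_subset [OF cont])
      show "bounded R" by (simp add: R_def)
      show "complex_of_real \<theta> \<in> R" using \<theta> Y0 by (simp add: R)
    qed (rule bnd)
    moreover have "1 \<le> exp (\<epsilon> * \<theta>\<^sup>2)" using \<epsilon> by simp
    then have "cmod (G (complex_of_real \<theta>)) \<le> cmod (h (complex_of_real \<theta>))"
      unfolding h_def norm_mult nexp using mult_left_mono [of 1 "exp (\<epsilon> * \<theta>\<^sup>2)"] by simp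
    ultimately show ?thesis by simp
  qed
  moreover have "((\<lambda>\<epsilon>. B * exp \<epsilon>) \<longlongrightarrow> B * exp 0) (at_right 0)"
    by (intro tendsto_intros)
  ultimately show ?thesis
    by (intro tendsto_lowerbound [of "\<lambda>\<epsilon>. B * exp \<epsilon>" B "at_right 0"])
      (auto intro!: eventually_at_rightI [of 0 1])
qed

section \<open>Lower bounds for the column and row matrix norms\<close>

lemma op_mat_norm_upper:
  fixes T :: "nat \<Rightarrow> nat \<Rightarrow> 'h \<Rightarrow>\<^sub>L 'h::real_normed_vector"
  assumes "L2_set (\<lambda>k. norm (\<xi> k)) {..<n} \<le> 1"
  shows "L2_set (\<lambda>i. norm (\<Sum>k<n. T i k (\<xi> k))) {..<n} \<le> op_mat_norm n T"
  unfolding op_mat_norm_def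
proof (rule cSUP_upper)
  \<comment> \<open>A supremum of reals dominates its members only for a bounded set; the sum of all
    entry norms is a sufficient bound.\<close>
  show "bdd_above ((\<lambda>\<xi>. L2_set (\<lambda>i. norm (\<Sum>k<n. T i k (\<xi> k))) {..<n})
      ` {\<xi>. L2_set (\<lambda>k. norm (\<xi> k)) {..<n} \<le> 1})"
  proof (rule bdd_aboveI2)
    fix \<xi> :: "nat \<Rightarrow> 'h" assume "\<xi> \<in> {\<xi>. L2_set (\<lambda>k. norm (\<xi> k)) {..<n} \<le> 1}"
    then have le: "L2_set (\<lambda>k. norm (\<xi> k)) {..<n} \<le> 1" by simp
    have \<xi>: "norm (\<xi> k) \<le> 1" if "k < n" for k
      by (rule order_trans [OF member_le_L2_set le]) (use that in auto)
    have "L2_set (\<lambda>i. norm (\<Sum>k<n. T i k (\<xi> k))) {..<n} \<le> (\<Sum>i<n. norm (\<Sum>k<n. T i k (\<xi> k)))"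
      by (rule L2_set_le_sum) simp
    also have "\<dots> \<le> (\<Sum>i<n. \<Sum>k<n. norm (T i k))"
    proof (intro sum_mono order_trans [OF norm_sum])
      fix i k assume "k \<in> {..<n}"
      then have "norm (T i k) * norm (\<xi> k) \<le> norm (T i k) * 1" by (intro mult_left_mono \<xi>) auto
      then show "norm (T i k (\<xi> k)) \<le> norm (T i k)"
        using norm_blinfun [of "T i k" "\<xi> k"] by simp
    qed
    finally show "L2_set (\<lambda>i. norm (\<Sum>k<n. T i k (\<xi> k))) {..<n} \<le> (\<Sum>i<n. \<Sum>k<n. norm (T i k))" .
  qed
qed (use assms in simp)

lemma op_mat_norm_nonneg: "0 \<le> op_mat_norm n T"
  using order_trans [OF L2_set_nonneg op_mat_norm_upper [of "\<lambda>_. 0" n T]] by (simp add: L2_set_def)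

lemma opspace_norm_nonneg: "0 \<le> opspace_norm \<iota> n x"
  by (simp add: opspace_norm_def op_mat_norm_nonneg)

lemma opspace_norm_zero:
  fixes \<iota> :: "'e::zero \<Rightarrow> 'h \<Rightarrow>\<^sub>L 'h::real_normed_vector"
  assumes "\<iota> 0 = 0"
  shows "opspace_norm \<iota> n 0 = 0"
proof -
  define \<Xi> :: "(nat \<Rightarrow> 'h) set" where "\<Xi> = {\<xi>. L2_set (\<lambda>k. norm (\<xi> k)) {..<n} \<le> 1}"
  have "(\<lambda>_. 0) \<in> \<Xi>" by (simp add: \<Xi>_def L2_set_def)
  then have "\<Xi> \<noteq> {}" by blast
  then have "(SUP \<xi>\<in>\<Xi>. 0::real) = 0" by (rule cSUP_const)
  then show ?thesis
    using assms unfolding opspace_norm_def op_mat_norm_def \<Xi>_def [symmetric] by (simp add: L2_set_0')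
qed

text \<open>The test vector has \<open>unit_vec 0\<close> in the place \<open>q\<close> and zeros
  elsewhere. As \<open>col_op\<close> maps \<open>unit_vec 0\<close> to its argument, the image is
  the whole column \<open>q\<close>.\<close>

lemma col_norm_ge:
  assumes q: "q < N"
  shows "L2_set (\<lambda>p. norm (x p q)) {..<N} \<le> opspace_norm col_op N x"
proof -
  define \<xi> where "\<xi> = (\<lambda>k. if k = q then unit_vec 0 else 0)"
  have "L2_set (\<lambda>k. norm (\<xi> k)) {..<N} \<le> 1"
    using q by (simp add: \<xi>_def L2_set_def if_distrib [of "\<lambda>z. (norm z)\<^sup>2"] cong: if_cong)
  note op_mat_norm_upper [OF this, of "\<lambda>i j. col_op (x i j)"]
  moreover have "(\<Sum>k<N. col_op (x p k) (\<xi> k)) = x p q" for p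
    using q by (simp add: \<xi>_def if_distrib [of "blinfun_apply _"] col_op_apply scaleC_one cong: if_cong)
  ultimately show ?thesis by (simp add: opspace_norm_def)
qed

text \<open>The test vector is the normalised row \<open>p\<close> with conjugated coordinates,
  since \<open>row_op\<close> pairs bilinearly. Coordinate \<open>p\<close> of the image already has
  norm equal to the length of that row.\<close>

lemma row_norm_ge:
  assumes p: "p < N"
  shows "L2_set (\<lambda>q. norm (x p q)) {..<N} \<le> opspace_norm row_op N x"
proof -
  define r where "r = L2_set (\<lambda>q. norm (x p q)) {..<N}"
  show ?thesis
  proof (cases "r = 0")
    case True
    then show ?thesis using opspace_norm_nonneg by (metis r_def)
  next
    case False
    have "0 \<le> r" by (simp add: r_def L2_set_nonneg)
    with False have r: "0 < r" by simp
    have r2: "(\<Sum>q<N. (norm (x p q))\<^sup>2) = r\<^sup>2"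
      by (simp add: r_def L2_set_def sum_nonneg)
    define y where "y = (\<lambda>q. Abs_ell2 (\<lambda>i. cnj (coord (x p q) i)))"
    have y: "coord (y q) i = cnj (coord (x p q) i)" for q i
      unfolding y_def by (subst Abs_ell2_inverse) (simp_all add: summable_coord)
    have ny: "norm (y q) = norm (x p q)" for q by (simp add: norm_ell2_def y)
    define \<xi> where "\<xi> = (\<lambda>q. complex_of_real (inverse r) *\<^sub>C y q)"
    have "(\<Sum>k<N. (norm (\<xi> k))\<^sup>2) = (inverse r)\<^sup>2 * (\<Sum>k<N. (norm (x p k))\<^sup>2)"
      by (simp add: \<xi>_def norm_scaleC ny norm_inverse power_mult_distrib sum_distrib_left power_inverse)
    then have "L2_set (\<lambda>k. norm (\<xi> k)) {..<N} \<le> 1"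
      using r by (simp add: L2_set_def r2 power_inverse)
    note * = op_mat_norm_upper [OF this, of "\<lambda>i j. row_op (x i j)"]
    have "row_op (x p k) (y k) = complex_of_real ((norm (x p k))\<^sup>2) *\<^sub>C unit_vec 0" for k
      using cinner_self [of "x p k"] by (simp add: row_op_apply y cinner_ell2_def mult.commute)
    moreover have "row_op z (c *\<^sub>C w) = c *\<^sub>C row_op z w" for z w c
      using suminf_mult [OF summable_bilinear [of z w], of c]
      by (simp add: row_op_apply scaleC_scaleC algebra_simps)
    ultimately have "(\<Sum>k<N. row_op (x p k) (\<xi> k))
        = (\<Sum>k<N. complex_of_real (inverse r * (norm (x p k))\<^sup>2)) *\<^sub>C unit_vec 0"
      by (simp add: \<xi>_def scaleC_scaleC complex_vector.scale_sum_left)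
    also have "(\<Sum>k<N. complex_of_real (inverse r * (norm (x p k))\<^sup>2)) = complex_of_real r"
      using r unfolding of_real_sum [symmetric] sum_distrib_left [symmetric] r2
      by (simp add: power2_eq_square)
    finally have "norm (\<Sum>k<N. row_op (x p k) (\<xi> k)) = r"
      using r by (simp add: norm_scaleC)
    moreover have "norm (\<Sum>k<N. row_op (x p k) (\<xi> k))
        \<le> L2_set (\<lambda>i. norm (\<Sum>k<N. row_op (x i k) (\<xi> k))) {..<N}"
      by (rule member_le_L2_set) (use p in auto)
    ultimately show ?thesis using * by (simp add: opspace_norm_def r_def)
  qed
qed

lemma L2_set_square: "(L2_set f A)\<^sup>2 = (\<Sum>i\<in>A. (f i)\<^sup>2)"
  by (simp add: L2_set_def sum_nonneg)

section \<open>Scalar functions on the strip obtained from the couple of column and row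
  matrices\<close>

locale row_column_interpolation =
  fixes N :: nat
begin

definition "X = (mats N :: (nat \<Rightarrow> nat \<Rightarrow> ell2) set)"
definition "N0 = opspace_norm col_op N"
definition "N1 = opspace_norm row_op N"

lemma nonneg: "0 \<le> N0 x" "0 \<le> N1 x"
  by (simp_all add: N0_def N1_def opspace_norm_nonneg)

lemma zero: "N0 0 = 0" "N1 0 = 0"
proof -
  have "col_op 0 = 0" "row_op 0 = 0"
    using norm_col_op [of 0] norm_row_op [of 0] by simp_all
  then show "N0 0 = 0" "N1 0 = 0" by (simp_all add: N0_def N1_def opspace_norm_zero)
qed

lemma X_subspace: "0 \<in> X" "x \<in> X \<Longrightarrow> y \<in> X \<Longrightarrow> x + y \<in> X"
  "x \<in> X \<Longrightarrow> y \<in> X \<Longrightarrow> x - y \<in> X" "x \<in> X \<Longrightarrow> c *\<^sub>C x \<in> X"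
  by (auto simp: X_def intro: mats_intros)

lemma sum_space: "sum_space X X = X"
proof
  show "X \<subseteq> sum_space X X"
    unfolding sum_space_def using X_subspace(1) by (smt (verit) add_0 mem_Collect_eq subsetI)
qed (auto simp: sum_space_def X_subspace)

lemma entry_le:
  assumes "p < N" "q < N"
  shows "norm (x p q) \<le> N0 x" "norm (x p q) \<le> N1 x"
proof -
  show "norm (x p q) \<le> N0 x" unfolding N0_def
    by (rule order_trans [OF _ col_norm_ge [OF assms(2)]]) (rule member_le_L2_set, use assms in auto)
  show "norm (x p q) \<le> N1 x" unfolding N1_def
    by (rule order_trans [OF _ row_norm_ge [OF assms(1)]]) (rule member_le_L2_set, use assms in auto)
qed

abbreviation "sn \<equiv> sum_norm X N0 X N1"

text \<open>Both end norms dominate every entry, hence so does the sum norm. This is what carries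
  continuity and holomorphy in the sum norm over to scalar functions of the entries.\<close>

lemma entry_le_sum_norm:
  assumes pq: "p < N" "q < N" and x: "x \<in> X"
  shows "norm (x p q) \<le> sn x"
  unfolding sum_norm_def
proof (rule cInf_greatest)
  show "{N0 a + N1 b |a b. a \<in> X \<and> b \<in> X \<and> x = a + b} \<noteq> {}"
    using x X_subspace(1) add_0_right [of x, symmetric] by blast
  fix s assume "s \<in> {N0 a + N1 b |a b. a \<in> X \<and> b \<in> X \<and> x = a + b}"
  then obtain a b where "s = N0 a + N1 b" "x = a + b" by auto
  then show "norm (x p q) \<le> s"
    using norm_triangle_ineq [of "a p q" "b p q"] entry_le [OF pq, of a] entry_le [OF pq, of b] by simp
qed

lemma sum_norm_zero: "sn 0 = 0"
proof (rule antisym)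
  have bdd: "bdd_below {N0 a + N1 b |a b. a \<in> X \<and> b \<in> X \<and> 0 = a + b}"
    using nonneg by (auto intro!: bdd_belowI [of _ 0] add_nonneg_nonneg)
  show "sn 0 \<le> 0" unfolding sum_norm_def
    by (rule cInf_lower [OF _ bdd]) (use zero X_subspace(1) in \<open>auto intro!: exI [of _ 0]\<close>)
  show "0 \<le> sn 0" unfolding sum_norm_def
    by (rule cInf_greatest) (use nonneg X_subspace(1) in \<open>auto intro!: exI [of _ 0] add_nonneg_nonneg\<close>)
qed

text \<open>Both end spaces have the same elements, so constants are admissible. Therefore the
  infimum in \<open>interp_norm\<close> runs over a nonempty set.\<close>

lemma const_interp_function:
  assumes x: "x \<in> X"
  shows "(\<lambda>_. x) \<in> interp_functions X N0 X N1"
proof -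
  have c: "norm_continuous_on S M (\<lambda>_. x)" if "M 0 = 0" for M and S :: "'z::topological_space set"
    using that by (simp add: norm_continuous_on_def)
  have "norm_holomorphic_on S X sn (\<lambda>_. x)" for S
    unfolding norm_holomorphic_on_def using X_subspace(1) by (auto intro!: bexI [of _ 0] simp: sum_norm_zero)
  then show ?thesis
    using x c [of sn, OF sum_norm_zero] c [of N0, OF zero(1)] c [of N1, OF zero(2)]
    by (auto simp: interp_functions_def sum_space)
qed

text \<open>An admissible \<open>F\<close> is paired with a fixed matrix \<open>e\<close>, with
  weights continued analytically in \<open>z\<close>. On \<open>Re z = 0\<close> the weights reduce
  to \<open>D q\<close> and are matched by column norms, on \<open>Re z = 1\<close> to
  \<open>D p\<close> and row norms; at \<open>\<theta>\<close> the pairing is exactly the weighted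
  sum of squares \<open>\<tau>\<close>.\<close>

lemma interp_norm_ge:
  assumes x: "x \<in> X" and \<theta>: "0 < \<theta>" "\<theta> < 1"
    and D: "\<And>p. p < N \<Longrightarrow> 0 < D p" and sumD: "(\<Sum>p<N. D p) \<le> 1"
  shows "sqrt (\<Sum>p<N. \<Sum>q<N. D p powr \<theta> * D q powr (1 - \<theta>) * (norm (x p q))\<^sup>2)
    \<le> interp_norm X N0 X N1 \<theta> x"
proof -
  define e where "e = (\<lambda>p q. complex_of_real (D p powr (\<theta> / 2) * D q powr ((1 - \<theta>) / 2)) *\<^sub>C x p q)"
  define \<tau> where "\<tau> = (\<Sum>p<N. \<Sum>q<N. (norm (e p q))\<^sup>2)"
  have \<tau>0: "0 \<le> \<tau>" by (simp add: \<tau>_def sum_nonneg)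
  have D1: "D p \<le> 1" if "p < N" for p
    using member_le_sum [of p "{..<N}" D] that D sumD by (auto simp: less_imp_le)
  have "\<tau> \<le> M\<^sup>2"
    if F: "F \<in> interp_functions X N0 X N1" and F\<theta>: "F (complex_of_real \<theta>) = x"
      and M: "M = max (SUP t. N0 (F (Complex 0 t))) (SUP t. N1 (F (Complex 1 t)))" for F M
  \<comment> \<open>For \<open>\<tau> > 0\<close> the bound \<open>(\<tau> + M\<^sup>2) / 2\<close>
    is positive, as \<open>three_lines\<close> demands.\<close>
  proof (cases "\<tau> = 0")
    case False
    define L where "L = (\<lambda>p q z. exp (z / 2 * complex_of_real (ln (D p)))
      * exp ((1 - z) / 2 * complex_of_real (ln (D q))))"
    define G where "G = (\<lambda>z. \<Sum>p<N. \<Sum>q<N. L p q z * cinner (e p q) (F z p q))"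
    have FX: "F z \<in> X" if "0 \<le> Re z" "Re z \<le> 1" for z
      using F that by (auto simp: interp_functions_def sum_space)
    have entry: "cmod (cinner w (y p q)) \<le> norm w * sn y" if "y \<in> X" "p < N" "q < N" for w y p q
      by (rule order_trans [OF cmod_cinner_le]) (intro mult_left_mono entry_le_sum_norm that norm_ge_zero)
    have L: "cmod (L p q z) = D p powr (Re z / 2) * D q powr ((1 - Re z) / 2)"
      if "p < N" "q < N" for p q z
      using D [OF that(1)] D [OF that(2)] by (simp add: L_def norm_mult powr_def)
    have cinner_diff: "cinner w (y - z) = cinner w y - cinner w z" for w y z :: ell2
      using cinner_add_right [of w "y - z" z] by simp
    have cont: "continuous_on {z. 0 \<le> Re z \<and> Re z \<le> 1} (\<lambda>z. cinner (e p q) (F z p q))"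
      if pq: "p < N" "q < N" for p q
      unfolding continuous_on_def
    proof
      fix z assume z: "z \<in> {z. 0 \<le> Re z \<and> Re z \<le> 1}"
      have "((\<lambda>w. sn (F w - F z)) \<longlongrightarrow> 0) (at z within {z. 0 \<le> Re z \<and> Re z \<le> 1})"
        using F z by (auto simp: interp_functions_def norm_continuous_on_def)
      then have "((\<lambda>w. norm (e p q) * sn (F w - F z)) \<longlongrightarrow> 0) (at z within {z. 0 \<le> Re z \<and> Re z \<le> 1})"
        by (rule tendsto_mult_right_zero)
      moreover have "\<forall>\<^sub>F w in at z within {z. 0 \<le> Re z \<and> Re z \<le> 1}.
          cmod (cinner (e p q) (F w p q) - cinner (e p q) (F z p q)) \<le> norm (e p q) * sn (F w - F z)"
        unfolding eventually_at_filter
      proof (intro always_eventually allI impI)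
        fix w assume "w \<in> {z. 0 \<le> Re z \<and> Re z \<le> 1}"
        then have "F w - F z \<in> X" using z by (intro X_subspace FX) auto
        from entry [OF this pq, of "e p q"]
        show "cmod (cinner (e p q) (F w p q) - cinner (e p q) (F z p q)) \<le> norm (e p q) * sn (F w - F z)"
          by (simp add: cinner_diff)
      qed
      ultimately have "((\<lambda>w. cinner (e p q) (F w p q) - cinner (e p q) (F z p q)) \<longlongrightarrow> 0)
          (at z within {z. 0 \<le> Re z \<and> Re z \<le> 1})"
        by (rule Lim_null_comparison [rotated])
      then show "((\<lambda>z. cinner (e p q) (F z p q)) \<longlongrightarrow> cinner (e p q) (F z p q))
          (at z within {z. 0 \<le> Re z \<and> Re z \<le> 1})"
        by (rule LIM_zero_cancel)
    qed
    have hol: "(\<lambda>z. cinner (e p q) (F z p q)) holomorphic_on {z. 0 < Re z \<and> Re z < 1}"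
      if pq: "p < N" "q < N" for p q
      unfolding holomorphic_on_def field_differentiable_def
    proof
      let ?S = "{z. 0 < Re z \<and> Re z < 1}"
      fix z assume z: "z \<in> ?S"
      obtain F' where F': "F' \<in> X"
        and lim: "((\<lambda>w. sn (inverse (w - z) *\<^sub>C (F w - F z) - F')) \<longlongrightarrow> 0) (at z within ?S)"
        using F z by (auto simp: interp_functions_def norm_holomorphic_on_def sum_space)
      have "((\<lambda>w. norm (e p q) * sn (inverse (w - z) *\<^sub>C (F w - F z) - F')) \<longlongrightarrow> 0) (at z within ?S)"
        using lim by (rule tendsto_mult_right_zero)
      moreover have "\<forall>\<^sub>F w in at z within ?S.
          cmod ((cinner (e p q) (F w p q) - cinner (e p q) (F z p q)) / (w - z) - cinner (e p q) (F' p q))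
            \<le> norm (e p q) * sn (inverse (w - z) *\<^sub>C (F w - F z) - F')"
        unfolding eventually_at_filter
      proof (intro always_eventually allI impI)
        fix w assume "w \<in> ?S"
        then have "inverse (w - z) *\<^sub>C (F w - F z) - F' \<in> X"
          using z F' by (intro X_subspace FX) auto
        from entry [OF this pq, of "e p q"]
        show "cmod ((cinner (e p q) (F w p q) - cinner (e p q) (F z p q)) / (w - z) - cinner (e p q) (F' p q))
            \<le> norm (e p q) * sn (inverse (w - z) *\<^sub>C (F w - F z) - F')"
          by (simp add: scaleC_fun_def cinner_diff cinner_scaleC_right divide_inverse mult.commute)
      qed
      ultimately have "((\<lambda>w. (cinner (e p q) (F w p q) - cinner (e p q) (F z p q)) / (w - z)
          - cinner (e p q) (F' p q)) \<longlongrightarrow> 0) (at z within ?S)"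
        by (rule Lim_null_comparison [rotated])
      then have "((\<lambda>w. (cinner (e p q) (F w p q) - cinner (e p q) (F z p q)) / (w - z))
          \<longlongrightarrow> cinner (e p q) (F' p q)) (at z within ?S)"
        by (rule LIM_zero_cancel)
      then show "\<exists>f'. ((\<lambda>z. cinner (e p q) (F z p q)) has_field_derivative f') (at z within ?S)"
        unfolding has_field_derivative_iff by blast
    qed
    obtain K where K: "\<And>z. 0 \<le> Re z \<Longrightarrow> Re z \<le> 1 \<Longrightarrow> sn (F z) \<le> K"
      using F unfolding interp_functions_def bdd_above_def by auto
    have MN: "N0 (F (Complex 0 t)) \<le> M" "N1 (F (Complex 1 t)) \<le> M" for t
    proof -
      have "N0 (F (Complex 0 t)) \<le> (SUP t. N0 (F (Complex 0 t)))"
        using F by (intro cSUP_upper) (auto simp: interp_functions_def)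
      then show "N0 (F (Complex 0 t)) \<le> M" by (simp add: M)
      have "N1 (F (Complex 1 t)) \<le> (SUP t. N1 (F (Complex 1 t)))"
        using F by (intro cSUP_upper) (auto simp: interp_functions_def)
      then show "N1 (F (Complex 1 t)) \<le> M" by (simp add: M)
    qed
    \<comment> \<open>The arithmetic mean replaces Cauchy-Schwarz, so \<open>e\<close> needs no
      normalisation: in the end \<open>\<tau> \<le> (\<tau> + M\<^sup>2) / 2\<close>, that is
      \<open>\<tau> \<le> M\<^sup>2\<close>.\<close>
    have mean: "cmod (G z) \<le> (\<tau> + (\<Sum>p<N. \<Sum>q<N. D p powr Re z * D q powr (1 - Re z) * (norm (F z p q))\<^sup>2)) / 2" for z
    proof -
      have "2 * cmod (L p q z * cinner (e p q) (F z p q))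
          \<le> (norm (e p q))\<^sup>2 + D p powr Re z * D q powr (1 - Re z) * (norm (F z p q))\<^sup>2"
        if pq: "p < N" "q < N" for p q
      proof -
        have sq: "(a powr (s / 2))\<^sup>2 = a powr s" for a s :: real
          by (simp add: power2_eq_square flip: powr_add)
        have "2 * cmod (cinner (e p q) (L p q z *\<^sub>C F z p q)) \<le> (norm (e p q))\<^sup>2 + (norm (L p q z *\<^sub>C F z p q))\<^sup>2"
          by (rule cinner_mean_le)
        then show ?thesis
          by (simp add: cinner_scaleC_right norm_scaleC L [OF pq] power_mult_distrib sq)
      qed
      then have "(\<Sum>p<N. \<Sum>q<N. 2 * cmod (L p q z * cinner (e p q) (F z p q)))
          \<le> (\<Sum>p<N. \<Sum>q<N. (norm (e p q))\<^sup>2 + D p powr Re z * D q powr (1 - Re z) * (norm (F z p q))\<^sup>2)"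
        by (intro sum_mono) auto
      moreover have "cmod (G z) \<le> (\<Sum>p<N. \<Sum>q<N. cmod (L p q z * cinner (e p q) (F z p q)))"
        unfolding G_def by (intro order_trans [OF norm_sum] sum_mono order_refl)
      ultimately show ?thesis
        by (simp add: \<tau>_def sum.distrib flip: sum_distrib_left)
    qed
    have "cmod (G (complex_of_real \<theta>)) \<le> (\<tau> + M\<^sup>2) / 2"
    proof (rule three_lines)
      show "G holomorphic_on {z. 0 < Re z \<and> Re z < 1}"
        unfolding G_def L_def by (intro holomorphic_intros hol) auto
      show "continuous_on {z. 0 \<le> Re z \<and> Re z \<le> 1} G"
        unfolding G_def L_def by (intro continuous_intros cont) auto
      show "cmod (G z) \<le> (\<Sum>p<N. \<Sum>q<N. norm (e p q) * K)" if z: "0 \<le> Re z" "Re z \<le> 1" for z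
        unfolding G_def
      proof (intro order_trans [OF norm_sum] sum_mono)
        fix p q assume "p \<in> {..<N}" "q \<in> {..<N}"
        then have pq: "p < N" "q < N" by auto
        have "D p powr (Re z / 2) * D q powr ((1 - Re z) / 2) \<le> 1 * 1"
          using D D1 pq z by (intro mult_mono powr_le1) (auto simp: less_imp_le)
        then have "cmod (L p q z) * cmod (cinner (e p q) (F z p q)) \<le> 1 * (norm (e p q) * sn (F z))"
          unfolding L [OF pq] by (intro mult_mono entry FX z pq) auto
        also have "\<dots> \<le> norm (e p q) * K"
          using K [OF z] by (simp add: mult_left_mono)
        finally show "cmod (L p q z * cinner (e p q) (F z p q)) \<le> norm (e p q) * K"
          by (simp add: norm_mult)
      qed
      show "0 < (\<tau> + M\<^sup>2) / 2" using False \<tau>0 by (simp add: add_pos_nonneg)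
      fix t
      \<comment> \<open>Summing over \<open>p\<close> first produces squared column lengths, each at
        most \<open>M\<^sup>2\<close>, weighted by numbers \<open>D q\<close> of total at most 1.
        The other line is the same with rows and \<open>D p\<close>.\<close>
      have "(\<Sum>p<N. \<Sum>q<N. D q * (norm (F (Complex 0 t) p q))\<^sup>2)
          = (\<Sum>q<N. D q * (L2_set (\<lambda>p. norm (F (Complex 0 t) p q)) {..<N})\<^sup>2)"
        by (subst sum.swap) (simp add: L2_set_square sum_distrib_left)
      also have "\<dots> \<le> (\<Sum>q<N. D q * M\<^sup>2)"
        using D col_norm_ge [of _ N "F (Complex 0 t)"] MN(1) [of t] unfolding N0_def
        by (intro sum_mono mult_left_mono power_mono) (auto simp: less_imp_le L2_set_nonneg intro: order_trans)
      also have "\<dots> \<le> M\<^sup>2"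
        using sumD mult_right_mono [OF sumD, of "M\<^sup>2"] by (simp add: sum_distrib_right)
      also have "(\<Sum>p<N. \<Sum>q<N. D q * (norm (F (Complex 0 t) p q))\<^sup>2)
          = (\<Sum>p<N. \<Sum>q<N. D p powr Re (Complex 0 t) * D q powr (1 - Re (Complex 0 t)) * (norm (F (Complex 0 t) p q))\<^sup>2)"
        using D by (intro sum.cong) (auto simp: less_le)
      finally show "cmod (G (Complex 0 t)) \<le> (\<tau> + M\<^sup>2) / 2"
        by (intro order_trans [OF mean] divide_right_mono add_left_mono) simp_all
      have "(\<Sum>p<N. \<Sum>q<N. D p * (norm (F (Complex 1 t) p q))\<^sup>2)
          = (\<Sum>p<N. D p * (L2_set (\<lambda>q. norm (F (Complex 1 t) p q)) {..<N})\<^sup>2)"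
        by (simp add: L2_set_square sum_distrib_left)
      also have "\<dots> \<le> (\<Sum>p<N. D p * M\<^sup>2)"
        using D row_norm_ge [of _ N "F (Complex 1 t)"] MN(2) [of t] unfolding N1_def
        by (intro sum_mono mult_left_mono power_mono) (auto simp: less_imp_le L2_set_nonneg intro: order_trans)
      also have "\<dots> \<le> M\<^sup>2"
        using sumD mult_right_mono [OF sumD, of "M\<^sup>2"] by (simp add: sum_distrib_right)
      also have "(\<Sum>p<N. \<Sum>q<N. D p * (norm (F (Complex 1 t) p q))\<^sup>2)
          = (\<Sum>p<N. \<Sum>q<N. D p powr Re (Complex 1 t) * D q powr (1 - Re (Complex 1 t)) * (norm (F (Complex 1 t) p q))\<^sup>2)"
        using D by (intro sum.cong) (auto simp: less_le)
      finally show "cmod (G (Complex 1 t)) \<le> (\<tau> + M\<^sup>2) / 2"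
        by (intro order_trans [OF mean] divide_right_mono add_left_mono) simp_all
    qed (rule \<theta>)+
    moreover have "G (complex_of_real \<theta>) = complex_of_real \<tau>"
    proof -
      have "L p q (complex_of_real \<theta>) * cinner (e p q) (x p q) = complex_of_real ((norm (e p q))\<^sup>2)"
        if pq: "p < N" "q < N" for p q
      proof -
        have "L p q (complex_of_real \<theta>) = complex_of_real (D p powr (\<theta> / 2) * D q powr ((1 - \<theta>) / 2))"
          using D [OF pq(1)] D [OF pq(2)] by (simp add: L_def powr_def exp_of_real [symmetric])
        then show ?thesis
          unfolding cinner_self [symmetric] by (simp add: e_def cinner_scaleC_right)
      qed
      then show ?thesis unfolding G_def F\<theta> \<tau>_def of_real_sum by (intro sum.cong) auto
    qed
    ultimately show ?thesis using \<tau>0 by simp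
  qed simp
  moreover have M0: "0 \<le> max (SUP t. N0 (F (Complex 0 t))) (SUP t. N1 (F (Complex 1 t)))"
    if F: "F \<in> interp_functions X N0 X N1" for F
  proof -
    have "N0 (F (Complex 0 0)) \<le> (SUP t. N0 (F (Complex 0 t)))"
      using F by (intro cSUP_upper) (auto simp: interp_functions_def)
    then show ?thesis using nonneg(1) [of "F (Complex 0 0)"] by linarith
  qed
  ultimately have le: "sqrt \<tau> \<le> max (SUP t. N0 (F (Complex 0 t))) (SUP t. N1 (F (Complex 1 t)))"
    if "F \<in> interp_functions X N0 X N1" "F (complex_of_real \<theta>) = x" for F
    using that by (intro real_le_lsqrt) auto
  have "sqrt \<tau> \<le> interp_norm X N0 X N1 \<theta> x"
    unfolding interp_norm_def
  proof (rule cInf_greatest)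
    show "{max (SUP t. N0 (F (Complex 0 t))) (SUP t. N1 (F (Complex 1 t))) |F.
        F \<in> interp_functions X N0 X N1 \<and> F (complex_of_real \<theta>) = x} \<noteq> {}"
      using const_interp_function [OF x] by blast
  qed (use le in blast)
  moreover have "\<tau> = (\<Sum>p<N. \<Sum>q<N. D p powr \<theta> * D q powr (1 - \<theta>) * (norm (x p q))\<^sup>2)"
  proof -
    have sq: "(a powr (s / 2))\<^sup>2 = a powr s" for a s :: real
      by (simp add: power2_eq_square flip: powr_add)
    show ?thesis
      unfolding \<tau>_def e_def norm_scaleC norm_of_real power_mult_distrib power2_abs sq ..
  qed
  ultimately show ?thesis by simp
qed

end

section \<open>The functionals induced by a density\<close>

definition single :: "nat \<Rightarrow> nat \<Rightarrow> 'a::zero \<Rightarrow> nat \<Rightarrow> nat \<Rightarrow> 'a" where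
  "single p q a = (\<lambda>i j. if i = p \<and> j = q then a else 0)"

lemma sum_apply2: "(\<Sum>k\<in>I. h k) i j = (\<Sum>k\<in>I. h k i j)"
  for h :: "_ \<Rightarrow> _ \<Rightarrow> _ \<Rightarrow> _::comm_monoid_add"
  by (induction I rule: infinite_finite_induct) simp_all

lemma single_mats: "p < N \<Longrightarrow> q < N \<Longrightarrow> single p q a \<in> mats N"
  by (auto simp: single_def mats_def)

lemma madj_single: "madj (single p q a) = single q p (star a)"
  by (auto simp: madj_def single_def fun_eq_iff)

lemma mmul_single_left:
  "q < N \<Longrightarrow> mmul N (single p q a) y = (\<lambda>i j. if i = p then a * y q j else 0)"
  by (auto simp: mmul_def single_def fun_eq_iff if_distrib [of "\<lambda>z. z * _"] cong: if_cong)

lemma mmul_single_right: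
  "q < N \<Longrightarrow> mmul N x (single q p a) = (\<lambda>i j. if j = p then x i q * a else 0)"
  by (auto simp: mmul_def single_def fun_eq_iff if_distrib [of "\<lambda>z. _ * z"] cong: if_cong)

lemma clinear_norm_le:
  fixes \<phi> :: "'a::complex_normed_vector \<Rightarrow> complex"
  assumes lin: "clinear \<phi>" and le: "\<And>y. norm y \<le> 1 \<Longrightarrow> cmod (\<phi> y) \<le> 1"
  shows "cmod (\<phi> y) \<le> norm y"
proof (cases "y = 0")
  case True
  interpret Vector_Spaces.linear scaleC scaleC \<phi> by (rule lin)
  show ?thesis using True by (simp add: zero)
next
  case False
  interpret Vector_Spaces.linear scaleC scaleC \<phi> by (rule lin)
  have "cmod (\<phi> (complex_of_real (inverse (norm y)) *\<^sub>C y)) \<le> 1"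
    using False by (intro le) (simp add: norm_scaleC norm_inverse)
  then show ?thesis
    using False by (simp add: scale scaleC_complex_def norm_mult norm_divide norm_inverse divide_simps)
qed

locale contraction_into_R = representation +
  fixes \<theta> :: real and u :: "'a \<Rightarrow> ell2"
  assumes \<theta>: "0 < \<theta>" "\<theta> < 1"
    and u: "completely_contractive (opspace_norm \<pi>) (R_interp_norm \<theta>) u"
begin

lemma u_add: "u (a + b) = u a + u b" and u_scale: "u (c *\<^sub>C a) = c *\<^sub>C u a"
proof -
  interpret Vector_Spaces.linear scaleC scaleC u
    using u by (simp add: completely_contractive_def)
  show "u (a + b) = u a + u b" "u (c *\<^sub>C a) = c *\<^sub>C u a" by (rule add scale)+
qed

lemma u_zero: "u 0 = 0"
  using u_scale [of 0 0] by simp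

lemma opspace_norm_contr:
  assumes x: "x \<in> contr N"
  shows "opspace_norm \<pi> N x \<le> 1"
  unfolding opspace_norm_def op_mat_norm_def
proof (rule cSUP_least)
  show "{\<xi> :: nat \<Rightarrow> 'b. L2_set (\<lambda>k. norm (\<xi> k)) {..<N} \<le> 1} \<noteq> {}"
    by (auto simp: L2_set_def intro!: exI [of _ "\<lambda>_. 0"])
  fix \<xi> :: "nat \<Rightarrow> 'b" assume "\<xi> \<in> {\<xi>. L2_set (\<lambda>k. norm (\<xi> k)) {..<N} \<le> 1}"
  then have "(\<Sum>k<N. (norm (\<xi> k))\<^sup>2) \<le> 1" by (simp add: L2_set_def)
  then have "tup.sq N (act N x \<xi>) \<le> 1"
    using contrD [OF x, of \<xi>] by (simp add: tup_sq)
  then show "L2_set (\<lambda>i. norm (\<Sum>k<N. \<pi> (x i k) (\<xi> k))) {..<N} \<le> 1"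
    by (simp add: L2_set_def tup_sq act_def)
qed

lemma R_interp_norm_contr:
  assumes x: "x \<in> contr N" and N: "1 \<le> N"
  shows "R_interp_norm \<theta> N (\<lambda>i j. u (x i j)) \<le> 1"
proof -
  have "ereal (R_interp_norm \<theta> N (\<lambda>i j. u (x i j))) \<le> cb_norm (opspace_norm \<pi>) (R_interp_norm \<theta>) u"
    unfolding cb_norm_def
    by (intro SUP_upper2 [of N] SUP_upper2 [of x]) (use N contr_mats [OF x] opspace_norm_contr [OF x] in auto)
  also have "\<dots> \<le> 1" using u by (simp add: completely_contractive_def)
  finally show ?thesis by simp
qed

text \<open>Complete contractivity now reads as contractivity of the amplified map from matrices
  over \<open>A\<close> into a weighted Hilbert space, the setting of
  \<open>little_Grothendieck\<close>.\<close>

lemma weighted_contraction: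
  assumes x: "x \<in> contr N" and N: "1 \<le> N"
    and D: "\<And>p. p < N \<Longrightarrow> 0 < D p" and sumD: "(\<Sum>p<N. D p) \<le> 1"
  shows "(\<Sum>p<N. \<Sum>q<N. D p powr \<theta> * D q powr (1 - \<theta>) * (norm (u (x p q)))\<^sup>2) \<le> 1"
proof -
  interpret row_column_interpolation N .
  have "(\<lambda>i j. u (x i j)) \<in> X"
    using contr_mats [OF x] u_zero by (simp add: X_def mats_def)
  from interp_norm_ge [OF this \<theta> D sumD]
  have "sqrt (\<Sum>p<N. \<Sum>q<N. D p powr \<theta> * D q powr (1 - \<theta>) * (norm (u (x p q)))\<^sup>2)
      \<le> R_interp_norm \<theta> N (\<lambda>i j. u (x i j))"
    by (simp add: R_interp_norm_def X_def N0_def N1_def)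
  also have "\<dots> \<le> 1" by (rule R_interp_norm_contr [OF x N])
  finally show ?thesis by simp
qed

lemma single_contr:
  assumes pq: "p < N" "q < N" and a: "norm a \<le> 1"
  shows "single p q a \<in> contr N"
proof (rule contrI)
  show "single p q a \<in> mats N" by (rule single_mats [OF pq])
  fix \<xi>
  have "act N (single p q a) \<xi> = (\<lambda>i. if i = p then \<pi> a (\<xi> q) else 0)"
    using pq by (auto simp: act_def single_def fun_eq_iff if_distrib [of \<pi>] pi_zero
        if_distrib [of "\<lambda>z. blinfun_apply z _"] cong: if_cong)
  then have "tup.sq N (act N (single p q a) \<xi>) = (norm (\<pi> a (\<xi> q)))\<^sup>2"
    using pq by (simp add: tup_sq if_distrib [of "\<lambda>z. (norm z)\<^sup>2"] cong: if_cong)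
  also have "norm (\<pi> a (\<xi> q)) \<le> norm (\<xi> q)"
    using norm_blinfun [of "\<pi> a" "\<xi> q"] mult_right_mono [OF a, of "norm (\<xi> q)"] by (simp add: pi_norm)
  then have "(norm (\<pi> a (\<xi> q)))\<^sup>2 \<le> (norm (\<xi> q))\<^sup>2" by (rule power_mono) simp
  also have "\<dots> \<le> tup.sq N \<xi>"
    unfolding tup_sq by (rule member_le_sum) (use pq in auto)
  finally show "tup.sq N (act N (single p q a) \<xi>) \<le> tup.sq N \<xi>" .
qed

lemma sum_pi_le:
  assumes "norm a \<le> 1"
  shows "tup.sq N (\<lambda>k. \<pi> a (\<xi> k)) \<le> tup.sq N \<xi>"
  unfolding tup_sq
proof (intro sum_mono power_mono)
  fix k
  show "norm (\<pi> a (\<xi> k)) \<le> norm (\<xi> k)"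
    using norm_blinfun [of "\<pi> a" "\<xi> k"] mult_right_mono [OF assms, of "norm (\<xi> k)"] by (simp add: pi_norm)
qed simp

text \<open>For a matrix \<open>x\<close> with the single entry \<open>a\<close> at
  \<open>(p, q)\<close>, the product of the adjoint with \<open>x\<close> sits at
  \<open>(q, q)\<close> and the reverse product at \<open>(p, p)\<close>. So one term of the matrix
  inequality depends on \<open>q\<close> alone and the other on \<open>p\<close> alone. Summing over
  the diagonal yields functionals bounded by the norm.\<close>

lemma matrix_functionals:
  assumes N: "1 \<le> N" and D: "\<And>p. p < N \<Longrightarrow> 0 < D p" and sumD: "(\<Sum>p<N. D p) \<le> 1" and \<delta>: "0 < \<delta>"
  obtains F G :: "nat \<Rightarrow> 'a \<Rightarrow> complex"
  where "clinear (\<lambda>y. \<Sum>q<N. F q y)" and "clinear (\<lambda>y. \<Sum>p<N. G p y)"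
    and "\<And>y. cmod (\<Sum>q<N. F q y) \<le> norm y" and "\<And>y. cmod (\<Sum>p<N. G p y) \<le> norm y"
    and "\<And>q a. q < N \<Longrightarrow> norm a \<le> 1 \<Longrightarrow> - \<delta> \<le> Re (F q (star a * a))"
    and "\<And>p a. p < N \<Longrightarrow> norm a \<le> 1 \<Longrightarrow> - \<delta> \<le> Re (G p (a * star a))"
    and "\<And>p q a. p < N \<Longrightarrow> q < N \<Longrightarrow> norm a \<le> 1 \<Longrightarrow> D p powr \<theta> * D q powr (1 - \<theta>) * (norm (u a))\<^sup>2
        \<le> Re (F q (star a * a)) + Re (G p (a * star a)) + \<delta>"
proof -
  define \<omega> where "\<omega> = (\<lambda>p q. D p powr \<theta> * D q powr (1 - \<theta>))"
  have \<omega>: "0 \<le> \<omega> p q" for p q by (simp add: \<omega>_def)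
  define T where "T = (\<lambda>x y :: nat \<Rightarrow> nat \<Rightarrow> 'a. \<Sum>p<N. \<Sum>q<N. complex_of_real (\<omega> p q) * cinner (u (x p q)) (u (y p q)))"
  interpret T: semi_inner T
  proof
    fix x y z :: "nat \<Rightarrow> nat \<Rightarrow> 'a" and c :: complex
    show "T x y = cnj (T y x)"
      by (simp add: T_def flip: cinner_commute)
    show "T x (y + z) = T x y + T x z"
      by (simp add: T_def u_add cinner_add_right distrib_left sum.distrib)
    show "T x (c *\<^sub>C y) = c * T x y"
      by (simp add: T_def scaleC_fun_def u_scale cinner_scaleC_right sum_distrib_left mult.left_commute)
    show "0 \<le> Re (T x x)"
      using \<omega> by (simp add: T_def cinner_self sum_nonneg)
  qed
  have Tsq: "T.sq x = (\<Sum>p<N. \<Sum>q<N. \<omega> p q * (norm (u (x p q)))\<^sup>2)" for x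
    unfolding T.sq_def by (simp add: T_def cinner_self)
  have le1: "T.sq x \<le> 1" if "x \<in> contr N" for x
    unfolding Tsq \<omega>_def by (rule weighted_contraction [OF that N D sumD])
  obtain v where v: "v \<in> contr N"
    and ineq: "\<And>x. x \<in> contr N \<Longrightarrow> T.sq x
      \<le> Re (T v (mmul N x (mmul N (madj x) v))) + Re (T v (mmul N v (mmul N (madj x) x))) + \<delta>"
    and posF: "\<And>x. x \<in> contr N \<Longrightarrow> - \<delta> \<le> Re (T v (mmul N v (mmul N (madj x) x)))"
    and posG: "\<And>x. x \<in> contr N \<Longrightarrow> - \<delta> \<le> Re (T v (mmul N x (mmul N (madj x) v)))"
    using little_Grothendieck [OF T.semi_inner_axioms le1 \<delta>] by blast
  \<comment> \<open>\<open>T v\<close> is applied to \<open>v\<close> times the matrix with entry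
    \<open>y\<close> at \<open>(q, q)\<close>; for \<open>G\<close> the matrix with entry
    \<open>y\<close> at \<open>(p, p)\<close> multiplies \<open>v\<close> from the left.\<close>
  define F where "F = (\<lambda>q y. T v (\<lambda>i j. if j = q then v i q * y else 0))"
  define G where "G = (\<lambda>p y. T v (\<lambda>i j. if i = p then y * v p j else 0))"
  have F: "T v (mmul N v (mmul N (madj (single p q a)) (single p q a))) = F q (star a * a)"
    if "p < N" "q < N" for p q a
  proof -
    have "mmul N (madj (single p q a)) (single p q a) = single q q (star a * a)"
      using that by (auto simp: madj_single mmul_single_left fun_eq_iff) (auto simp: single_def)
    then show ?thesis using that by (simp add: F_def mmul_single_right)
  qed
  have G: "T v (mmul N (single p q a) (mmul N (madj (single p q a)) v)) = G p (a * star a)"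
    if "p < N" "q < N" for p q a
    using that by (simp add: G_def madj_single mmul_single_left mult.assoc cong: if_cong)
  have sq_single: "T.sq (single p q a) = \<omega> p q * (norm (u a))\<^sup>2" if "p < N" "q < N" for p q a
  proof -
    have "T.sq (single p q a) = (\<Sum>i<N. \<Sum>j<N. if i = p \<and> j = q then \<omega> p q * (norm (u a))\<^sup>2 else 0)"
      unfolding Tsq by (intro sum.cong) (auto simp: single_def u_zero)
    also have "\<dots> = (\<Sum>i<N. if i = p then \<omega> p q * (norm (u a))\<^sup>2 else 0)"
      using that by (intro sum.cong refl) simp
    finally show ?thesis using that by simp
  qed
  have sumF: "(\<Sum>q<N. F q y) = T v (\<lambda>i j. if j < N then v i j * y else 0)" for y
  proof -
    have "(\<Sum>q<N. (\<lambda>i j. if j = q then v i q * y else 0)) = (\<lambda>i j. if j < N then v i j * y else 0)"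
      by (auto simp: fun_eq_iff sum_apply2)
    then show ?thesis unfolding F_def by (simp flip: T.sum_right)
  qed
  have sumG: "(\<Sum>p<N. G p y) = T v (\<lambda>i j. if i < N then y * v i j else 0)" for y
  proof -
    have "(\<Sum>p<N. (\<lambda>i j. if i = p then y * v p j else 0)) = (\<lambda>i j. if i < N then y * v i j else 0)"
      by (auto simp: fun_eq_iff sum_apply2)
    then show ?thesis unfolding G_def by (simp flip: T.sum_right)
  qed
  have linF: "clinear (\<lambda>y. T v (\<lambda>i j. if j < N then v i j * y else 0))"
  proof (rule clinearI)
    fix x y :: 'a and c :: complex
    have "(\<lambda>i j. if j < N then v i j * (x + y) else 0) = (\<lambda>i j. if j < N then v i j * x else 0) + (\<lambda>i j. if j < N then v i j * y else 0)"
      by (auto simp: fun_eq_iff distrib_left distrib_right)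
    then show "T v (\<lambda>i j. if j < N then v i j * (x + y) else 0) = T v (\<lambda>i j. if j < N then v i j * x else 0) + T v (\<lambda>i j. if j < N then v i j * y else 0)"
      by (simp only: T.add_right)
    have "(\<lambda>i j. if j < N then v i j * (c *\<^sub>C x) else 0) = c *\<^sub>C (\<lambda>i j. if j < N then v i j * x else 0)"
      by (auto simp: fun_eq_iff scaleC_fun_def mult_scaleC_left mult_scaleC_right)
    then show "T v (\<lambda>i j. if j < N then v i j * (c *\<^sub>C x) else 0) = c *\<^sub>C T v (\<lambda>i j. if j < N then v i j * x else 0)"
      by (simp only: T.scaleC_right scaleC_complex_def)
  qed
  have linG: "clinear (\<lambda>y. T v (\<lambda>i j. if i < N then y * v i j else 0))"
  proof (rule clinearI)
    fix x y :: 'a and c :: complex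
    have "(\<lambda>i j. if i < N then (x + y) * v i j else 0) = (\<lambda>i j. if i < N then x * v i j else 0) + (\<lambda>i j. if i < N then y * v i j else 0)"
      by (auto simp: fun_eq_iff distrib_left distrib_right)
    then show "T v (\<lambda>i j. if i < N then (x + y) * v i j else 0) = T v (\<lambda>i j. if i < N then x * v i j else 0) + T v (\<lambda>i j. if i < N then y * v i j else 0)"
      by (simp only: T.add_right)
    have "(\<lambda>i j. if i < N then (c *\<^sub>C x) * v i j else 0) = c *\<^sub>C (\<lambda>i j. if i < N then x * v i j else 0)"
      by (auto simp: fun_eq_iff scaleC_fun_def mult_scaleC_left mult_scaleC_right)
    then show "T v (\<lambda>i j. if i < N then (c *\<^sub>C x) * v i j else 0) = c *\<^sub>C T v (\<lambda>i j. if i < N then x * v i j else 0)"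
      by (simp only: T.scaleC_right scaleC_complex_def)
  qed
  have lin: "clinear (\<lambda>y. \<Sum>q<N. F q y)" "clinear (\<lambda>y. \<Sum>p<N. G p y)"
    unfolding sumF sumG by (rule linF linG)+
  \<comment> \<open>The sum over \<open>q\<close> multiplies \<open>v\<close> by the diagonal matrix
    with all entries \<open>y\<close>, which keeps it in the unit ball and gives the sum norm at
    most 1.\<close>
  have contrF: "(\<lambda>i j. if j < N then v i j * y else 0) \<in> contr N" if y: "norm y \<le> 1" for y
  proof (rule contrI)
    show "(\<lambda>i j. if j < N then v i j * y else 0) \<in> mats N"
      using contr_mats [OF v] by (auto simp: mats_def)
    fix \<xi>
    have "act N (\<lambda>i j. if j < N then v i j * y else 0) \<xi> = act N v (\<lambda>k. \<pi> y (\<xi> k))"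
      by (simp add: act_def pi_mult)
    then show "tup.sq N (act N (\<lambda>i j. if j < N then v i j * y else 0) \<xi>) \<le> tup.sq N \<xi>"
      using order_trans [OF contrD [OF v] sum_pi_le [OF y]] by simp
  qed
  have contrG: "(\<lambda>i j. if i < N then y * v i j else 0) \<in> contr N" if y: "norm y \<le> 1" for y
  proof (rule contrI)
    show "(\<lambda>i j. if i < N then y * v i j else 0) \<in> mats N"
      using contr_mats [OF v] by (auto simp: mats_def)
    fix \<xi>
    have "act N (\<lambda>i j. if i < N then y * v i j else 0) \<xi> i = \<pi> y (act N v \<xi> i)" if "i < N" for i
      using that by (simp add: act_def pi_mult blinfun.sum_right)
    then have "tup.sq N (act N (\<lambda>i j. if i < N then y * v i j else 0) \<xi>) = tup.sq N (\<lambda>i. \<pi> y (act N v \<xi> i))"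
      by (simp add: tup_sq)
    then show "tup.sq N (act N (\<lambda>i j. if i < N then y * v i j else 0) \<xi>) \<le> tup.sq N \<xi>"
      using order_trans [OF sum_pi_le [OF y] contrD [OF v]] by simp
  qed
  have T1: "cmod (T v z) \<le> 1" if "z \<in> contr N" for z
    using T.cmod_le [of v z] le1 [OF v] le1 [OF that] by linarith
  show thesis
  proof (rule that [of F G])
    show "cmod (\<Sum>q<N. F q y) \<le> norm y" "cmod (\<Sum>p<N. G p y) \<le> norm y" for y
      by (rule clinear_norm_le [OF lin(1)], unfold sumF, rule T1 [OF contrF], assumption)
        (rule clinear_norm_le [OF lin(2)], unfold sumG, rule T1 [OF contrG], assumption)
    show "- \<delta> \<le> Re (F q (star a * a))" if "q < N" "norm a \<le> 1" for q a
      using posF [OF single_contr [OF that(1) that(1) that(2)]] that by (simp add: F)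
    show "- \<delta> \<le> Re (G p (a * star a))" if "p < N" "norm a \<le> 1" for p a
      using posG [OF single_contr [OF that(1) that(1) that(2)]] that by (simp add: G)
    show "D p powr \<theta> * D q powr (1 - \<theta>) * (norm (u a))\<^sup>2
        \<le> Re (F q (star a * a)) + Re (G p (a * star a)) + \<delta>" if "p < N" "q < N" "norm a \<le> 1" for p q a
      using ineq [OF single_contr [OF that]] that by (simp add: F G sq_single \<omega>_def)
  qed (rule lin)+
qed

end

section \<open>Densities with geometric multiplicities\<close>

text \<open>Blocks of the prescribed sizes are appended one after another, so that the indices fill
  an initial segment, as matrix indices must.\<close>

lemma levels_exist:
  fixes m :: "nat \<Rightarrow> nat"
  obtains N :: nat and lev :: "nat \<Rightarrow> nat"
  where "\<And>p. p < N \<Longrightarrow> lev p < L" and "\<And>k. k < L \<Longrightarrow> card {p. p < N \<and> lev p = k} = m k"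
proof -
  have "\<exists>(N::nat) lev. (\<forall>p<N. lev p < L) \<and> (\<forall>k<L. card {p. p < N \<and> lev p = k} = m k)"
  proof (induction L)
    case 0
    show ?case by (rule exI [of _ 0]) simp
  next
    case (Suc L)
    then obtain N :: nat and lev :: "nat \<Rightarrow> nat" where lev: "\<forall>p<N. lev p < L" and card: "\<forall>k<L. card {p. p < N \<and> lev p = k} = m k"
      by blast
    define lev' where "lev' = (\<lambda>p. if p < N then lev p else L)"
    have low: "{p. p < N + m L \<and> lev' p = k} = {p. p < N \<and> lev p = k}" if "k < L" for k
      using that by (auto simp: lev'_def)
    have "lev p \<noteq> L" if "p < N" for p
      using lev that by blast
    then have eq: "(p < N + m L \<and> lev' p = L) = (p \<in> {N..<N + m L})" for p
      unfolding lev'_def by (cases "p < N") simp_all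
    have top: "{p. p < N + m L \<and> lev' p = L} = {N..<N + m L}" by (simp only: eq Collect_mem_eq)
    have "card {p. p < N + m L \<and> lev' p = k} = m k" if k: "k < Suc L" for k
    proof (cases "k = L")
      case True
      then show ?thesis by (simp add: top)
    next
      case False
      then have "k < L" using k by simp
      then show ?thesis using card by (simp add: low)
    qed
    moreover have "\<forall>p<N + m L. lev' p < Suc L"
      using lev by (auto simp: lev'_def less_SucI)
    ultimately show ?case by blast
  qed
  then show thesis using that by blast
qed

context contraction_into_R
begin

text \<open>Summing the entrywise inequality over a pair of levels leaves a bound that depends on
  the multiplicities only through their ratio \<open>r\<close>. The injectivity of both projections
  on \<open>S\<close> uses each level at most once on either side, so the sums over \<open>S\<close>
  stay below the full functionals.\<close>

lemma level_functionals:
  assumes L: "1 \<le> L" and m: "\<And>k. k < L \<Longrightarrow> 1 \<le> m k" and \<delta>: "0 < \<delta>"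
  obtains f g :: "'a \<Rightarrow> complex"
  where "clinear f" and "clinear g" and "\<And>y. cmod (f y) \<le> norm y" and "\<And>y. cmod (g y) \<le> norm y"
    and "\<And>a. norm a \<le> 1 \<Longrightarrow> - \<delta> \<le> Re (f (star a * a))"
    and "\<And>a. norm a \<le> 1 \<Longrightarrow> - \<delta> \<le> Re (g (a * star a))"
    and "\<And>S r a. S \<subseteq> {..<L} \<times> {..<L} \<Longrightarrow> inj_on fst S \<Longrightarrow> inj_on snd S \<Longrightarrow> 0 < r \<Longrightarrow>
      (\<And>k j. (k, j) \<in> S \<Longrightarrow> real (m k) = r * real (m j)) \<Longrightarrow> norm a \<le> 1 \<Longrightarrow>
      real (card S) / real L * (r powr \<theta> * (norm (u a))\<^sup>2)
        \<le> (Re (f (star a * a)) + \<delta>) + r * (Re (g (a * star a)) + \<delta>)"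
proof -
  obtain N :: nat and lev :: "nat \<Rightarrow> nat" where lev: "\<And>p. p < N \<Longrightarrow> lev p < L"
    and card: "\<And>k. k < L \<Longrightarrow> card {p. p < N \<and> lev p = k} = m k"
    using levels_exist [of L m] by blast
  define A where "A = (\<lambda>k. {p. p < N \<and> lev p = k})"
  have finA [simp]: "finite (A k)" for k unfolding A_def by (rule finite_subset [of _ "{..<N}"]) auto
  have cardA: "card (A k) = m k" if "k < L" for k using card [OF that] by (simp add: A_def)
  have AN: "p < N" "lev p = k" if "p \<in> A k" for p k using that by (simp_all add: A_def)
  have sum_levels: "(\<Sum>k<L. \<Sum>p\<in>A k. h p) = (\<Sum>p<N. h p)" for h :: "nat \<Rightarrow> real"
  proof -
    have "(\<Sum>p\<in>(\<Union>k<L. A k). h p) = (\<Sum>k<L. \<Sum>p\<in>A k. h p)"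
      by (rule sum.UNION_disjoint) (auto simp: A_def)
    moreover have "(\<Union>k<L. A k) = {..<N}" using lev by (auto simp: A_def)
    ultimately show ?thesis by simp
  qed
  have "A 0 \<noteq> {}" using cardA [of 0] m [of 0] L by auto
  then have N: "1 \<le> N" using AN by fastforce
  \<comment> \<open>Every level has total mass \<open>1 / L\<close>, shared equally among its
    indices.\<close>
  define D where "D = (\<lambda>p. 1 / (real L * real (m (lev p))))"
  have D: "0 < D p" if "p < N" for p
    using m [OF lev [OF that]] L by (simp add: D_def)
  have "(\<Sum>p<N. D p) = (\<Sum>k<L. \<Sum>p\<in>A k. D p)" by (rule sum_levels [symmetric])
  also have "\<dots> = (\<Sum>k<L. \<Sum>p\<in>A k. 1 / (real L * real (m k)))"
    by (intro sum.cong refl) (simp add: D_def AN)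
  also have "\<dots> = (\<Sum>k<L. 1 / real L)"
    using m L by (intro sum.cong refl) (force simp: cardA)
  also have "\<dots> = 1" using L by simp
  finally have sumD: "(\<Sum>p<N. D p) \<le> 1" by simp
  \<comment> \<open>Each of the \<open>N\<close> summands contributes one error, and together they
    make up \<open>\<delta>\<close>.\<close>
  define \<delta>' where "\<delta>' = \<delta> / real N"
  have \<delta>': "0 < \<delta>'" "real N * \<delta>' = \<delta>" using \<delta> N by (simp_all add: \<delta>'_def)
  obtain F G :: "nat \<Rightarrow> 'a \<Rightarrow> complex"
    where lin: "clinear (\<lambda>y. \<Sum>q<N. F q y)" "clinear (\<lambda>y. \<Sum>p<N. G p y)"
    and bound: "\<And>y. cmod (\<Sum>q<N. F q y) \<le> norm y" "\<And>y. cmod (\<Sum>p<N. G p y) \<le> norm y"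
    and posF: "\<And>q a. q < N \<Longrightarrow> norm a \<le> 1 \<Longrightarrow> - \<delta>' \<le> Re (F q (star a * a))"
    and posG: "\<And>p a. p < N \<Longrightarrow> norm a \<le> 1 \<Longrightarrow> - \<delta>' \<le> Re (G p (a * star a))"
    and ineq: "\<And>p q a. p < N \<Longrightarrow> q < N \<Longrightarrow> norm a \<le> 1 \<Longrightarrow> D p powr \<theta> * D q powr (1 - \<theta>) * (norm (u a))\<^sup>2
        \<le> Re (F q (star a * a)) + Re (G p (a * star a)) + \<delta>'"
    using matrix_functionals [OF N D sumD \<delta>'(1)] by blast
  show thesis
  proof (rule that [OF lin bound])
    fix a :: 'a assume a: "norm a \<le> 1"
    \<comment> \<open>The shift by \<open>\<delta>'\<close> makes the summands nonnegative, so sums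
      over some levels may be enlarged to sums over all.\<close>
    define F' where "F' = (\<lambda>q. Re (F q (star a * a)) + \<delta>')"
    define G' where "G' = (\<lambda>p. Re (G p (a * star a)) + \<delta>')"
    have F': "0 \<le> F' q" and G': "0 \<le> G' q" if "q < N" for q
      using posF [OF that a] posG [OF that a] by (simp_all add: F'_def G'_def)
    have sF: "(\<Sum>q<N. F' q) = Re (\<Sum>q<N. F q (star a * a)) + \<delta>"
      and sG: "(\<Sum>p<N. G' p) = Re (\<Sum>p<N. G p (a * star a)) + \<delta>"
      using \<delta>'(2) by (simp_all add: F'_def G'_def sum.distrib)
    show "- \<delta> \<le> Re (\<Sum>q<N. F q (star a * a))"
      using sF sum_nonneg [of "{..<N}" F'] F' by simp
    show "- \<delta> \<le> Re (\<Sum>p<N. G p (a * star a))"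
      using sG sum_nonneg [of "{..<N}" G'] G' by simp
    fix S :: "(nat \<times> nat) set" and r :: real
    assume S: "S \<subseteq> {..<L} \<times> {..<L}" and inj: "inj_on fst S" "inj_on snd S" and r: "0 < r"
      and ratio: "\<And>k j. (k, j) \<in> S \<Longrightarrow> real (m k) = r * real (m j)"
    have finS: "finite S" by (rule finite_subset [OF S]) simp
    define F'' where "F'' = (\<lambda>k. \<Sum>q\<in>A k. F' q)"
    define G'' where "G'' = (\<lambda>j. \<Sum>p\<in>A j. G' p)"
    have F'': "0 \<le> F'' k" and G'': "0 \<le> G'' k" for k
      unfolding F''_def G''_def using F' G' AN by (auto intro!: sum_nonneg)
    have level: "r powr \<theta> * (norm (u a))\<^sup>2 / real L \<le> F'' k + r * G'' j" if kj: "(k, j) \<in> S" for k j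
    proof -
      have kL: "k < L" "j < L" using S kj by auto
      have mj: "0 < real (m j)" and mk: "0 < real (m k)" using m [OF kL(1)] m [OF kL(2)] by auto
      have "real (m j) * (real (m k) * ((1 / (real L * real (m j))) powr \<theta>
            * (1 / (real L * real (m k))) powr (1 - \<theta>) * (norm (u a))\<^sup>2))
          = (\<Sum>p\<in>A j. \<Sum>q\<in>A k. D p powr \<theta> * D q powr (1 - \<theta>) * (norm (u a))\<^sup>2)"
        by (simp add: D_def AN cardA kL cong: sum.cong)
      also have "\<dots> \<le> (\<Sum>p\<in>A j. \<Sum>q\<in>A k. F' q + G' p)"
      proof (intro sum_mono)
        fix p q assume "p \<in> A j" "q \<in> A k"
        then have "p < N" "q < N" using AN by auto
        from ineq [OF this a]
        show "D p powr \<theta> * D q powr (1 - \<theta>) * (norm (u a))\<^sup>2 \<le> F' q + G' p"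
          by (rule order_trans) (use \<delta>' in \<open>simp add: F'_def G'_def\<close>)
      qed
      also have "\<dots> = real (m j) * F'' k + real (m k) * G'' j"
        by (simp add: sum.distrib F''_def G''_def cardA kL flip: sum_distrib_left)
      finally have "real (m j) * (real (m k) * ((1 / (real L * real (m j))) powr \<theta>
            * (1 / (real L * real (m k))) powr (1 - \<theta>) * (norm (u a))\<^sup>2))
          \<le> real (m j) * (F'' k + r * G'' j)"
        unfolding ratio [OF kj] by (simp add: algebra_simps)
      then have le: "real (m k) * ((1 / (real L * real (m j))) powr \<theta>
            * (1 / (real L * real (m k))) powr (1 - \<theta>) * (norm (u a))\<^sup>2) \<le> F'' k + r * G'' j"
        using mj by simp
      have Lp: "0 < real L" using L by simp
      have pw: "(1 / (x * y)) powr s = 1 / (x powr s * y powr s)" if "0 < x" "0 < y" for x y s :: real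
        using that by (simp add: powr_divide powr_mult)
      \<comment> \<open>The exponents of \<open>L\<close> add up to 1, and \<open>m k\<close> times
        its power \<open>\<theta> - 1\<close> is its power \<open>\<theta>\<close>. What remains is
        the power \<open>\<theta>\<close> of the ratio, divided by \<open>L\<close>.\<close>
      have "real (m k) * ((1 / (real L * real (m j))) powr \<theta> * (1 / (real L * real (m k))) powr (1 - \<theta>))
          = (real (m k) / real (m k) powr (1 - \<theta>)) / (real L powr \<theta> * real L powr (1 - \<theta>)) / real (m j) powr \<theta>"
        unfolding pw [OF Lp mj] pw [OF Lp mk] by simp
      also have "real L powr \<theta> * real L powr (1 - \<theta>) = real L"
        using Lp by (simp flip: powr_add)
      also have "real (m k) / real (m k) powr (1 - \<theta>) = real (m k) powr \<theta>"
        using mk powr_diff [of "real (m k)" 1 "1 - \<theta>"] by simp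
      also have "real (m k) powr \<theta> = r powr \<theta> * real (m j) powr \<theta>"
        unfolding ratio [OF kj] using r mj by (simp add: powr_mult)
      finally have "real (m k) * ((1 / (real L * real (m j))) powr \<theta> * (1 / (real L * real (m k))) powr (1 - \<theta>))
          = r powr \<theta> / real L" using mj by simp
      then have "real (m k) * ((1 / (real L * real (m j))) powr \<theta>
            * (1 / (real L * real (m k))) powr (1 - \<theta>) * (norm (u a))\<^sup>2) = r powr \<theta> * (norm (u a))\<^sup>2 / real L"
        by (metis mult.assoc times_divide_eq_left)
      then show ?thesis using le by simp
    qed
    have "real (card S) / real L * (r powr \<theta> * (norm (u a))\<^sup>2) = (\<Sum>(k, j)\<in>S. r powr \<theta> * (norm (u a))\<^sup>2 / real L)"
      by simp
    also have "\<dots> \<le> (\<Sum>(k, j)\<in>S. F'' k + r * G'' j)"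
      by (intro sum_mono) (auto dest: level)
    also have "\<dots> = (\<Sum>x\<in>S. F'' (fst x)) + r * (\<Sum>x\<in>S. G'' (snd x))"
      by (simp add: case_prod_unfold sum.distrib sum_distrib_left)
    also have "(\<Sum>x\<in>S. F'' (fst x)) = (\<Sum>k\<in>fst ` S. F'' k)"
      by (simp add: sum.reindex [OF inj(1)])
    also have "(\<Sum>x\<in>S. G'' (snd x)) = (\<Sum>k\<in>snd ` S. G'' k)"
      by (simp add: sum.reindex [OF inj(2)])
    also have "(\<Sum>k\<in>fst ` S. F'' k) \<le> (\<Sum>k<L. F'' k)"
      using S F'' by (intro sum_mono2) auto
    also have "(\<Sum>k<L. F'' k) = Re (\<Sum>q<N. F q (star a * a)) + \<delta>"
      unfolding F''_def sum_levels sF ..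
    also have "r * (\<Sum>k\<in>snd ` S. G'' k) \<le> r * (\<Sum>k<L. G'' k)"
      using S G'' r by (intro mult_left_mono sum_mono2) auto
    also have "(\<Sum>k<L. G'' k) = Re (\<Sum>p<N. G p (a * star a)) + \<delta>"
      unfolding G''_def sum_levels sG ..
    finally show "real (card S) / real L * (r powr \<theta> * (norm (u a))\<^sup>2)
        \<le> (Re (\<Sum>q<N. F q (star a * a)) + \<delta>) + r * (Re (\<Sum>p<N. G p (a * star a)) + \<delta>)"
      by simp
  qed
qed

text \<open>Among \<open>n\<^sup>2\<close> levels with consecutive ratio \<open>1 + 1 / n\<close>,
  all but a fraction \<open>d / n\<^sup>2\<close> have a partner at distance \<open>d\<close>. This
  loss is negligible for \<open>d\<close> of order \<open>n\<close>, while powers with such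
  exponents already approach every ratio.\<close>

lemma geometric_functionals:
  assumes n: "1 \<le> n"
  obtains f g :: "'a \<Rightarrow> complex"
  where "clinear f" and "clinear g" and "\<And>y. cmod (f y) \<le> norm y" and "\<And>y. cmod (g y) \<le> norm y"
    and "\<And>a. norm a \<le> 1 \<Longrightarrow> - (1 / real n) \<le> Re (f (star a * a))"
    and "\<And>a. norm a \<le> 1 \<Longrightarrow> - (1 / real n) \<le> Re (g (a * star a))"
    and "\<And>r a d. r = (1 + 1 / real n) ^ d \<or> r = 1 / (1 + 1 / real n) ^ d \<Longrightarrow> norm a \<le> 1 \<Longrightarrow>
      real (n\<^sup>2 - d) / (real n)\<^sup>2 * (r powr \<theta> * (norm (u a))\<^sup>2)
        \<le> (Re (f (star a * a)) + 1 / real n) + r * (Re (g (a * star a)) + 1 / real n)"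
proof -
  define L where "L = n\<^sup>2"
  \<comment> \<open>For \<open>k \<le> L\<close> this is \<open>n ^ L\<close> times
    \<open>(1 + 1 / n) ^ k\<close>, the prefactor clearing denominators so that multiplicities are
    integers.\<close>
  define m where "m = (\<lambda>k. n ^ (L - k) * (n + 1) ^ k)"
  have L: "1 \<le> L" using n by (simp add: L_def)
  have m: "1 \<le> m k" for k using n by (simp add: m_def)
  have \<delta>: "0 < 1 / real n" using n by simp
  have shift: "real (m (j + d)) = (1 + 1 / real n) ^ d * real (m j)" if "j + d \<le> L" for j d
  proof -
    have "real n ^ (L - j) = real n ^ (L - (j + d)) * real n ^ d"
      using that by (simp flip: power_add)
    moreover have "(1 + 1 / real n) ^ d * real n ^ d = real (n + 1) ^ d"
      using n by (simp add: distrib_right add.commute flip: power_mult_distrib)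
    ultimately show ?thesis by (simp add: m_def power_add mult_ac)
  qed
  show thesis
  proof (rule level_functionals [where m = m, OF L m \<delta>])
    fix f g :: "'a \<Rightarrow> complex"
    assume fg: "clinear f" "clinear g" "\<And>y. cmod (f y) \<le> norm y" "\<And>y. cmod (g y) \<le> norm y"
      "\<And>a. norm a \<le> 1 \<Longrightarrow> - (1 / real n) \<le> Re (f (star a * a))"
      "\<And>a. norm a \<le> 1 \<Longrightarrow> - (1 / real n) \<le> Re (g (a * star a))"
      and ineq: "\<And>S r a. S \<subseteq> {..<L} \<times> {..<L} \<Longrightarrow> inj_on fst S \<Longrightarrow> inj_on snd S \<Longrightarrow> 0 < r \<Longrightarrow>
        (\<And>k j. (k, j) \<in> S \<Longrightarrow> real (m k) = r * real (m j)) \<Longrightarrow> norm a \<le> 1 \<Longrightarrow>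
        real (card S) / real L * (r powr \<theta> * (norm (u a))\<^sup>2)
          \<le> (Re (f (star a * a)) + 1 / real n) + r * (Re (g (a * star a)) + 1 / real n)"
    show thesis
    proof (rule that [OF fg])
      fix r :: real and a :: 'a and d
      assume r: "r = (1 + 1 / real n) ^ d \<or> r = 1 / (1 + 1 / real n) ^ d" and a: "norm a \<le> 1"
      have pos: "0 < 1 + 1 / real n" by (simp add: add_pos_nonneg)
      then have "0 < r" using r by auto
      \<comment> \<open>The pairs of levels at distance \<open>d\<close>, ordered according to
        whether \<open>r\<close> is the power or its reciprocal. For \<open>d \<ge> L\<close> there
        are none, in agreement with the truncated difference.\<close>
      from r have "\<exists>S \<subseteq> {..<L} \<times> {..<L}. inj_on fst S \<and> inj_on snd S \<and> card S = L - d
        \<and> (\<forall>k j. (k, j) \<in> S \<longrightarrow> real (m k) = r * real (m j))"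
      proof
        assume r: "r = (1 + 1 / real n) ^ d"
        have "card ((\<lambda>j. (j + d, j)) ` {..<L - d}) = L - d"
          by (subst card_image) (auto simp: inj_on_def)
        then show ?thesis
          using shift by (intro exI [of _ "(\<lambda>j. (j + d, j)) ` {..<L - d}"]) (auto simp: inj_on_def r)
      next
        assume r: "r = 1 / (1 + 1 / real n) ^ d"
        have "card ((\<lambda>j. (j, j + d)) ` {..<L - d}) = L - d"
          by (subst card_image) (auto simp: inj_on_def)
        then show ?thesis
          using shift pos by (intro exI [of _ "(\<lambda>j. (j, j + d)) ` {..<L - d}"]) (auto simp: inj_on_def r)
      qed
      then obtain S where S: "S \<subseteq> {..<L} \<times> {..<L}" "inj_on fst S" "inj_on snd S"
        and card: "card S = L - d" and ratio: "\<And>k j. (k, j) \<in> S \<Longrightarrow> real (m k) = r * real (m j)"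
        by blast
      from ineq [OF S \<open>0 < r\<close> ratio a]
      show "real (n\<^sup>2 - d) / (real n)\<^sup>2 * (r powr \<theta> * (norm (u a))\<^sup>2)
          \<le> (Re (f (star a * a)) + 1 / real n) + r * (Re (g (a * star a)) + 1 / real n)"
        unfolding card by (simp add: L_def)
    qed
  qed
qed

end

section \<open>Cluster points\<close>

text \<open>Tychonoff's theorem for a product of discs, as in the proof of the Banach-Alaoglu
  theorem; the topology is pointwise convergence.\<close>

lemma compact_Pi_cball: "compact {f :: 'a \<Rightarrow> complex. \<forall>a. cmod (f a) \<le> b a}"
proof -
  have "compactin (product_topology (\<lambda>_. euclidean) UNIV) (PiE (UNIV :: 'a set) (\<lambda>a. cball (0::complex) (b a)))"
    unfolding compactin_PiE by (simp add: compactin_euclidean_iff)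
  moreover have "PiE (UNIV :: 'a set) (\<lambda>a. cball (0::complex) (b a)) = {f. \<forall>a. cmod (f a) \<le> b a}"
    by auto
  ultimately show ?thesis
    by (simp add: euclidean_product_topology)
qed

lemma tendsto_coordinate:
  fixes h :: "'a \<Rightarrow> 'b::topological_space"
  assumes "(X \<longlongrightarrow> h) H"
  shows "((\<lambda>n. X n a) \<longlongrightarrow> h a) H"
proof (rule topological_tendstoI)
  fix S :: "'b set" assume S: "open S" "h a \<in> S"
  have "open ((\<lambda>k :: 'a \<Rightarrow> 'b. k a) -` S)"
    by (rule open_vimage [OF S(1)]) simp
  from topological_tendstoD [OF assms this]
  show "\<forall>\<^sub>F n in H. X n a \<in> S" using S(2) by simp
qed

text \<open>The product space need not be sequentially compact, so a finer filter replaces a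
  subsequence. It joins the tail filter with the pulled back neighbourhoods of a cluster point, and
  the cluster property says precisely that this filter is proper.\<close>

lemma compact_subfilter:
  fixes X :: "nat \<Rightarrow> 'b::topological_space"
  assumes K: "compact K" and X: "\<And>n. X n \<in> K"
  obtains x H where "H \<noteq> bot" and "H \<le> sequentially" and "(X \<longlongrightarrow> x) H"
proof -
  have "filtermap X sequentially \<noteq> bot" by (simp add: filtermap_bot_iff)
  moreover have "eventually (\<lambda>x. x \<in> K) (filtermap X sequentially)"
    using X by (simp add: eventually_filtermap)
  ultimately obtain x where x: "inf (nhds x) (filtermap X sequentially) \<noteq> bot"
    using K unfolding compact_filter by blast
  define H where "H = inf (filtercomap X (nhds x)) sequentially"
  have "H \<noteq> bot"
  proof
    assume "H = bot"
    then have "eventually (\<lambda>_. False) H" by simp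
    then obtain P Q where P: "eventually P (filtercomap X (nhds x))" and Q: "eventually Q sequentially"
      and no: "\<And>n. P n \<Longrightarrow> Q n \<Longrightarrow> False"
      unfolding H_def eventually_inf by auto
    obtain P' where P': "eventually P' (nhds x)" and PX: "\<And>n. P' (X n) \<Longrightarrow> P n"
      using P unfolding eventually_filtercomap by blast
    have "eventually (\<lambda>y. \<not> P' y) (filtermap X sequentially)"
      unfolding eventually_filtermap using Q by (rule eventually_mono) (use no PX in blast)
    then have "eventually (\<lambda>_. False) (inf (nhds x) (filtermap X sequentially))"
      unfolding eventually_inf using P' by blast
    then show False using x by (simp add: eventually_False)
  qed
  moreover have "H \<le> sequentially" by (simp add: H_def)
  moreover have "(X \<longlongrightarrow> x) H"
    unfolding filterlim_iff_le_filtercomap H_def by simp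
  ultimately show thesis by (rule that)
qed

text \<open>Take \<open>d n\<close> to be the integer part of \<open>n * ln r\<close>. The power is
  then \<open>(1 + 1 / n) ^ n\<close> raised to \<open>d n / n\<close>, which tends to
  \<open>exp (ln r)\<close>, while \<open>d n\<close> over \<open>n\<^sup>2\<close> tends to
  0.\<close>

lemma powers_approximate:
  assumes r: "1 \<le> (r::real)"
  obtains d :: "nat \<Rightarrow> nat"
  where "(\<lambda>n. (1 + 1 / real n) ^ d n) \<longlonglongrightarrow> r" and "(\<lambda>n. real (n\<^sup>2 - d n) / (real n)\<^sup>2) \<longlonglongrightarrow> 1"
proof -
  define c where "c = ln r"
  have c: "0 \<le> c" using r by (simp add: c_def)
  define d where "d = (\<lambda>n::nat. nat \<lfloor>real n * c\<rfloor>)"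
  have d: "real n * c - 1 \<le> real (d n)" "real (d n) \<le> real n * c" for n
    using c by (auto simp: d_def)
  have lim: "(\<lambda>n. real (d n) / real n) \<longlonglongrightarrow> c"
  proof (rule tendsto_sandwich)
    show "\<forall>\<^sub>F n in sequentially. c - 1 / real n \<le> real (d n) / real n"
      using eventually_gt_at_top [of 0]
    proof eventually_elim
      case (elim n)
      then show ?case using d(1) [of n] by (simp add: pos_le_divide_eq right_diff_distrib mult.commute)
    qed
    show "\<forall>\<^sub>F n in sequentially. real (d n) / real n \<le> c"
      using eventually_gt_at_top [of 0]
    proof eventually_elim
      case (elim n)
      then show ?case using d(2) [of n] by (simp add: field_simps)
    qed
    have "(\<lambda>n. c - 1 / real n) \<longlonglongrightarrow> c - 0" by (intro tendsto_intros lim_1_over_n)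
    then show "(\<lambda>n. c - 1 / real n) \<longlonglongrightarrow> c" by simp
  qed simp
  have "(\<lambda>n. (1 + 1 / real n) ^ n) \<longlonglongrightarrow> exp 1"
    using tendsto_exp_limit_sequentially [of 1] by simp
  then have "(\<lambda>n. ((1 + 1 / real n) ^ n) powr (real (d n) / real n)) \<longlonglongrightarrow> exp 1 powr c"
    using lim by (intro tendsto_powr) auto
  moreover have "exp 1 powr c = r" using r by (simp add: powr_def c_def)
  ultimately have "(\<lambda>n. ((1 + 1 / real n) ^ n) powr (real (d n) / real n)) \<longlonglongrightarrow> r" by simp
  moreover have "\<forall>\<^sub>F n in sequentially. ((1 + 1 / real n) ^ n) powr (real (d n) / real n) = (1 + 1 / real n) ^ d n"
    using eventually_gt_at_top [of 0]
  proof eventually_elim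
    case (elim n)
    define b where "b = 1 + 1 / real n"
    have "0 < b" by (simp add: b_def add_pos_nonneg)
    then have "(b ^ n) powr (real (d n) / real n) = b ^ d n"
      using elim by (simp add: powr_powr flip: powr_realpow)
    then show ?case unfolding b_def .
  qed
  ultimately have 1: "(\<lambda>n. (1 + 1 / real n) ^ d n) \<longlonglongrightarrow> r"
    by (rule Lim_transform_eventually)
  have "(\<lambda>n. 1 - real (d n) / real n * (1 / real n)) \<longlonglongrightarrow> 1 - c * 0"
    by (intro tendsto_intros lim lim_1_over_n)
  then have "(\<lambda>n. 1 - real (d n) / real n * (1 / real n)) \<longlonglongrightarrow> 1" by simp
  moreover have "\<forall>\<^sub>F n in sequentially. 1 - real (d n) / real n * (1 / real n) = real (n\<^sup>2 - d n) / (real n)\<^sup>2"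
    \<comment> \<open>From \<open>n \<ge> ln r\<close> on, \<open>d n\<close> is at most
      \<open>n\<^sup>2\<close> and the truncated difference is the true one.\<close>
    using eventually_gt_at_top [of 0] eventually_ge_at_top [of "nat \<lceil>c\<rceil>"]
  proof eventually_elim
    case (elim n)
    have "c \<le> real n" using elim(2) by linarith
    then have "real n * c \<le> real n * real n" by (intro mult_left_mono) auto
    then have "real (d n) \<le> real (n * n)" using d(2) [of n] by simp
    then have "d n \<le> n\<^sup>2" unfolding of_nat_le_iff power2_eq_square .
    then have "real (n\<^sup>2 - d n) = (real n)\<^sup>2 - real (d n)" by (simp add: of_nat_diff)
    then show ?case using elim(1) by (simp add: diff_divide_distrib power2_eq_square)
  qed
  ultimately have 2: "(\<lambda>n. real (n\<^sup>2 - d n) / (real n)\<^sup>2) \<longlonglongrightarrow> 1"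
    by (rule Lim_transform_eventually)
  show thesis by (rule that [OF 1 2])
qed

lemma clinear_limit:
  fixes X :: "'i \<Rightarrow> 'a::complex_vector \<Rightarrow> complex"
  assumes lin: "\<And>n. clinear (X n)" and lim: "\<And>a. ((\<lambda>n. X n a) \<longlongrightarrow> x a) H" and H: "H \<noteq> bot"
  shows "clinear x"
proof (rule clinearI)
  have Xadd: "X n (a + b) = X n a + X n b" and Xscale: "X n (c *\<^sub>C a) = c * X n a" for n a b c
  proof -
    interpret Vector_Spaces.linear scaleC scaleC "X n" by (rule lin)
    show "X n (a + b) = X n a + X n b" "X n (c *\<^sub>C a) = c * X n a"
      by (simp_all add: add scale scaleC_complex_def)
  qed
  fix a b :: 'a and c :: complex
  show "x (a + b) = x a + x b"
    using tendsto_unique [OF H lim [of "a + b"]] tendsto_add [OF lim [of a] lim [of b]] by (simp add: Xadd)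
  show "x (c *\<^sub>C a) = c *\<^sub>C x a"
    using tendsto_unique [OF H lim [of "c *\<^sub>C a"]] tendsto_mult_left [OF lim [of a], of c]
    by (simp add: Xscale scaleC_complex_def)
qed

context contraction_into_R
begin

text \<open>The cluster point is chosen before \<open>r\<close>: the approximating pair of
  functionals serves all distances \<open>d\<close> at once, so for a given \<open>r\<close> only
  \<open>d\<close> has to be adapted to \<open>n\<close>.\<close>

lemma limit_functionals:
  obtains f g :: "'a \<Rightarrow> complex"
  where "clinear f" and "clinear g" and "\<And>y. cmod (f y) \<le> norm y" and "\<And>y. cmod (g y) \<le> norm y"
    and "\<And>a. norm a \<le> 1 \<Longrightarrow> 0 \<le> Re (f (star a * a))"
    and "\<And>a. norm a \<le> 1 \<Longrightarrow> 0 \<le> Re (g (a * star a))"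
    and "\<And>r a. 0 < r \<Longrightarrow> norm a \<le> 1 \<Longrightarrow>
      r powr \<theta> * (norm (u a))\<^sup>2 \<le> Re (f (star a * a)) + r * Re (g (a * star a))"
proof -
  define P where "P = (\<lambda>n (f :: 'a \<Rightarrow> complex) (g :: 'a \<Rightarrow> complex). clinear f \<and> clinear g
    \<and> (\<forall>y. cmod (f y) \<le> norm y) \<and> (\<forall>y. cmod (g y) \<le> norm y)
    \<and> (\<forall>a. norm a \<le> 1 \<longrightarrow> - (1 / real n) \<le> Re (f (star a * a)))
    \<and> (\<forall>a. norm a \<le> 1 \<longrightarrow> - (1 / real n) \<le> Re (g (a * star a)))
    \<and> (\<forall>r a d. r = (1 + 1 / real n) ^ d \<or> r = 1 / (1 + 1 / real n) ^ d \<longrightarrow> norm a \<le> 1 \<longrightarrow>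
      real (n\<^sup>2 - d) / (real n)\<^sup>2 * (r powr \<theta> * (norm (u a))\<^sup>2)
        \<le> (Re (f (star a * a)) + 1 / real n) + r * (Re (g (a * star a)) + 1 / real n)))"
  \<comment> \<open>The approximations begin at \<open>n = 1\<close>, which explains the shifts by
    \<open>Suc\<close> from here on.\<close>
  have "\<exists>f g. P (Suc n) f g" for n
    using geometric_functionals [of "Suc n"] unfolding P_def by (metis (full_types) le_add1 plus_1_eq_Suc)
  then obtain f g where fg: "\<And>n. P (Suc n) (f n) (g n)" by metis
  define K where "K = {h :: 'a \<Rightarrow> complex. \<forall>a. cmod (h a) \<le> norm a}"
  have "compact (K \<times> K)"
    unfolding K_def by (intro compact_Times compact_Pi_cball)
  moreover have "(f n, g n) \<in> K \<times> K" for n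
    using fg [of n] by (simp add: P_def K_def)
  ultimately obtain x H where H: "H \<noteq> bot" "H \<le> sequentially" and "((\<lambda>n. (f n, g n)) \<longlongrightarrow> x) H"
    using compact_subfilter [of "K \<times> K" "\<lambda>n. (f n, g n)"] by blast
  moreover define f' g' where "f' = fst x" and "g' = snd x"
  ultimately have "(f \<longlongrightarrow> f') H" "(g \<longlongrightarrow> g') H"
    using tendsto_fst [of "\<lambda>n. (f n, g n)" x H] tendsto_snd [of "\<lambda>n. (f n, g n)" x H] by simp_all
  then have f: "((\<lambda>n. f n a) \<longlongrightarrow> f' a) H" and g: "((\<lambda>n. g n a) \<longlongrightarrow> g' a) H" for a
    by (auto intro: tendsto_coordinate)
  have inv: "((\<lambda>n. 1 / real (Suc n)) \<longlongrightarrow> 0) H"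
    using LIMSEQ_inverse_real_of_nat H(2) by (auto simp: inverse_eq_divide intro: tendsto_mono)
  show thesis
  proof (rule that [of f' g'])
    show "clinear f'" "clinear g'"
      using fg by (auto simp: P_def intro: clinear_limit [OF _ f H(1)] clinear_limit [OF _ g H(1)])
    show "cmod (f' y) \<le> norm y" for y
    proof (rule tendsto_upperbound [OF tendsto_norm [OF f] _ H(1)])
      show "\<forall>\<^sub>F n in H. cmod (f n y) \<le> norm y"
        using fg by (intro always_eventually allI) (simp add: P_def)
    qed
    show "cmod (g' y) \<le> norm y" for y
    proof (rule tendsto_upperbound [OF tendsto_norm [OF g] _ H(1)])
      show "\<forall>\<^sub>F n in H. cmod (g n y) \<le> norm y"
        using fg by (intro always_eventually allI) (simp add: P_def)
    qed
    fix a :: 'a assume a: "norm a \<le> 1"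
    show "0 \<le> Re (f' (star a * a))"
    proof (rule tendsto_le [OF H(1) tendsto_Re [OF f]])
      show "((\<lambda>n. - (1 / real (Suc n))) \<longlongrightarrow> 0) H" using tendsto_minus [OF inv] by simp
    qed (use fg a in \<open>auto simp: P_def intro!: always_eventually\<close>)
    show "0 \<le> Re (g' (a * star a))"
    proof (rule tendsto_le [OF H(1) tendsto_Re [OF g]])
      show "((\<lambda>n. - (1 / real (Suc n))) \<longlongrightarrow> 0) H" using tendsto_minus [OF inv] by simp
    qed (use fg a in \<open>auto simp: P_def intro!: always_eventually\<close>)
    fix r :: real assume r: "0 < r"
    \<comment> \<open>Ratios below 1 are reached through reciprocals of powers that approximate
      \<open>1 / r\<close>.\<close>
    have "\<exists>d. (\<lambda>n. real (n\<^sup>2 - d n) / (real n)\<^sup>2) \<longlonglongrightarrow> 1 \<and>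
      ((\<lambda>n. (1 + 1 / real n) ^ d n) \<longlonglongrightarrow> r \<or> (\<lambda>n. 1 / (1 + 1 / real n) ^ d n) \<longlonglongrightarrow> r)"
    proof (cases "1 \<le> r")
      case True
      from powers_approximate [OF this] show ?thesis by blast
    next
      case False
      then have "1 \<le> 1 / r" using r by simp
      then obtain d where d: "(\<lambda>n. (1 + 1 / real n) ^ d n) \<longlonglongrightarrow> 1 / r"
        "(\<lambda>n. real (n\<^sup>2 - d n) / (real n)\<^sup>2) \<longlonglongrightarrow> 1"
        by (rule powers_approximate)
      have "(\<lambda>n. 1 / (1 + 1 / real n) ^ d n) \<longlonglongrightarrow> 1 / (1 / r)"
        using r by (intro tendsto_divide d tendsto_const) simp
      then show ?thesis using d(2) r by (intro exI [of _ d]) simp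
    qed
    then obtain d \<rho> where d: "(\<lambda>n. real (n\<^sup>2 - d n) / (real n)\<^sup>2) \<longlonglongrightarrow> 1"
      and \<rho>: "\<rho> \<longlonglongrightarrow> r" "\<And>n. \<rho> n = (1 + 1 / real n) ^ d n \<or> \<rho> n = 1 / (1 + 1 / real n) ^ d n"
      by fastforce
    have d': "((\<lambda>n. real ((Suc n)\<^sup>2 - d (Suc n)) / (real (Suc n))\<^sup>2) \<longlongrightarrow> 1) H"
      using filterlim_compose [OF d filterlim_Suc] H(2) by (rule tendsto_mono [rotated])
    have \<rho>': "((\<lambda>n. \<rho> (Suc n)) \<longlongrightarrow> r) H"
      using filterlim_compose [OF \<rho>(1) filterlim_Suc] H(2) by (rule tendsto_mono [rotated])
    have "1 * (r powr \<theta> * (norm (u a))\<^sup>2) \<le> (Re (f' (star a * a)) + 0) + r * (Re (g' (a * star a)) + 0)"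
    proof (rule tendsto_le [OF H(1)])
      show "((\<lambda>n. real ((Suc n)\<^sup>2 - d (Suc n)) / (real (Suc n))\<^sup>2 * (\<rho> (Suc n) powr \<theta> * (norm (u a))\<^sup>2))
          \<longlongrightarrow> 1 * (r powr \<theta> * (norm (u a))\<^sup>2)) H"
        using r by (intro tendsto_intros d' \<rho>') simp
      show "((\<lambda>n. (Re (f n (star a * a)) + 1 / real (Suc n)) + \<rho> (Suc n) * (Re (g n (a * star a)) + 1 / real (Suc n)))
          \<longlongrightarrow> (Re (f' (star a * a)) + 0) + r * (Re (g' (a * star a)) + 0)) H"
        by (intro tendsto_intros f g inv \<rho>')
      show "\<forall>\<^sub>F n in H. real ((Suc n)\<^sup>2 - d (Suc n)) / (real (Suc n))\<^sup>2 * (\<rho> (Suc n) powr \<theta> * (norm (u a))\<^sup>2)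
          \<le> (Re (f n (star a * a)) + 1 / real (Suc n)) + \<rho> (Suc n) * (Re (g n (a * star a)) + 1 / real (Suc n))"
      proof (rule always_eventually, rule allI)
        fix n
        show "real ((Suc n)\<^sup>2 - d (Suc n)) / (real (Suc n))\<^sup>2 * (\<rho> (Suc n) powr \<theta> * (norm (u a))\<^sup>2)
          \<le> (Re (f n (star a * a)) + 1 / real (Suc n)) + \<rho> (Suc n) * (Re (g n (a * star a)) + 1 / real (Suc n))"
          using fg [of n] \<rho>(2) [of "Suc n"] a unfolding P_def by blast
      qed
    qed
    then show "r powr \<theta> * (norm (u a))\<^sup>2 \<le> Re (f' (star a * a)) + r * Re (g' (a * star a))" by simp
  qed
qed

end

section \<open>States\<close>

lemma norm_star: "norm (star a) = norm a" for a :: "'a::cstar_algebra"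
proof (rule antisym)
  have le: "norm b \<le> norm (star b)" for b :: 'a
  proof (cases "b = 0")
    case False
    have "norm b * norm b \<le> norm (star b) * norm b"
      using norm_mult_ineq [of "star b" b] by (simp add: cstar_identity power2_eq_square)
    then show ?thesis using False by simp
  qed simp
  show "norm a \<le> norm (star a)" by (rule le)
  show "norm (star a) \<le> norm a" using le [of "star a"] by (simp add: star_star)
qed

definition positive_functional :: "('a::cstar_algebra \<Rightarrow> complex) \<Rightarrow> bool" where
  "positive_functional f \<longleftrightarrow> clinear f \<and> (\<forall>a. f (star a * a) \<in> \<real>\<^sub>\<ge>\<^sub>0)"

lemma clinear_bounded:
  fixes f :: "'a::complex_normed_vector \<Rightarrow> complex"
  assumes "clinear f" and "\<And>a. cmod (f a) \<le> K * norm a"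
  shows "bounded_linear f"
proof -
  interpret Vector_Spaces.linear scaleC scaleC f by (rule assms)
  show ?thesis
    by (rule bounded_linear_intro [where K = K])
      (use assms(2) in \<open>simp_all add: add scale scaleR_scaleC scaleC_complex_def mult.commute\<close>)
qed

lemma normalise_functional:
  fixes f :: "'a::cstar_algebra \<Rightarrow> complex"
  assumes f: "positive_functional f" and bound: "\<And>a. cmod (f a) \<le> K * norm a" and nz: "f b \<noteq> 0"
  shows "0 < onorm f" and "state (\<lambda>a. complex_of_real (inverse (onorm f)) * f a)"
proof -
  have lin: "clinear f" using f by (simp add: positive_functional_def)
  have bl: "bounded_linear f" by (rule clinear_bounded [OF lin bound])
  then show pos: "0 < onorm f" using nz by (auto simp: onorm_pos_lt)
  have "bounded_linear (\<lambda>a. complex_of_real (inverse (onorm f)) * f a)"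
    by (rule bounded_linear_const_mult [OF bl])
  moreover have "onorm (\<lambda>a. inverse (onorm f) *\<^sub>R f a) = \<bar>inverse (onorm f)\<bar> * onorm f"
    by (rule onorm_scaleR [OF bl])
  then have "onorm (\<lambda>a. complex_of_real (inverse (onorm f)) * f a) = 1"
    using pos by (simp add: scaleR_conv_of_real)
  moreover have "clinear (\<lambda>a. complex_of_real (inverse (onorm f)) * f a)"
  proof -
    interpret Vector_Spaces.linear scaleC scaleC f by (rule lin)
    show ?thesis by (rule clinearI) (simp_all add: add scale scaleC_complex_def algebra_simps)
  qed
  moreover have "complex_of_real (inverse (onorm f)) * f (star a * a) \<in> \<real>\<^sub>\<ge>\<^sub>0" for a
    using f pos by (intro nonneg_Reals_mult_I) (auto simp: positive_functional_def)
  ultimately show "state (\<lambda>a. complex_of_real (inverse (onorm f)) * f a)"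
    by (simp add: state_def)
qed

text \<open>A vector state, normalised, at a vector not annihilated by some element. It supplies a
  state when the functional to be dominated vanishes on all squares.\<close>

lemma (in representation) state_exists:
  assumes "\<exists>a::'a. a \<noteq> 0"
  obtains f :: "'a \<Rightarrow> complex" where "state f"
proof -
  obtain a :: 'a where "a \<noteq> 0" using assms by blast
  then have "\<pi> a \<noteq> 0" using pi_norm [of a] by auto
  then obtain \<xi> where \<xi>: "\<pi> a \<xi> \<noteq> 0" by (metis blinfun_eqI blinfun.zero_left)
  define f where "f = (\<lambda>a. cinner \<xi> (\<pi> a \<xi>))"
  have sq: "f (star a * a) = complex_of_real ((norm (\<pi> a \<xi>))\<^sup>2)" for a
    by (simp add: f_def pi_mult cinner_self flip: pi_star)
  have "positive_functional f"
    unfolding positive_functional_def sq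
    by (auto intro!: clinearI simp: f_def pi_add pi_scale blinfun.add_left scaleC_blinfun.rep_eq
        cinner_add_right cinner_scaleC_right scaleC_complex_def)
  moreover have "cmod (f a) \<le> (norm \<xi>)\<^sup>2 * norm a" for a
  proof -
    have "cmod (f a) \<le> norm \<xi> * norm (\<pi> a \<xi>)" unfolding f_def by (rule cmod_cinner_le)
    also have "\<dots> \<le> norm \<xi> * (norm a * norm \<xi>)"
      using norm_blinfun [of "\<pi> a" \<xi>] by (intro mult_left_mono) (simp_all add: pi_norm)
    finally show ?thesis by (simp add: power2_eq_square mult_ac)
  qed
  moreover have "f (star a * a) \<noteq> 0" unfolding sq using \<xi> by simp
  ultimately show thesis using normalise_functional(2) that by blast
qed

text \<open>The hermitian part \<open>k\<close> of \<open>f\<close> is a positive functional of norm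
  at most 1 whose value on a square is the real part of that of \<open>f\<close>. Normalising
  \<open>k\<close> can therefore only increase these values; if \<open>k = 0\<close>, any state will
  do.\<close>

lemma (in representation) state_dominating:
  fixes f :: "'a \<Rightarrow> complex"
  assumes nz: "\<exists>a::'a. a \<noteq> 0" and lin: "clinear f" and bound: "\<And>a. cmod (f a) \<le> norm a"
    and pos: "\<And>a. norm a \<le> 1 \<Longrightarrow> 0 \<le> Re (f (star a * a))"
  obtains h where "state h" and "\<And>a. Re (f (star a * a)) \<le> Re (h (star a * a))"
proof -
  interpret f: Vector_Spaces.linear scaleC scaleC f by (rule lin)
  define k where "k = (\<lambda>a. (f a + cnj (f (star a))) / 2)"
  have kself: "k (star a * a) = complex_of_real (Re (f (star a * a)))" for a
    by (simp add: k_def star_mult star_star complex_eq_iff)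
  have Re_nonneg: "0 \<le> Re (f (star a * a))" for a
  proof (cases "a = 0")
    case False
    \<comment> \<open>Positivity is assumed on the unit ball only and extends to all of
      \<open>A\<close> by scaling.\<close>
    define c where "c = complex_of_real (inverse (norm a))"
    have "0 \<le> Re (f (star (c *\<^sub>C a) * (c *\<^sub>C a)))"
      using False by (intro pos) (simp add: c_def norm_scaleC norm_inverse)
    moreover have "star (c *\<^sub>C a) * (c *\<^sub>C a) = complex_of_real ((inverse (norm a))\<^sup>2) *\<^sub>C (star a * a)"
      by (simp add: c_def star_scaleC mult_scaleC_left mult_scaleC_right scaleC_scaleC power2_eq_square)
    ultimately have "0 \<le> (inverse (norm a))\<^sup>2 * Re (f (star a * a))"
      by (simp add: f.scale scaleC_complex_def del: of_real_power)
    then show ?thesis using False by (simp add: zero_le_mult_iff)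
  qed (simp add: f.zero)
  have k: "positive_functional k"
    unfolding positive_functional_def kself using Re_nonneg
    by (auto intro!: clinearI simp: k_def star_add star_scaleC f.add f.scale scaleC_complex_def field_simps)
  have kbound: "cmod (k a) \<le> 1 * norm a" for a
    using norm_triangle_ineq [of "f a" "cnj (f (star a))"] bound [of a] bound [of "star a"]
    by (simp add: k_def norm_divide norm_star)
  show thesis
  proof (cases "\<exists>b. k b \<noteq> 0")
    case True
    then obtain b where b: "k b \<noteq> 0" by blast
    note h = normalise_functional [OF k kbound b]
    have "onorm k \<le> 1" by (rule onorm_bound) (use kbound in auto)
    then have inv: "1 \<le> inverse (onorm k)" using h(1) by (simp add: one_le_inverse)
    show thesis
    proof (rule that [OF h(2)])
      fix a
      show "Re (f (star a * a)) \<le> Re (complex_of_real (inverse (onorm k)) * k (star a * a))"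
        using mult_right_mono [OF inv Re_nonneg [of a]]
        unfolding kself of_real_mult [symmetric] Re_complex_of_real by simp
    qed
  next
    case False
    obtain h :: "'a \<Rightarrow> complex" where h: "state h" by (rule state_exists [OF nz])
    show thesis
    proof (rule that [OF h])
      fix a
      have "Re (f (star a * a)) = 0" using False kself [of a] by simp
      moreover have "0 \<le> Re (h (star a * a))"
        using h by (simp add: state_def complex_nonneg_Reals_iff)
      ultimately show "Re (f (star a * a)) \<le> Re (h (star a * a))" by simp
    qed
  qed
qed

section \<open>Optimising over the ratio and passing to states\<close>

lemma c_const_ge_1:
  assumes "0 < \<theta>" "\<theta> < 1"
  shows "1 \<le> c_const \<theta>"
proof -
  have "\<theta> powr \<theta> * (1 - \<theta>) powr (1 - \<theta>) \<le> 1 * 1"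
    using assms by (intro mult_mono powr_le1) auto
  then show ?thesis using assms unfolding c_const_def by (intro one_le_inverse) auto
qed

text \<open>The quotient of \<open>F + r * G\<close> by \<open>r powr \<theta>\<close> is smallest
  at \<open>r = \<theta> * F / ((1 - \<theta>) * G)\<close>, where its value is the claimed bound.
  If \<open>F = 0\<close> a small \<open>r\<close>, and if \<open>G = 0\<close> a large one, forces
  \<open>x = 0\<close>.\<close>

lemma optimise_ratio:
  assumes \<theta>: "0 < \<theta>" "\<theta> < 1" and F: "0 \<le> F" and G: "0 \<le> G" and x: "0 \<le> x"
    and le: "\<And>r. 0 < r \<Longrightarrow> r powr \<theta> * x \<le> F + r * G"
  shows "x \<le> c_const \<theta> * (F powr (1 - \<theta>) * G powr \<theta>)"
proof (cases "F = 0 \<or> G = 0")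
  case False
  then have FG: "0 < F" "0 < G" using F G by auto
  define r where "r = \<theta> * F / ((1 - \<theta>) * G)"
  have r: "0 < r" using FG \<theta> by (simp add: r_def)
  have "F + r * G = F / (1 - \<theta>)" using FG \<theta> by (simp add: r_def field_simps)
  then have "r powr \<theta> * x \<le> F / (1 - \<theta>)" using le [OF r] by simp
  then have "x \<le> F / (1 - \<theta>) / r powr \<theta>"
    using r \<theta> by (simp add: divide_simps mult_ac)
  also have "r powr \<theta> = \<theta> powr \<theta> * F powr \<theta> / ((1 - \<theta>) powr \<theta> * G powr \<theta>)"
    using FG \<theta> by (simp add: r_def powr_divide powr_mult)
  also have "F / (1 - \<theta>) / (\<theta> powr \<theta> * F powr \<theta> / ((1 - \<theta>) powr \<theta> * G powr \<theta>))
      = inverse (\<theta> powr \<theta> * ((1 - \<theta>) / (1 - \<theta>) powr \<theta>)) * (F / F powr \<theta> * G powr \<theta>)"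
    using FG \<theta> by (simp add: field_simps)
  also have "F / F powr \<theta> = F powr (1 - \<theta>)" using FG by (simp add: powr_diff)
  also have "(1 - \<theta>) / (1 - \<theta>) powr \<theta> = (1 - \<theta>) powr (1 - \<theta>)" using \<theta> by (simp add: powr_diff)
  finally show ?thesis by (simp add: c_const_def)
next
  case True
  have "x \<le> 0"
  proof (rule ccontr)
    assume "\<not> x \<le> 0"
    then have x: "0 < x" by simp
    from True show False
    proof
      assume "F = 0"
      then have le': "r powr \<theta> * x \<le> r * G" if "0 < r" for r using le [OF that] by simp
      \<comment> \<open>Chosen so that \<open>x\<close> equals
        \<open>r powr (1 - \<theta>) * (G + 1)\<close>, more than the permitted
        \<open>r powr (1 - \<theta>) * G\<close>; the summand 1 also covers
        \<open>G = 0\<close>.\<close>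
      define r where "r = (x / (G + 1)) powr (1 / (1 - \<theta>))"
      have r: "0 < r" using x G by (simp add: r_def)
      have "r powr (1 - \<theta>) = x / (G + 1)" using x G \<theta> by (simp add: r_def powr_powr)
      then have "x = r powr (1 - \<theta>) * (G + 1)" using G by (simp add: field_simps)
      then have "r powr \<theta> * x = r powr \<theta> * r powr (1 - \<theta>) * (G + 1)" by simp
      also have "r powr \<theta> * r powr (1 - \<theta>) = r" using r by (simp flip: powr_add)
      finally show False using le' [OF r] r by (simp add: algebra_simps)
    next
      assume "G = 0"
      then have le': "r powr \<theta> * x \<le> F" if "0 < r" for r using le [OF that] by simp
      define r where "r = ((F + 1) / x) powr (1 / \<theta>)"
      have r: "0 < r" using x F by (simp add: r_def)
      have "r powr \<theta> = (F + 1) / x" using x F \<theta> by (simp add: r_def powr_powr)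
      then show False using le' [OF r] x by simp
    qed
  qed
  then show ?thesis using x True \<theta> by auto
qed

theorem theorem1:
  fixes \<theta> :: real
    and \<pi> :: "'a::cstar_algebra \<Rightarrow> 'h::complex_hilbert \<Rightarrow>\<^sub>L 'h"
    and u :: "'a \<Rightarrow> ell2"
  assumes "0 < \<theta>" and "\<theta> < 1"
    and "\<exists>a::'a. a \<noteq> 0"
    and "faithful_representation \<pi>"
    and "completely_contractive (opspace_norm \<pi>) (R_interp_norm \<theta>) u"
  shows "\<exists>f g. state f \<and> state g \<and>
    (\<forall>a. norm (u a) \<le> c_const \<theta>
        * Re (f (star a * a)) powr ((1 - \<theta>) / 2)
        * Re (g (a * star a)) powr (\<theta> / 2))"
proof -
  interpret contraction_into_R \<pi> \<theta> u
    using assms by unfold_locales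
  obtain f0 g0 :: "'a \<Rightarrow> complex" where lin: "clinear f0" "clinear g0"
    and bound: "\<And>y. cmod (f0 y) \<le> norm y" "\<And>y. cmod (g0 y) \<le> norm y"
    and pos: "\<And>a. norm a \<le> 1 \<Longrightarrow> 0 \<le> Re (f0 (star a * a))"
      "\<And>a. norm a \<le> 1 \<Longrightarrow> 0 \<le> Re (g0 (a * star a))"
    and ineq: "\<And>r a. 0 < r \<Longrightarrow> norm a \<le> 1 \<Longrightarrow>
      r powr \<theta> * (norm (u a))\<^sup>2 \<le> Re (f0 (star a * a)) + r * Re (g0 (a * star a))"
    using limit_functionals by blast
  obtain f where f: "state f" "\<And>a. Re (f0 (star a * a)) \<le> Re (f (star a * a))"
    using state_dominating [OF assms(3) lin(1) bound(1) pos(1)] by blast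
  \<comment> \<open>Positivity of \<open>g0\<close> is known on products \<open>a * star a\<close>;
    substituting \<open>star a\<close> brings it into the form that \<open>state_dominating\<close>
    expects.\<close>
  have "0 \<le> Re (g0 (star a * a))" if "norm a \<le> 1" for a
    using pos(2) [of "star a"] that by (simp add: star_star norm_star)
  then obtain g where g: "state g" "\<And>a. Re (g0 (star a * a)) \<le> Re (g (star a * a))"
    using state_dominating [OF assms(3) lin(2) bound(2)] by blast
  have g': "Re (g0 (a * star a)) \<le> Re (g (a * star a))" for a
    using g(2) [of "star a"] by (simp add: star_star)
  have fpos: "0 \<le> Re (f (star a * a))" and gpos: "0 \<le> Re (g (a * star a))" for a
    using f(1) g(1) star_star [of a] unfolding state_def complex_nonneg_Reals_iff by metis+
  have unit: "(norm (u a))\<^sup>2 \<le> c_const \<theta> * (Re (f (star a * a)) powr (1 - \<theta>) * Re (g (a * star a)) powr \<theta>)"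
    if a: "norm a \<le> 1" for a
  proof (rule optimise_ratio [OF assms(1,2) fpos gpos])
    fix r :: real assume r: "0 < r"
    have "r * Re (g0 (a * star a)) \<le> r * Re (g (a * star a))"
      using r g' [of a] by (intro mult_left_mono) auto
    then show "r powr \<theta> * (norm (u a))\<^sup>2 \<le> Re (f (star a * a)) + r * Re (g (a * star a))"
      using order_trans [OF ineq [OF r a] add_mono [OF f(2)]] by blast
  qed simp
  have c: "1 \<le> c_const \<theta>" by (rule c_const_ge_1 [OF assms(1,2)])
  have unit': "norm (u a) \<le> c_const \<theta> * Re (f (star a * a)) powr ((1 - \<theta>) / 2) * Re (g (a * star a)) powr (\<theta> / 2)"
    if a: "norm a \<le> 1" for a
  proof (rule power2_le_imp_le)
    have sq: "(x powr (s / 2))\<^sup>2 = x powr s" for x s :: real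
      by (simp add: power2_eq_square flip: powr_add)
    \<comment> \<open>The estimate before taking roots has the constant to the first power, and
      \<open>1 \<le> c_const \<theta>\<close> allows its square.\<close>
    have "c_const \<theta> * (Re (f (star a * a)) powr (1 - \<theta>) * Re (g (a * star a)) powr \<theta>)
        \<le> (c_const \<theta>)\<^sup>2 * (Re (f (star a * a)) powr (1 - \<theta>) * Re (g (a * star a)) powr \<theta>)"
      using c by (intro mult_right_mono) (auto simp: power2_eq_square)
    also have "\<dots> = (c_const \<theta> * Re (f (star a * a)) powr ((1 - \<theta>) / 2) * Re (g (a * star a)) powr (\<theta> / 2))\<^sup>2"
      by (simp only: power_mult_distrib sq mult.assoc)
    finally show "(norm (u a))\<^sup>2 \<le> (c_const \<theta> * Re (f (star a * a)) powr ((1 - \<theta>) / 2) * Re (g (a * star a)) powr (\<theta> / 2))\<^sup>2"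
      using unit [OF a] by linarith
    show "0 \<le> c_const \<theta> * Re (f (star a * a)) powr ((1 - \<theta>) / 2) * Re (g (a * star a)) powr (\<theta> / 2)"
      using c by simp
  qed
  have "norm (u a) \<le> c_const \<theta> * Re (f (star a * a)) powr ((1 - \<theta>) / 2) * Re (g (a * star a)) powr (\<theta> / 2)"
    for a
  proof (cases "a = 0")
    case True
    then show ?thesis using c by (simp add: u_zero)
  next
    case False
    \<comment> \<open>Both sides are homogeneous of degree 1 in \<open>a\<close>: the powers
      \<open>1 - \<theta>\<close> and \<open>\<theta>\<close> of \<open>s\<close> multiply to
      \<open>s\<close>, which cancels.\<close>
    define s where "s = inverse (norm a)"
    have s: "0 < s" using False by (simp add: s_def)
    let ?b = "complex_of_real s *\<^sub>C a"
    have nb: "norm ?b \<le> 1" using False by (simp add: s_def norm_scaleC norm_inverse)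
    have prod: "star ?b * ?b = complex_of_real (s\<^sup>2) *\<^sub>C (star a * a)" "?b * star ?b = complex_of_real (s\<^sup>2) *\<^sub>C (a * star a)"
      by (simp_all add: star_scaleC mult_scaleC_left mult_scaleC_right scaleC_scaleC power2_eq_square)
    have hom: "Re (h (complex_of_real (s\<^sup>2) *\<^sub>C y)) = s\<^sup>2 * Re (h y)" if "state h" for h y
    proof -
      interpret Vector_Spaces.linear scaleC scaleC h using that by (simp add: state_def)
      show ?thesis by (simp add: scale scaleC_complex_def del: of_real_power)
    qed
    have pw: "(s\<^sup>2 * y) powr (t / 2) = s powr t * y powr (t / 2)" if "0 \<le> y" for y t
    proof -
      have "s\<^sup>2 = s powr 2" using s by simp
      then have "(s\<^sup>2) powr (t / 2) = s powr t" using powr_powr [of s 2 "t / 2"] by simp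
      then show ?thesis using s that by (simp add: powr_mult)
    qed
    have "s * norm (u a) \<le> c_const \<theta> * (s\<^sup>2 * Re (f (star a * a))) powr ((1 - \<theta>) / 2)
        * (s\<^sup>2 * Re (g (a * star a))) powr (\<theta> / 2)"
      using unit' [OF nb] s unfolding prod hom [OF f(1)] hom [OF g(1)] by (simp add: u_scale norm_scaleC)
    also have "\<dots> = (s powr (1 - \<theta>) * s powr \<theta>)
        * (c_const \<theta> * Re (f (star a * a)) powr ((1 - \<theta>) / 2) * Re (g (a * star a)) powr (\<theta> / 2))"
      unfolding pw [OF fpos] pw [OF gpos] by (simp only: mult_ac)
    also have "s powr (1 - \<theta>) * s powr \<theta> = s" using s by (simp flip: powr_add)
    finally show ?thesis using s by simp
  qed
  then show ?thesis using f(1) g(1) by blast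
qed

end
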